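(* Let $n\ge1$ be an integer, $-1<\ell<0$, $\beta\ge0$, $\mu\in\mathbb R$, $p>1$, and assume $\delta:=(1-\beta)^2-4\mu^2<0$. Let $f,g\in C_c^\infty(\mathbb R^n)$ with $f\ge0$, $g\ge0$, $(f,g)\not\equiv(0,0)$. Consider finite-propagation weak solutions $w$ of $$w_{tt}-(1+t)^{2\ell}\Delta w+\frac{\beta}{1+t}w_t+\frac{\mu^2}{(1+t)^2}w=|w|^p,\qquad w(x,0)=\varepsilon f(x),\quad w_t(x,0)=\varepsilon g(x).$$ (i) If $n(1+\ell)+\beta\le1$, then no global weak solution exists for any $p>1$ and any $\varepsilon>0$. (ii) If $n(1+\ell)+\beta>1$ and $1<p<p_{\mathrm{Str}}\big(n+\frac{\beta}{1+\ell},\ell\big)$, then no global weak solution exists for any $\varepsilon>0$. In either case, there exist $\varepsilon_0>0$ and $C>0$, independent of $\varepsilon$, such that for every $0<\varepsilon\le\varepsilon_0$, the lifespan $T_\varepsilon$ of $w$ (i.e. any $T_\varepsilon$ such that a weak solution $w$ is defined on $[0,T_\varepsilon)$) satisfies $$T_\varepsilon\le C\,\varepsilon^{\frac{2p(p-1)}{(1+\ell)\gamma_{\alpha_\beta}(n,\ell;p)}},\qquad \alpha_\beta=\frac{\beta}{2}(p-1).$$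
   Context: For $\alpha\ge0$, $$\gamma_\alpha(n,\ell;p)=\Big(n-1+\frac{\ell}{1+\ell}\Big)p^2-\Big(n+1-\frac{3\ell+2\alpha}{1+\ell}\Big)p-2.$$ For real $N$ with $N-1+\frac{\ell}{1+\ell}>0$, $p_{\mathrm{Str}}(N,\ell)$ denotes the unique positive root $p$ of $\big(N-1+\frac{\ell}{1+\ell}\big)p^2-\big(N+1-\frac{3\ell}{1+\ell}\big)p-2=0$. Set $A(t)=\int_0^t(1+s)^\ell\,ds$. $B_r$ is the ball of radius $r$ centred at $0$. Finite-propagation weak solution. Let $R_0>0$ be such that $\operatorname{supp}f\cup\operatorname{supp}g\subset B_{R_0}$, and let $T\in(0,\infty]$. A function $w$ is a weak solution on $[0,T)$ if: (i) $w\in C^1([0,T);L^1_{\rm loc}(\mathbb R^n))\cap L^p_{\rm loc}([0,T)\times\mathbb R^n)$; (ii) $\operatorname{supp}w(\cdot,t)\cup\operatorname{supp}w_t(\cdot,t)\subset B_{R_0+A(t)}$ for all $t\in[0,T)$; (iii) for every $\phi\in C_c^\infty(\mathbb R^n\times[0,T))$, $$\int_0^T\!\!\int_{\mathbb R^n}w\Big(\phi_{tt}-(1+t)^{2\ell}\Delta\phi-\Big(\frac{\beta}{1+t}\phi\Big)_t+\frac{\mu^2}{(1+t)^2}\phi\Big)dx\,dt=\int_0^T\!\!\int_{\mathbb R^n}|w|^p\phi\,dx\,dt+\varepsilon\int_{\mathbb R^n}\big((g+\beta f)\phi(x,0)-f\phi_t(x,0)\big)dx.$$ A global weak solution is a weak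 solution on $[0,\infty)$. Nonexistence holds for every choice of $R_0$; in the lifespan estimate $R_0$ is fixed (independent of $\varepsilon$) and $\varepsilon_0,C$ may depend on $R_0,n,\ell,\beta,\mu,p,f,g$. *)

theory Defs
  imports "HOL-Analysis.Analysis"
begin

primrec Ck :: "nat \<Rightarrow> ('a::euclidean_space \<Rightarrow> real) \<Rightarrow> bool" where
  "Ck 0 u \<longleftrightarrow> continuous_on UNIV u"
| "Ck (Suc k) u \<longleftrightarrow> u differentiable_on UNIV \<and>
     (\<forall>b\<in>Basis. Ck k (\<lambda>x. frechet_derivative u (at x) b))"

definition tsupport :: "('a::euclidean_space \<Rightarrow> real) \<Rightarrow> 'a set" where
  "tsupport u = closure {x. u x \<noteq> 0}"

definition Cc_infty :: "('a::euclidean_space \<Rightarrow> real) set" where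
  "Cc_infty = {u. (\<forall>k. Ck k u) \<and> compact (tsupport u)}"

definition laplacian :: "('a::euclidean_space \<Rightarrow> real) \<Rightarrow> 'a \<Rightarrow> real" where
  "laplacian u x = (\<Sum>b\<in>Basis. (deriv ^^ 2) (\<lambda>h. u (x + h *\<^sub>R b)) 0)"

definition Lp_loc_on :: "real \<Rightarrow> 'a::euclidean_space set \<Rightarrow> ('a \<Rightarrow> real) \<Rightarrow> bool" where
  "Lp_loc_on p S u \<longleftrightarrow> u \<in> borel_measurable (lebesgue_on S) \<and>
     (\<forall>K. compact K \<and> K \<subseteq> S \<longrightarrow> (\<lambda>x. \<bar>u x\<bar> powr p) absolutely_integrable_on K)"

definition ess_support :: "('a::euclidean_space \<Rightarrow> real) \<Rightarrow> 'a set" where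
  "ess_support u = - \<Union>{U. open U \<and> (AE x in lebesgue. x \<in> U \<longrightarrow> u x = 0)}"

definition L1_loc_continuous_on :: "real set \<Rightarrow> (real \<Rightarrow> 'a::euclidean_space \<Rightarrow> real) \<Rightarrow> bool" where
  "L1_loc_continuous_on I u \<longleftrightarrow>
     (\<forall>t\<in>I. Lp_loc_on 1 UNIV (u t)) \<and>
     (\<forall>t\<in>I. \<forall>K. compact K \<longrightarrow>
        ((\<lambda>s. LINT x:K|lebesgue. \<bar>u s x - u t x\<bar>) \<longlongrightarrow> 0) (at t within I))"

text \<open>\<open>u\<close> is a \<open>C\<^sup>1\<close> curve from \<open>I\<close> to the space of locally integrable functions, with derivative \<open>v\<close>
  (unique up to null sets at each time, unless \<open>I\<close> has isolated points).\<close>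

definition L1_loc_C1_on ::
    "real set \<Rightarrow> (real \<Rightarrow> 'a::euclidean_space \<Rightarrow> real) \<Rightarrow> (real \<Rightarrow> 'a \<Rightarrow> real) \<Rightarrow> bool" where
  "L1_loc_C1_on I u v \<longleftrightarrow>
     L1_loc_continuous_on I u \<and> L1_loc_continuous_on I v \<and>
     (\<forall>t\<in>I. \<forall>K. compact K \<longrightarrow>
        ((\<lambda>s. LINT x:K|lebesgue. \<bar>(u s x - u t x) / (s - t) - v t x\<bar>) \<longlongrightarrow> 0) (at t within I))"

definition time_interval :: "ereal \<Rightarrow> real set" where
  "time_interval T = {t. 0 \<le> t \<and> ereal t < T}"

text \<open>Test functions on \<open>[0,T) \<times> \<real>\<^sup>n\<close>, smooth up to \<open>t = 0\<close> and not required to vanish there: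
  they are represented by extensions to negative times. Only their values and derivatives
  at times \<open>t \<ge> 0\<close> are ever used.\<close>

definition test_functions :: "ereal \<Rightarrow> (real \<times> 'a::euclidean_space \<Rightarrow> real) set" where
  "test_functions T = {\<phi> \<in> Cc_infty. tsupport \<phi> \<subseteq> {(t, x). ereal t < T}}"

definition propagation :: "real \<Rightarrow> real \<Rightarrow> real" where
  "propagation l t = integral {0..t} (\<lambda>s. (1 + s) powr l)"

text \<open>Finite-propagation weak solutions; \<open>w t x\<close> is the value at time \<open>t\<close> and position \<open>x\<close>, and only
  the times in \<open>[0,T)\<close> matter. The balls are taken to be closed, which gives the weakest support
  requirement.\<close>

definition weak_solution ::
    "real \<Rightarrow> real \<Rightarrow> real \<Rightarrow> real \<Rightarrow> (real^'n \<Rightarrow> real) \<Rightarrow> (real^'n \<Rightarrow> real) \<Rightarrow> real \<Rightarrow> real \<Rightarrow>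
     ereal \<Rightarrow> (real \<Rightarrow> real^'n \<Rightarrow> real) \<Rightarrow> bool" where
  "weak_solution l \<beta> \<mu> p f g \<epsilon> R\<^sub>0 T w \<longleftrightarrow>
     0 < T \<and>
     Lp_loc_on p (time_interval T \<times> UNIV) (\<lambda>(t, x). w t x) \<and>
     (\<exists>w\<^sub>t. L1_loc_C1_on (time_interval T) w w\<^sub>t \<and>
        (\<forall>t\<in>time_interval T.
           ess_support (w t) \<union> ess_support (w\<^sub>t t) \<subseteq> cball 0 (R\<^sub>0 + propagation l t))) \<and>
     (\<forall>\<phi>\<in>test_functions T.
        (LINT (t, x):(time_interval T \<times> UNIV)|lebesgue.
           w t x * ((deriv ^^ 2) (\<lambda>s. \<phi> (s, x)) t
                    - (1 + t) powr (2 * l) * laplacian (\<lambda>y. \<phi> (t, y)) x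
                    - deriv (\<lambda>s. \<beta> / (1 + s) * \<phi> (s, x)) t
                    + \<mu>\<^sup>2 / (1 + t)\<^sup>2 * \<phi> (t, x)))
        = (LINT (t, x):(time_interval T \<times> UNIV)|lebesgue. \<bar>w t x\<bar> powr p * \<phi> (t, x))
          + \<epsilon> * (LINT x|lebesgue.
                   (g x + \<beta> * f x) * \<phi> (0, x) - f x * deriv (\<lambda>s. \<phi> (s, x)) 0))"

definition gamma_poly :: "real \<Rightarrow> real \<Rightarrow> real \<Rightarrow> real \<Rightarrow> real" where
  "gamma_poly \<alpha> n l p =
     (n - 1 + l / (1 + l)) * p\<^sup>2 - (n + 1 - (3 * l + 2 * \<alpha>) / (1 + l)) * p - 2"

definition p_Str :: "real \<Rightarrow> real \<Rightarrow> real" where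
  "p_Str N l = (THE p. 0 < p \<and>
     (N - 1 + l / (1 + l)) * p\<^sup>2 - (N + 1 - 3 * l / (1 + l)) * p - 2 = 0)"

lemma quadratic_unique_pos_root:
  fixes a b :: real
  assumes "0 < a"
  shows "\<exists>!p. 0 < p \<and> a * p\<^sup>2 - b * p - 2 = 0"
proof (rule ex_ex1I)
  define s where "s = sqrt (b\<^sup>2 + 8 * a)"
  have s2: "s\<^sup>2 = b\<^sup>2 + 8 * a" using assms by (simp add: s_def)
  have "\<bar>b\<bar> < s" unfolding s_def using assms by (intro real_less_rsqrt) simp
  then have "0 < (b + s) / (2 * a)" using assms by simp
  moreover have "a * ((b + s) / (2 * a))\<^sup>2 - b * ((b + s) / (2 * a)) - 2
      = (s\<^sup>2 - b\<^sup>2 - 8 * a) / (4 * a)"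
    using assms by (simp add: field_simps power2_eq_square)
  ultimately show "\<exists>p. 0 < p \<and> a * p\<^sup>2 - b * p - 2 = 0"
    using s2 by (intro exI[of _ "(b + s) / (2 * a)"]) simp
next
  fix p q :: real
  assume p: "0 < p \<and> a * p\<^sup>2 - b * p - 2 = 0" and q: "0 < q \<and> a * q\<^sup>2 - b * q - 2 = 0"
  have "(p - q) * (a * p * q + 2) = q * (a * p\<^sup>2 - b * p - 2) - p * (a * q\<^sup>2 - b * q - 2)"
    by (simp add: algebra_simps power2_eq_square)
  also have "\<dots> = 0" using p q by simp
  finally have "(p - q) * (a * p * q + 2) = 0" .
  moreover have "0 < a * p * q + 2" using assms p q by (simp add: add_pos_pos)
  ultimately show "p = q" by simp
qed

end

theory Submission
  imports Defs
begin

text \<open>Write \<open>q = p / (p - 1)\<close>. A time cutoff supported in \<open>[\<tau> / 2, 3 \<tau>]\<close>, used as test function,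
  does not see the data; Young's inequality and finite propagation bound the integral \<open>X\<close> of \<open>\<bar>w\<bar> powr p\<close>
  over \<open>\<tau> \<le> t \<le> 2 \<tau>\<close> by a power of \<open>\<tau>\<close>. The second test function is a cut-off positive solution
  \<open>L t * \<Phi> x\<close> of the adjoint equation, with \<open>\<Phi>\<close> a radial solution of \<open>\<Delta> \<Phi> = \<kappa>\<^sup>2 \<Phi>\<close> and \<open>L\<close> built from
  the decaying Bessel function \<open>K\<close> of imaginary order. Only derivatives of the cutoff survive, so the
  data term, a positive multiple of \<open>\<epsilon>\<close>, is bounded by an integral of \<open>\<bar>w\<bar>\<close> against an explicit
  weight over the same time slab. By Young's inequality \<open>\<epsilon> powr p\<close> is at most a constant times
  \<open>X\<close> times the \<open>p - 1\<close>-st power of the \<open>q\<close>-th moment of the weight, where the decay of \<open>L * \<Phi>\<close> away from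
  the light cone gives that moment as a power of \<open>\<tau>\<close>. The powers of \<open>\<tau>\<close> add up to
  \<open>(1 + l) \<gamma> / (2 (p - 1))\<close>, which is negative in the subcritical range.\<close>

section \<open>Smooth functions\<close>

text \<open>The hypothesis \<open>(1 - \<beta>)\<^sup>2 < 4 * \<mu>\<^sup>2\<close> gives the linear
  equation for functions of time alone complex characteristic exponents: spatial means may
  oscillate, so no argument by positivity of a mean of w is available. Testing avoids this, since
  positivity is asked only of the test function at times t >= 0 and of the data term. The
  scale-invariant lower-order terms all cost \<tau>^(-2), like two time derivatives of the cutoff.
  In the second test function the decay of the time factor is tuned to the propagation radius: on
  the light cone the exponentials cancel and only powers of 1 + t remain, while inside the cone the
  product is exponentially small in the distance to it. Both estimates concern the same time slab,
  so the unknown energy can be eliminated between them. Their constants do not depend on \<epsilon>,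
  w or the lifespan; a negative power of \<tau> therefore yields nonexistence when \<tau> is
  unbounded and the lifespan estimate when \<tau> approaches a third of the lifespan.\<close>

primrec diff_order :: "nat \<Rightarrow> real set \<Rightarrow> (real \<Rightarrow> real) \<Rightarrow> bool" where
  "diff_order 0 U f \<longleftrightarrow> True"
| "diff_order (Suc k) U f \<longleftrightarrow>
     (\<exists>f'. (\<forall>x\<in>U. (f has_real_derivative f' x) (at x)) \<and> diff_order k U f')"

lemma diff_order_SucE:
  assumes "diff_order (Suc k) U f"
  obtains f' where "\<And>x. x \<in> U \<Longrightarrow> (f has_real_derivative f' x) (at x)" "diff_order k U f'"
  using assms by (auto elim!: bexE)

text \<open>Only derivatives at points of \<open>U\<close> count, so functions regular only on a
  half-line, such as powers, are covered. The derivative chains for different orders are a priori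
  unrelated; \<open>smooth_onE\<close> ties them together.\<close>

definition smooth_on :: "real set \<Rightarrow> (real \<Rightarrow> real) \<Rightarrow> bool" where
  "smooth_on U f \<longleftrightarrow> (\<forall>k. diff_order k U f)"

lemma diff_order_cong:
  assumes "open U" "\<And>x. x \<in> U \<Longrightarrow> f x = g x" "diff_order k U f"
  shows "diff_order k U g"
proof (cases k)
  case (Suc j)
  then obtain f' where f': "\<And>x. x \<in> U \<Longrightarrow> (f has_real_derivative f' x) (at x)" "diff_order j U f'"
    using assms(3) by auto
  have "(g has_real_derivative f' x) (at x)" if "x \<in> U" for x
    using has_field_derivative_transform_within_open[OF f'(1)[OF that] assms(1) that] assms(2) by auto
  then show ?thesis using f'(2) Suc by auto
qed simp

lemma diff_order_Suc_D: "diff_order (Suc k) U f \<Longrightarrow> diff_order k U f"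
  by (induction k arbitrary: f) (simp, metis diff_order.simps(2))

lemma smooth_on_cong:
  assumes "open U" "\<And>x. x \<in> U \<Longrightarrow> f x = g x" "smooth_on U f"
  shows "smooth_on U g"
  using assms diff_order_cong[of U f g] by (auto simp: smooth_on_def)

lemma smooth_on_subset: "smooth_on U f \<Longrightarrow> V \<subseteq> U \<Longrightarrow> smooth_on V f"
proof -
  have "diff_order k U f \<Longrightarrow> V \<subseteq> U \<Longrightarrow> diff_order k V f" for k
  proof (induction k arbitrary: f)
    case (Suc k)
    obtain f' where f': "\<And>x. x \<in> U \<Longrightarrow> (f has_real_derivative f' x) (at x)" "diff_order k U f'"
      using diff_order_SucE[OF Suc.prems(1)] by metis
    then show ?case using Suc by (auto intro!: exI[of _ f'])
  qed simp
  then show "smooth_on U f \<Longrightarrow> V \<subseteq> U \<Longrightarrow> smooth_on V f" by (auto simp: smooth_on_def)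
qed

text \<open>The witnesses supplied for different orders coincide on \<open>U\<close>, since each
  must equal \<open>deriv f\<close> there; one derivative therefore has all orders.\<close>

lemma smooth_onE:
  assumes "smooth_on U f" "open U"
  obtains f' where "\<And>x. x \<in> U \<Longrightarrow> (f has_real_derivative f' x) (at x)" "smooth_on U f'"
proof -
  have *: "(f has_real_derivative deriv f x) (at x)" if "x \<in> U" for x
    using assms(1) that unfolding smooth_on_def
    by (metis DERIV_imp_deriv diff_order.simps(2))
  have "diff_order k U (deriv f)" for k
  proof -
    have "diff_order (Suc k) U f" using assms(1) smooth_on_def by blast
    then obtain f' where f': "\<And>x. x \<in> U \<Longrightarrow> (f has_real_derivative f' x) (at x)" "diff_order k U f'"
      by auto
    have "f' x = deriv f x" if "x \<in> U" for x using f'(1)[OF that] by (simp add: DERIV_imp_deriv)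
    then show ?thesis using diff_order_cong[OF assms(2)] f'(2) by metis
  qed
  then show thesis using that * unfolding smooth_on_def by blast
qed

text \<open>A class closed under differentiation consists of smooth functions. Formulas for the k-th
  derivative are thereby replaced by the choice of a suitable family \<open>S\<close>.\<close>

lemma smooth_on_coinduct:
  assumes "f \<in> S"
    and "\<And>g. g \<in> S \<Longrightarrow> \<exists>g'\<in>S. \<forall>x\<in>U. (g has_real_derivative g' x) (at x)"
  shows "smooth_on U f"
proof -
  have "\<forall>f\<in>S. diff_order k U f" for k
    by (induction k) (simp, metis assms(2) diff_order.simps(2))
  then show ?thesis using assms(1) smooth_on_def by blast
qed

section \<open>Closure properties of smooth functions of one variable\<close>

lemma smooth_on_const [simp]: "smooth_on U (\<lambda>x. c)"
  by (rule smooth_on_coinduct[where S="range (\<lambda>c x. c)"]) (auto intro!: derivative_eq_intros)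

lemma smooth_on_affine: "smooth_on U (\<lambda>x. a * x + b)"
  by (rule smooth_on_coinduct[where S="insert (\<lambda>x. a * x + b) (range (\<lambda>c x. c))"])
    (auto intro!: derivative_eq_intros)

lemma diff_order_add:
  "diff_order k U f \<Longrightarrow> diff_order k U g \<Longrightarrow> diff_order k U (\<lambda>x. f x + g x)"
proof (induction k arbitrary: f g)
  case (Suc k)
  obtain f' where f': "\<And>x. x \<in> U \<Longrightarrow> (f has_real_derivative f' x) (at x)" "diff_order k U f'"
    using diff_order_SucE[OF Suc.prems(1)] by metis
  obtain g' where g': "\<And>x. x \<in> U \<Longrightarrow> (g has_real_derivative g' x) (at x)" "diff_order k U g'"
    using diff_order_SucE[OF Suc.prems(2)] by metis
  note * = f' g'
  then show ?case using * Suc.IH[of f' g']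
    by (auto intro!: exI[of _ "\<lambda>x. f' x + g' x"] derivative_eq_intros)
qed simp

lemma diff_order_mult:
  "diff_order k U f \<Longrightarrow> diff_order k U g \<Longrightarrow> diff_order k U (\<lambda>x. f x * g x)"
proof (induction k arbitrary: f g)
  case (Suc k)
  obtain f' where f': "\<And>x. x \<in> U \<Longrightarrow> (f has_real_derivative f' x) (at x)" "diff_order k U f'"
    using diff_order_SucE[OF Suc.prems(1)] by metis
  obtain g' where g': "\<And>x. x \<in> U \<Longrightarrow> (g has_real_derivative g' x) (at x)" "diff_order k U g'"
    using diff_order_SucE[OF Suc.prems(2)] by metis
  note * = f' g'
  have "diff_order k U (\<lambda>x. f' x * g x + f x * g' x)"
    using Suc * diff_order_Suc_D by (intro diff_order_add Suc.IH) auto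
  then show ?case using *
    by (auto intro!: exI[of _ "\<lambda>x. f' x * g x + f x * g' x"] derivative_eq_intros)
qed simp

lemma diff_order_compose:
  assumes "open V" "\<And>x. x \<in> U \<Longrightarrow> g x \<in> V" "smooth_on V f"
  shows "diff_order k U g \<Longrightarrow> diff_order k U (\<lambda>x. f (g x))"
  using assms(3)
proof (induction k arbitrary: f)
  case (Suc k)
  obtain f' where f': "\<And>x. x \<in> V \<Longrightarrow> (f has_real_derivative f' x) (at x)" "smooth_on V f'"
    using smooth_onE[OF Suc.prems(2) assms(1)] by metis
  obtain g' where g': "\<And>x. x \<in> U \<Longrightarrow> (g has_real_derivative g' x) (at x)" "diff_order k U g'"
    using Suc.prems by auto
  have "diff_order k U (\<lambda>x. f' (g x) * g' x)"
    using Suc.IH[of f'] Suc.prems(1) f' g' diff_order_Suc_D by (intro diff_order_mult) auto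
  moreover have "((\<lambda>x. f (g x)) has_real_derivative f' (g x) * g' x) (at x)" if "x \<in> U" for x
    using DERIV_chain2[OF f'(1)[OF assms(2)[OF that]] g'(1)[OF that]] .
  ultimately show ?case by (auto intro!: exI[of _ "\<lambda>x. f' (g x) * g' x"])
qed simp

lemma smooth_on_add: "smooth_on U f \<Longrightarrow> smooth_on U g \<Longrightarrow> smooth_on U (\<lambda>x. f x + g x)"
  by (simp add: smooth_on_def diff_order_add)

lemma smooth_on_mult: "smooth_on U f \<Longrightarrow> smooth_on U g \<Longrightarrow> smooth_on U (\<lambda>x. f x * g x)"
  by (simp add: smooth_on_def diff_order_mult)

lemma smooth_on_power: "smooth_on U f \<Longrightarrow> smooth_on U (\<lambda>x. f x ^ n)"
  by (induction n) (auto intro: smooth_on_mult)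

lemma smooth_on_compose:
  assumes "open V" "\<And>x. x \<in> U \<Longrightarrow> g x \<in> V" "smooth_on V f" "smooth_on U g"
  shows "smooth_on U (\<lambda>x. f (g x))"
  using diff_order_compose[OF assms(1-3)] assms(4) by (auto simp: smooth_on_def)

lemma smooth_on_affine_compose: "smooth_on UNIV f \<Longrightarrow> smooth_on UNIV (\<lambda>x. f (a * x + b))"
  by (rule smooth_on_compose[where V=UNIV and g="\<lambda>x. a * x + b"]) (auto simp: smooth_on_affine)

text \<open>Glueing makes a factor that exists only for t > -1 smooth on the whole line once it is
  multiplied by a step that vanishes up to t = -1/2.\<close>

lemma smooth_on_union:
  assumes "open U" "open V" "smooth_on U f" "smooth_on V f"
  shows "smooth_on (U \<union> V) f"
proof -
  have "diff_order k U f \<Longrightarrow> diff_order k V f \<Longrightarrow> diff_order k (U \<union> V) f" for k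
  proof (induction k arbitrary: f)
    case (Suc k)
    obtain f' where f': "\<And>x. x \<in> U \<Longrightarrow> (f has_real_derivative f' x) (at x)" "diff_order k U f'"
      using diff_order_SucE[OF Suc.prems(1)] by metis
    obtain g' where g': "\<And>x. x \<in> V \<Longrightarrow> (f has_real_derivative g' x) (at x)" "diff_order k V g'"
      using diff_order_SucE[OF Suc.prems(2)] by metis
    note * = f' g'
    have "f' x = deriv f x" if "x \<in> U" for x using *(1)[OF that] by (simp add: DERIV_imp_deriv)
    moreover have "g' x = deriv f x" if "x \<in> V" for x using *(3)[OF that] by (simp add: DERIV_imp_deriv)
    ultimately have "diff_order k (U \<union> V) (deriv f)"
      using Suc.IH diff_order_cong[OF assms(1) _ *(2)] diff_order_cong[OF assms(2) _ *(4)] by blast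
    moreover have "\<forall>x\<in>U \<union> V. (f has_real_derivative deriv f x) (at x)"
      using * DERIV_imp_deriv by (metis Un_iff)
    ultimately show ?case by auto
  qed simp
  then show ?thesis using assms by (auto simp: smooth_on_def)
qed

lemma smooth_on_powr: "smooth_on {0<..} (\<lambda>x. x powr a)"
proof (rule smooth_on_coinduct[where S="{g. \<exists>c a. g = (\<lambda>x. c * x powr a)}"], goal_cases)
  case 1
  show ?case by (rule CollectI, rule exI[of _ 1], rule exI[of _ a]) simp
next
  case (2 g)
  then obtain c b where g: "g = (\<lambda>x. c * x powr b)" by auto
  show ?case unfolding g
    by (intro bexI[of _ "\<lambda>x. (c * b) * x powr (b - 1)"]) (auto intro!: derivative_eq_intros)
qed

lemma smooth_on_continuous: "smooth_on UNIV f \<Longrightarrow> continuous_on UNIV f"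
  by (metis DERIV_continuous_on UNIV_I has_field_derivative_at_within open_UNIV smooth_onE)

lemma smooth_on_powser:
  fixes a :: "nat \<Rightarrow> real"
  assumes "\<And>x. summable (\<lambda>n. a n * x ^ n)"
  shows "smooth_on UNIV (\<lambda>x. \<Sum>n. a n * x ^ n)"
proof (rule smooth_on_coinduct[where
      S="{g. \<exists>b. (\<forall>x. summable (\<lambda>n. b n * x ^ n)) \<and> g = (\<lambda>x::real. \<Sum>n. b n * x ^ n)}"], goal_cases)
  case 1
  show ?case using assms by auto
next
  case (2 g)
  then obtain b where b: "\<And>x. summable (\<lambda>n. b n * x ^ n)" "g = (\<lambda>x::real. \<Sum>n. b n * x ^ n)" by auto
  have "summable (\<lambda>n. diffs b n * x ^ n)" for x
    using termdiff_converges[of x "norm x + 1" b] b(1) by simp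
  moreover have "(g has_real_derivative (\<Sum>n. diffs b n * x ^ n)) (at x)" for x
    unfolding b(2) using termdiffs_strong_converges_everywhere[OF b(1)] by simp
  ultimately show ?case
    by (intro bexI[of _ "\<lambda>x. \<Sum>n. diffs b n * x ^ n"] CollectI exI[of _ "diffs b"]) auto
qed

subsection \<open>A smooth step\<close>

lemma poly_exp_neg_tendsto_0: "((\<lambda>y::real. poly Q y * exp (- y)) \<longlongrightarrow> 0) at_top"
proof -
  have "((\<lambda>y. \<Sum>i\<le>degree Q. coeff Q i * (y ^ i / exp y)) \<longlongrightarrow> (\<Sum>i\<le>degree Q. coeff Q i * 0)) at_top"
    by (intro tendsto_intros tendsto_power_div_exp_0)
  then show ?thesis
    by (simp add: poly_altdef sum_distrib_right exp_minus divide_inverse mult.assoc)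
qed

text \<open>The polynomial in \<open>1 / x\<close> is carried along to make the family closed under
  differentiation; \<open>flat 1\<close> is the classical exp (- 1 / x).\<close>

definition flat :: "real poly \<Rightarrow> real \<Rightarrow> real" where
  "flat P x = (if x > 0 then poly P (1 / x) * exp (- (1 / x)) else 0)"

text \<open>With y = 1 / x one has dy/dx = - y^2, and \<open>[:0, 0, 1:]\<close> is the polynomial
  y^2. At 0 the right difference quotient is again a polynomial in y times exp (- y), which tends to
  0, and the left one is 0.\<close>

lemma flat_deriv:
  "(flat P has_real_derivative flat ((P - pderiv P) * [:0, 0, 1:]) x) (at x)"
proof -
  consider "x > 0" | "x < 0" | "x = 0" by linarith
  then show ?thesis
  proof cases
    case 1
    have "((\<lambda>x. poly P (1 / x) * exp (- (1 / x))) has_real_derivative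
        flat ((P - pderiv P) * [:0, 0, 1:]) x) (at x)"
      using 1 by (auto intro!: derivative_eq_intros DERIV_chain2[OF poly_DERIV]
          simp: flat_def field_simps power2_eq_square)
    then show ?thesis
      by (rule has_field_derivative_transform_within_open[where S="{0<..}"])
        (use 1 in \<open>auto simp: flat_def\<close>)
  next
    case 2
    have "((\<lambda>x. 0) has_real_derivative flat ((P - pderiv P) * [:0, 0, 1:]) x) (at x)"
      using 2 by (auto simp: flat_def)
    then show ?thesis
      by (rule has_field_derivative_transform_within_open[where S="{..<0}"])
        (use 2 in \<open>auto simp: flat_def\<close>)
  next
    case 3
    have "((\<lambda>h. flat P h / h) \<longlongrightarrow> 0) (at_right 0)"
    proof (rule Lim_transform_eventually)
      show "((\<lambda>h::real. poly (P * [:0, 1:]) (1 / h) * exp (- (1 / h))) \<longlongrightarrow> 0) (at_right 0)"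
        using filterlim_compose[OF poly_exp_neg_tendsto_0[of "P * [:0, 1:]"]
            filterlim_inverse_at_top_right]
        by (simp add: divide_inverse del: mult_pCons_right)
      show "\<forall>\<^sub>F h in at_right 0. poly (P * [:0, 1:]) (1 / h) * exp (- (1 / h)) = flat P h / h"
        using eventually_at_right_less[of 0] by eventually_elim (simp add: flat_def)
    qed
    moreover have "((\<lambda>h. flat P h / h) \<longlongrightarrow> 0) (at_left 0)"
    proof (rule Lim_transform_eventually[of "\<lambda>_. 0"])
      show "\<forall>\<^sub>F h in at_left 0. 0 = flat P h / h"
        unfolding eventually_at_left_field by (auto simp: flat_def intro: exI[of _ "-1"])
    qed simp
    ultimately have "((\<lambda>h. flat P h / h) \<longlongrightarrow> 0) (at 0)"
      using filterlim_split_at by blast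
    then show ?thesis using 3 by (simp add: DERIV_def flat_def)
  qed
qed

lemma smooth_on_flat: "smooth_on UNIV (flat P)"
  by (rule smooth_on_coinduct[where S="range flat"]) (auto intro: flat_deriv)

text \<open>The reciprocal is written as a power with exponent -1, so that smoothness follows by
  composition with \<open>powr\<close> on the positive half-line. The denominator is positive
  because x and 1 - x are never both nonpositive.\<close>

definition smooth_step :: "real \<Rightarrow> real" where
  "smooth_step x = flat 1 x * (flat 1 x + flat 1 (1 - x)) powr (- 1)"

lemma flat_1_nonneg: "0 \<le> flat 1 x" and flat_1_pos: "0 < flat 1 x \<longleftrightarrow> 0 < x"
  by (auto simp: flat_def)

lemma flat_1_sum_pos: "0 < flat 1 x + flat 1 (1 - x)"
  using flat_1_nonneg[of x] flat_1_nonneg[of "1 - x"] flat_1_pos[of x] flat_1_pos[of "1 - x"]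
  by (cases "0 < x") auto

lemma smooth_step_smooth: "smooth_on UNIV smooth_step"
proof -
  have *: "smooth_on UNIV (\<lambda>x. flat 1 x + flat 1 (1 - x))"
    using smooth_on_affine_compose[OF smooth_on_flat, of 1 "-1" 1]
    by (intro smooth_on_add smooth_on_flat) (simp add: algebra_simps)
  have "smooth_on UNIV (\<lambda>x. (flat 1 x + flat 1 (1 - x)) powr (- 1))"
    by (rule smooth_on_compose[OF _ _ smooth_on_powr *]) (auto simp: flat_1_sum_pos)
  then show ?thesis unfolding smooth_step_def[abs_def] by (intro smooth_on_mult smooth_on_flat)
qed

lemma smooth_step_eq: "smooth_step x = flat 1 x / (flat 1 x + flat 1 (1 - x))"
  unfolding smooth_step_def powr_neg_one[OF flat_1_sum_pos]
  by (simp only: times_divide_eq_right mult_1_right)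

lemma smooth_step_nonneg [simp]: "0 \<le> smooth_step x"
  and smooth_step_le_1 [simp]: "smooth_step x \<le> 1"
  using flat_1_sum_pos[of x] flat_1_nonneg[of x] flat_1_nonneg[of "1 - x"]
  by (simp_all add: smooth_step_eq divide_le_eq_1)

lemma smooth_step_0 [simp]: "x \<le> 0 \<Longrightarrow> smooth_step x = 0"
  by (simp add: smooth_step_eq flat_def)

lemma smooth_step_1 [simp]: "1 \<le> x \<Longrightarrow> smooth_step x = 1"
  using flat_1_pos[of x] flat_1_pos[of "1 - x"] by (simp add: smooth_step_eq flat_def)

subsection \<open>Smooth functions of several variables\<close>

lemma Ck_Suc_D: "Ck (Suc k) u \<Longrightarrow> Ck k u"
  by (induction k arbitrary: u) (auto simp: differentiable_imp_continuous_on)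

lemma Ck_SucI:
  fixes u :: "'a::euclidean_space \<Rightarrow> real"
  assumes "\<And>x. (u has_derivative D x) (at x)" "\<And>b. b \<in> Basis \<Longrightarrow> Ck k (\<lambda>x. D x b)"
  shows "Ck (Suc k) u"
proof -
  have "frechet_derivative u (at x) = D x" for x using frechet_derivative_at[OF assms(1)] by metis
  then show ?thesis using assms
    by (auto simp: differentiable_on_def differentiable_def intro: has_derivative_at_withinI)
qed

lemma Ck_SucE:
  fixes u :: "'a::euclidean_space \<Rightarrow> real"
  assumes "Ck (Suc k) u"
  obtains D where "\<And>x. (u has_derivative D x) (at x)" "\<And>b. b \<in> Basis \<Longrightarrow> Ck k (\<lambda>x. D x b)"
  using assms that[of "\<lambda>x. frechet_derivative u (at x)"]
  by (auto simp: differentiable_on_def frechet_derivative_works)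

lemma Ck_const: "Ck k (\<lambda>x. c)"
  by (induction k arbitrary: c) (simp, rule Ck_SucI[where D="\<lambda>x h. 0"], auto)

lemma Ck_linear: "bounded_linear u \<Longrightarrow> Ck k u"
proof (cases k)
  case (Suc j)
  assume "bounded_linear u"
  then show ?thesis unfolding Suc
    by (intro Ck_SucI[where D="\<lambda>x. u"]) (auto intro: bounded_linear_imp_has_derivative Ck_const)
qed (auto simp: linear_continuous_on)

lemma Ck_add: "Ck k u \<Longrightarrow> Ck k v \<Longrightarrow> Ck k (\<lambda>x. u x + v x)"
proof (induction k arbitrary: u v)
  case (Suc k)
  obtain D where D: "\<And>x. (u has_derivative D x) (at x)" "\<And>b. b \<in> Basis \<Longrightarrow> Ck k (\<lambda>x. D x b)"
    using Ck_SucE[OF Suc.prems(1)] by metis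
  obtain E where E: "\<And>x. (v has_derivative E x) (at x)" "\<And>b. b \<in> Basis \<Longrightarrow> Ck k (\<lambda>x. E x b)"
    using Ck_SucE[OF Suc.prems(2)] by metis
  show ?case
    by (rule Ck_SucI[where D="\<lambda>x h. D x h + E x h"])
      (use D E Suc.IH in \<open>auto intro!: derivative_eq_intros\<close>)
qed (auto intro: continuous_intros)

lemma Ck_mult: "Ck k u \<Longrightarrow> Ck k v \<Longrightarrow> Ck k (\<lambda>x. u x * v x)"
proof (induction k arbitrary: u v)
  case (Suc k)
  obtain D where D: "\<And>x. (u has_derivative D x) (at x)" "\<And>b. b \<in> Basis \<Longrightarrow> Ck k (\<lambda>x. D x b)"
    using Ck_SucE[OF Suc.prems(1)] by metis
  obtain E where E: "\<And>x. (v has_derivative E x) (at x)" "\<And>b. b \<in> Basis \<Longrightarrow> Ck k (\<lambda>x. E x b)"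
    using Ck_SucE[OF Suc.prems(2)] by metis
  show ?case
  proof (rule Ck_SucI[where D="\<lambda>x h. u x * E x h + D x h * v x"])
    show "((\<lambda>x. u x * v x) has_derivative (\<lambda>h. u x * E x h + D x h * v x)) (at x)" for x
      using D(1) E(1) by (rule has_derivative_mult)
    show "Ck k (\<lambda>x. u x * E x b + D x b * v x)" if "b \<in> Basis" for b
      using that D E Suc.prems[THEN Ck_Suc_D] by (intro Ck_add Suc.IH) simp_all
  qed
qed (auto intro: continuous_intros)

lemma Ck_compose:
  assumes "smooth_on UNIV f"
  shows "Ck k u \<Longrightarrow> Ck k (\<lambda>x. f (u x))"
  using assms
proof (induction k arbitrary: f)
  case 0
  then show ?case
    using continuous_on_compose2[OF smooth_on_continuous[OF 0(2)], of UNIV u] by auto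
next
  case (Suc k)
  obtain D where D: "\<And>x. (u has_derivative D x) (at x)" "\<And>b. b \<in> Basis \<Longrightarrow> Ck k (\<lambda>x. D x b)"
    using Ck_SucE[OF Suc.prems(1)] by metis
  obtain f' where f': "\<And>x. (f has_real_derivative f' x) (at x)" "smooth_on UNIV f'"
    using smooth_onE[OF Suc.prems(2)] by auto
  show ?case
  proof (rule Ck_SucI[where D="\<lambda>x h. f' (u x) * D x h"])
    show "((\<lambda>x. f (u x)) has_derivative (\<lambda>h. f' (u x) * D x h)) (at x)" for x
      using has_derivative_compose[OF D(1) f'(1)[unfolded has_field_derivative_def]] .
    show "Ck k (\<lambda>x. f' (u x) * D x b)" if "b \<in> Basis" for b
      by (rule Ck_mult[OF Suc.IH[OF Ck_Suc_D[OF Suc.prems(1)] f'(2)] D(2)[OF that]])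
  qed
qed

text \<open>Radial functions are built from the squared norm, which stays smooth at the origin; the
  linear map \<open>L\<close> allows the space component of a space-time point.\<close>

lemma Ck_norm_square:
  assumes "bounded_linear (L :: 'a::euclidean_space \<Rightarrow> 'b::euclidean_space)"
  shows "Ck k (\<lambda>x. (norm (L x))\<^sup>2)"
proof (cases k)
  case 0
  then show ?thesis using linear_continuous_on[OF assms, of UNIV]
    by (auto intro!: continuous_on_power continuous_on_norm)
next
  case (Suc j)
  have L: "(L has_derivative L) (at x)" for x using assms by (rule bounded_linear_imp_has_derivative)
  show ?thesis unfolding Suc power2_norm_eq_inner
  proof (rule Ck_SucI[where D="\<lambda>x h. 2 * (L x \<bullet> L h)"])
    show "((\<lambda>x. L x \<bullet> L x) has_derivative (\<lambda>h. 2 * (L x \<bullet> L h))) (at x)" for x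
      by (rule has_derivative_eq_rhs[OF has_derivative_inner[OF L L]]) (auto simp: inner_commute)
    show "Ck j (\<lambda>x. 2 * (L x \<bullet> L b))" for b
      by (intro Ck_linear bounded_linear_const_mult
          bounded_linear_compose[OF bounded_linear_inner_left assms])
  qed
qed

section \<open>The Macdonald function of imaginary order\<close>

lemma set_integrable_exp_neg:
  assumes "0 < c"
  shows "set_integrable lborel {0<..} (\<lambda>s::real. exp (- (c * s)))"
    and "(LINT s:{0<..}|lborel. exp (- (c * s))) = 1 / c"
proof -
  have hi: "((\<lambda>s::real. exp (- (c * s))) has_integral 1 / c) {0<..}"
  proof (subst has_integral_spike_set_eq[where T="{0..}"])
    show "negligible {x \<in> {0..} - {0<..}. exp (- (c * x)) \<noteq> 0}"
      and "negligible {x \<in> {0<..} - {0..}. exp (- (c * x)) \<noteq> 0}"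
      by (rule negligible_subset[of "{0}"], simp, force)+
    show "((\<lambda>s. exp (- (c * s))) has_integral 1 / c) {0..}"
      using has_integral_exp_minus_to_infinity[OF assms, of 0] by simp
  qed
  have "(\<lambda>s::real. exp (- (c * s))) absolutely_integrable_on {0<..}"
    by (rule nonnegative_absolutely_integrable_1) (use hi in auto)
  moreover have "(\<lambda>s. indicator {0<..} s *\<^sub>R exp (- (c * s))) \<in> borel_measurable lborel" by measurable
  ultimately show i: "set_integrable lborel {0<..} (\<lambda>s::real. exp (- (c * s)))"
    unfolding set_integrable_def using integrable_completion by blast
  show "(LINT s:{0<..}|lborel. exp (- (c * s))) = 1 / c"
    using set_borel_integral_eq_integral(2)[OF i] hi by (simp add: integral_unique)
qed

lemma power_le_exp:
  assumes "0 \<le> (x::real)"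
  shows "x ^ m \<le> (if m = 0 then 1 else real m ^ m) * exp x"
proof (cases "m = 0")
  case False
  have "(x / real m) ^ m \<le> (1 + x / real m) ^ m" using assms by (intro power_mono) auto
  also have "\<dots> \<le> exp x" using exp_ge_one_plus_x_over_n_power_n[of m x] assms False by simp
  finally show ?thesis using False by (simp add: field_simps power_divide)
qed (use assms in simp)

text \<open>The exponent is split into halves: one absorbs the power of cosh, the other gives exp (-
  s) because cosh s >= exp s / 2.\<close>

lemma cosh_exp_le_exp_neg:
  assumes "0 < z"
  obtains C where "0 \<le> C" "\<And>s::real. cosh s ^ m * exp (- (z * cosh s)) \<le> C * exp (- s)"
proof -
  define K where "K = (if m = 0 then 1 else real m ^ m)"
  define C where "C = K * (2 / z) ^ m * (4 / z)"
  have "cosh s ^ m * exp (- (z * cosh s)) \<le> C * exp (- s)" for s :: real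
  proof -
    have "(z / 2 * cosh s) ^ m \<le> K * exp (z / 2 * cosh s)"
      unfolding K_def using assms by (intro power_le_exp) auto
    then have 1: "cosh s ^ m * exp (- (z / 2 * cosh s)) \<le> K * (2 / z) ^ m"
      using assms by (simp add: power_mult_distrib exp_minus field_simps power_divide)
    have "z / 4 * exp s \<le> exp (z / 4 * exp s)" using exp_ge_add_one_self[of "z / 4 * exp s"] by linarith
    also have "\<dots> \<le> exp (z / 2 * cosh s)" using assms by (simp add: cosh_field_def)
    finally have 2: "exp (- (z / 2 * cosh s)) \<le> (4 / z) * exp (- s)"
      using assms by (simp add: exp_minus field_simps)
    have "cosh s ^ m * exp (- (z * cosh s))
        = (cosh s ^ m * exp (- (z / 2 * cosh s))) * exp (- (z / 2 * cosh s))"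
      by (simp add: mult.assoc exp_add[symmetric])
    also have "\<dots> \<le> (K * (2 / z) ^ m) * ((4 / z) * exp (- s))"
      using assms by (intro mult_mono[OF 1 2]) (auto simp: K_def)
    finally show ?thesis by (simp add: C_def)
  qed
  moreover have "0 \<le> C" using assms by (auto simp: C_def K_def)
  ultimately show thesis using that by blast
qed

lemma set_integrable_cosh_exp:
  fixes z :: real and w :: "real \<Rightarrow> real"
  assumes "0 < z" "continuous_on UNIV w" "\<And>s. \<bar>w s\<bar> \<le> c * cosh s ^ m"
  shows "set_integrable lborel {0<..} (\<lambda>s. w s * exp (- (z * cosh s)))"
proof -
  obtain C where C: "0 \<le> C" "\<And>s::real. cosh s ^ m * exp (- (z * cosh s)) \<le> C * exp (- s)"
    using cosh_exp_le_exp_neg[OF assms(1)] by metis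
  have c: "0 \<le> c" using order_trans[OF abs_ge_zero assms(3)[of 0]] by simp
  have w: "w \<in> borel_measurable borel" using assms(2) by (rule borel_measurable_continuous_onI)
  have ch: "(\<lambda>s::real. cosh s) \<in> borel_measurable borel"
    by (intro borel_measurable_continuous_onI continuous_intros)
  have "set_integrable lborel {0<..} (\<lambda>s. c * C * exp (- (1 * s)))"
    by (intro set_integrable_mult_right set_integrable_exp_neg(1)) simp
  then show ?thesis
  proof (rule set_integrable_bound)
    show "set_borel_measurable lborel {0<..} (\<lambda>s. w s * exp (- (z * cosh s)))"
      unfolding set_borel_measurable_def using w ch by measurable
    have "\<bar>w s\<bar> * exp (- (z * cosh s)) \<le> c * C * exp (- s)" for s
    proof -
      have "\<bar>w s\<bar> * exp (- (z * cosh s)) \<le> c * cosh s ^ m * exp (- (z * cosh s))"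
        using assms(3) by (intro mult_right_mono) auto
      also have "\<dots> \<le> c * (C * exp (- s))"
        unfolding mult.assoc using C c by (intro mult_left_mono) auto
      finally show ?thesis by simp
    qed
    then show "AE s in lborel. s \<in> {0<..} \<longrightarrow> norm (w s * exp (- (z * cosh s)))
        \<le> norm (c * C * exp (- (1 * s)))"
      using c C by (simp add: abs_mult)
  qed
qed

text \<open>Up to sign, the \<open>m\<close>-th derivative of $K_{i\nu}$.\<close>

definition macdonald :: "real \<Rightarrow> nat \<Rightarrow> real \<Rightarrow> real" where
  "macdonald \<nu> m z = (LINT s:{0<..}|lborel. cosh s ^ m * cos (\<nu> * s) * exp (- (z * cosh s)))"

lemma macdonald_integrable:
  fixes z \<nu> :: real
  assumes "0 < z"
  shows "set_integrable lborel {0<..} (\<lambda>s. cosh s ^ m * cos (\<nu> * s) * exp (- (z * cosh s)))"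
proof (rule set_integrable_cosh_exp[OF assms])
  show "\<bar>cosh s ^ m * cos (\<nu> * s)\<bar> \<le> 1 * cosh s ^ m" for s
    using mult_left_mono[OF abs_cos_le_one[of "\<nu> * s"], of "cosh s ^ m"] by (simp add: abs_mult)
qed (intro continuous_intros)

lemma exp_second_order:
  fixes x :: real
  shows "\<bar>exp x - 1 - x\<bar> \<le> x\<^sup>2 * exp \<bar>x\<bar>"
proof -
  have "exp x * (1 - x) \<le> exp x * exp (- x)" using exp_ge_add_one_self[of "- x"] by (intro mult_left_mono) auto
  then have 1: "exp x - 1 \<le> x * exp x" by (simp add: exp_minus algebra_simps)
  have 2: "x \<le> exp x - 1" using exp_ge_add_one_self[of x] by linarith
  have "x * (exp x - 1) \<le> x\<^sup>2 * exp \<bar>x\<bar>"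
  proof (cases "0 \<le> x")
    case True
    then show ?thesis using mult_left_mono[OF 1 True] by (simp add: power2_eq_square)
  next
    case False
    then have "x * (exp x - 1) \<le> x * x" using 2 by (intro mult_left_mono_neg) auto
    also have "\<dots> \<le> x * x * exp \<bar>x\<bar>" using mult_left_mono[of 1 "exp \<bar>x\<bar>" "x * x"] by simp
    finally show ?thesis by (simp add: power2_eq_square)
  qed
  moreover have "exp x - 1 - x \<le> x * (exp x - 1)" using 1 by (simp add: algebra_simps)
  ultimately show ?thesis using 2 by linarith
qed

text \<open>A remainder of size h^2 is stronger than differentiability, but convenient under an
  integral sign: one majorant, uniform for small h, suffices.\<close>

lemma DERIV_quadratic:
  fixes f :: "real \<Rightarrow> real"
  assumes "0 < r" "\<And>h. \<bar>h\<bar> < r \<Longrightarrow> \<bar>f (x + h) - f x - h * D\<bar> \<le> M * h\<^sup>2"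
  shows "(f has_real_derivative D) (at x)"
proof -
  have "((\<lambda>h. (f (x + h) - f x) / h - D) \<longlongrightarrow> 0) (at 0)"
  proof (rule Lim_null_comparison)
    show "((\<lambda>h. M * \<bar>h\<bar>) \<longlongrightarrow> 0) (at (0::real))" by (auto intro!: tendsto_eq_intros)
    show "\<forall>\<^sub>F h in at 0. norm ((f (x + h) - f x) / h - D) \<le> M * \<bar>h\<bar>"
      unfolding eventually_at
    proof (intro exI[of _ r] conjI ballI impI assms(1))
      fix h :: real assume h: "h \<noteq> 0 \<and> dist h 0 < r"
      then have "\<bar>f (x + h) - f x - h * D\<bar> \<le> M * h\<^sup>2" using assms(2) by simp
      moreover have "norm ((f (x + h) - f x) / h - D) = \<bar>f (x + h) - f x - h * D\<bar> / \<bar>h\<bar>"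
        using h by (simp add: diff_divide_distrib flip: abs_divide)
      moreover have "h\<^sup>2 = \<bar>h\<bar> * \<bar>h\<bar>" by (simp add: power2_eq_square)
      then have "M * h\<^sup>2 / \<bar>h\<bar> = M * \<bar>h\<bar>" using h by (cases "0 < h") auto
      ultimately show "norm ((f (x + h) - f x) / h - D) \<le> M * \<bar>h\<bar>"
        by (metis abs_ge_zero divide_right_mono)
    qed
  qed
  then show ?thesis by (simp add: DERIV_def LIM_zero_iff)
qed

lemma macdonald_deriv:
  assumes "0 < z"
  shows "(macdonald \<nu> m has_real_derivative - macdonald \<nu> (Suc m) z) (at z)"
proof (rule DERIV_quadratic)
  \<comment> \<open>For |h| < z / 2 the remainder of the exponential costs at most exp (z / 2 * cosh
    s), so half of the decay survives; the two extra powers of cosh come from the square of h * cosh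
    s.\<close>
  define M where "M = (LINT s:{0<..}|lborel. cosh s ^ (m + 2) * exp (- (z / 2 * cosh s)))"
  have M: "set_integrable lborel {0<..} (\<lambda>s. cosh s ^ (m + 2) * exp (- (z / 2 * cosh s)))"
    by (rule set_integrable_cosh_exp[of _ _ 1 "m + 2"]) (use assms in \<open>auto intro!: continuous_intros\<close>)
  show "0 < z / 2" using assms by simp
  fix h assume h: "\<bar>h\<bar> < z / 2"
  let ?D = "\<lambda>s. cosh s ^ m * cos (\<nu> * s) * exp (- ((z + h) * cosh s))
      - cosh s ^ m * cos (\<nu> * s) * exp (- (z * cosh s))
      + h * (cosh s ^ Suc m * cos (\<nu> * s) * exp (- (z * cosh s)))"
  have zh: "0 < z + h" using h by linarith
  note ints = macdonald_integrable[OF zh, of m \<nu>] macdonald_integrable[OF assms, of m \<nu>]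
    macdonald_integrable[OF assms, of "Suc m" \<nu>]
  have D: "set_integrable lborel {0<..} ?D"
    by (intro set_integral_add(1) set_integral_diff(1) set_integrable_mult_right ints)
  have eq: "macdonald \<nu> m (z + h) - macdonald \<nu> m z - h * - macdonald \<nu> (Suc m) z
      = (LINT s:{0<..}|lborel. ?D s)"
    unfolding macdonald_def using ints
    by (simp only: set_integral_add(2) set_integral_diff set_integrable_mult_right
        set_integral_mult_right)
  have pt: "\<bar>?D s\<bar> \<le> h\<^sup>2 * (cosh s ^ (m + 2) * exp (- (z / 2 * cosh s)))" for s
  proof -
    define u where "u = - (h * cosh s)"
    have "?D s = cosh s ^ m * cos (\<nu> * s) * exp (- (z * cosh s)) * (exp u - 1 - u)"
      by (simp add: u_def algebra_simps exp_add[symmetric])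
    then have "\<bar>?D s\<bar> = (cosh s ^ m * exp (- (z * cosh s))) * \<bar>cos (\<nu> * s)\<bar> * \<bar>exp u - 1 - u\<bar>"
      by (simp add: abs_mult)
    also have "\<dots> \<le> (cosh s ^ m * exp (- (z * cosh s))) * 1 * (u\<^sup>2 * exp \<bar>u\<bar>)"
      using exp_second_order[of u] by (intro mult_mono) auto
    also have "u\<^sup>2 * exp \<bar>u\<bar> \<le> u\<^sup>2 * exp (z / 2 * cosh s)"
    proof (rule mult_left_mono)
      show "exp \<bar>u\<bar> \<le> exp (z / 2 * cosh s)"
        using h mult_right_mono[of "\<bar>h\<bar>" "z / 2" "cosh s"] by (simp add: u_def abs_mult)
    qed simp
    finally show ?thesis
      by (simp add: u_def power_mult_distrib power_add power2_eq_square algebra_simps exp_add[symmetric])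
  qed
  have "\<bar>LINT s:{0<..}|lborel. ?D s\<bar> \<le> (LINT s:{0<..}|lborel. \<bar>?D s\<bar>)"
    using set_integral_norm_bound[OF D] by simp
  also have "\<dots> \<le> (LINT s:{0<..}|lborel. h\<^sup>2 * (cosh s ^ (m + 2) * exp (- (z / 2 * cosh s))))"
    by (intro set_integral_mono set_integrable_abs[OF D] set_integrable_mult_right M pt)
  also have "\<dots> = M * h\<^sup>2" by (simp only: M_def set_integral_mult_right mult.commute)
  finally show "\<bar>macdonald \<nu> m (z + h) - macdonald \<nu> m z - h * - macdonald \<nu> (Suc m) z\<bar> \<le> M * h\<^sup>2"
    unfolding eq .
qed

lemma smooth_on_macdonald: "smooth_on {0<..} (macdonald \<nu> m)"
proof (rule smooth_on_coinduct[where S="{g. \<exists>c m. g = (\<lambda>z. c * macdonald \<nu> m z)}"], goal_cases)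
  case 1
  show ?case by (rule CollectI, rule exI[of _ 1], rule exI[of _ m]) simp
next
  case (2 g)
  then obtain c m where g: "g = (\<lambda>z. c * macdonald \<nu> m z)" by auto
  show ?case unfolding g
  proof (rule bexI[of _ "\<lambda>z. (- c) * macdonald \<nu> (Suc m) z"])
    show "\<forall>x\<in>{0<..}. ((\<lambda>z. c * macdonald \<nu> m z) has_real_derivative - c * macdonald \<nu> (Suc m) x) (at x)"
      by (auto intro!: derivative_eq_intros macdonald_deriv)
  qed blast
qed

text \<open>The difference of the two sides is the integral of an exact derivative. Its primitive
  \<open>G\<close>, found by integrating by parts in the trigonometric and the hyperbolic factor,
  vanishes at 0 because both sines do, and at infinity by decay.\<close>

lemma macdonald_ode:
  assumes z: "0 < z"
  shows "z\<^sup>2 * macdonald \<nu> 2 z - z * macdonald \<nu> 1 z = (z\<^sup>2 - \<nu>\<^sup>2) * macdonald \<nu> 0 z"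
proof -
  let ?E = "\<lambda>s. exp (- (z * cosh s))"
  define G where "G = (\<lambda>s. (\<nu> * sin (\<nu> * s) - z * sinh s * cos (\<nu> * s)) * ?E s)"
  define g where "g = (\<lambda>s. z\<^sup>2 * (cosh s ^ 2 * cos (\<nu> * s) * ?E s) - z * (cosh s ^ 1 * cos (\<nu> * s) * ?E s)
      - (z\<^sup>2 - \<nu>\<^sup>2) * (cosh s ^ 0 * cos (\<nu> * s) * ?E s))"
  note ints = macdonald_integrable[OF z, of 2 \<nu>] macdonald_integrable[OF z, of 1 \<nu>]
    macdonald_integrable[OF z, of 0 \<nu>]
  have gi: "set_integrable lborel {0<..} g" unfolding g_def
    by (intro set_integral_diff(1) set_integrable_mult_right ints)
  have ei: "einterval 0 \<infinity> = {0<..}" by (auto simp: einterval_def zero_ereal_def)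
  have "(LBINT s=0..\<infinity>. g s) = 0 - 0"
  proof (rule interval_integral_FTC_integrable)
    show "set_integrable lborel (einterval 0 \<infinity>) g" unfolding ei by (rule gi)
    show "(G has_vector_derivative g s) (at s)" for s
      unfolding has_real_derivative_iff_has_vector_derivative[symmetric] G_def g_def cosh_square_eq
      by (auto intro!: derivative_eq_intros simp: algebra_simps power2_eq_square)
    show "isCont g s" for s unfolding g_def by (intro continuous_intros)
    have "isCont G 0" unfolding G_def by (intro continuous_intros)
    then have "(G \<longlongrightarrow> 0) (at_right 0)"
      unfolding isCont_def using filterlim_at_split by (fastforce simp: G_def)
    then show "((G \<circ> real_of_ereal) \<longlongrightarrow> 0) (at_right 0)"
      by (simp add: zero_ereal_def ereal_tendsto_simps)
    obtain C where C: "0 \<le> C" "\<And>s::real. cosh s ^ 1 * ?E s \<le> C * exp (- s)"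
      using cosh_exp_le_exp_neg[OF z] by metis
    have "(G \<longlongrightarrow> 0) at_top"
    proof (rule Lim_null_comparison)
      show "((\<lambda>s. (\<bar>\<nu>\<bar> + z) * C * exp (- s)) \<longlongrightarrow> 0) at_top"
        using tendsto_mult[OF tendsto_const[of "(\<bar>\<nu>\<bar> + z) * C"]
            filterlim_compose[OF exp_at_bot filterlim_uminus_at_bot_at_top]] by simp
      have "norm (G s) \<le> (\<bar>\<nu>\<bar> + z) * C * exp (- s)" if "0 \<le> s" for s
      proof -
        have "\<bar>\<nu> * sin (\<nu> * s)\<bar> \<le> \<bar>\<nu>\<bar> * cosh s"
          unfolding abs_mult using order_trans[OF abs_sin_le_one cosh_real_ge_1]
          by (intro mult_left_mono) auto
        moreover have "\<bar>z * sinh s * cos (\<nu> * s)\<bar> \<le> (z * cosh s) * 1"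
          unfolding abs_mult using z that sinh_le_cosh_real[of s]
          by (intro mult_mono) auto
        ultimately have "\<bar>\<nu> * sin (\<nu> * s) - z * sinh s * cos (\<nu> * s)\<bar> \<le> (\<bar>\<nu>\<bar> + z) * cosh s"
          by (simp add: algebra_simps)
        then have "norm (G s) \<le> (\<bar>\<nu>\<bar> + z) * cosh s * ?E s"
          unfolding G_def by (simp add: abs_mult)
        also have "\<dots> \<le> (\<bar>\<nu>\<bar> + z) * (C * exp (- s))"
          using mult_left_mono[OF C(2)[of s], of "\<bar>\<nu>\<bar> + z"] z by (simp add: mult.assoc)
        finally show ?thesis by simp
      qed
      then show "\<forall>\<^sub>F s in at_top. norm (G s) \<le> (\<bar>\<nu>\<bar> + z) * C * exp (- s)"
        using eventually_ge_at_top[of 0] by (rule eventually_mono[rotated])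
    qed
    then show "((G \<circ> real_of_ereal) \<longlongrightarrow> 0) (at_left \<infinity>)"
      by (simp add: ereal_tendsto_simps)
  qed simp
  then have "(LINT s:{0<..}|lborel. g s) = 0"
    by (simp add: interval_lebesgue_integral_def ei)
  then show ?thesis
    unfolding g_def macdonald_def using ints
    by (simp only: set_integral_diff set_integrable_mult_right set_integral_mult_right)
qed

text \<open>Laplace's method with explicit constants: cosh s - 1 >= s^2 / 4 makes the integrand
  essentially a Gaussian of width z^(-1/2). The Gaussian is replaced by the exponential of
  \<open>- (r * s)\<close> with \<open>r = sqrt z\<close>, whose integral is 1 / r.\<close>

lemma macdonald_bound:
  assumes "1 \<le> z" "m \<le> 1"
  shows "\<bar>macdonald \<nu> m z\<bar> \<le> 2 * exp 2 * z powr (- 1 / 2) * exp (- z)"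
proof -
  define r where "r = sqrt z"
  have r: "0 < r" "r * r = z" using assms by (auto simp: r_def)
  have pt: "\<bar>cosh s ^ m * cos (\<nu> * s) * exp (- (z * cosh s))\<bar> \<le> 2 * exp 2 * exp (- z) * exp (- (r * s))"
    if "s \<in> {0<..}" for s
  proof -
    define y where "y = cosh s - 1"
    have "1 + s + s\<^sup>2 / 2 \<le> exp s" using that exp_lower_Taylor_quadratic[of s] by simp
    moreover have "1 - s \<le> exp (- s)" using exp_ge_add_one_self[of "- s"] by simp
    ultimately have y: "s\<^sup>2 / 4 \<le> y" unfolding y_def cosh_field_def by (simp add: field_simps)
    then have y0: "0 \<le> y" using zero_le_power2[of s] by linarith
    have e1: "1 + y \<le> 2 * exp (z * y / 2)"
    proof -
      have "1 + y / 2 \<le> exp (y / 2)" by (rule exp_ge_add_one_self)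
      also have "\<dots> \<le> exp (z * y / 2)" using mult_right_mono[OF assms(1) y0] by simp
      finally show ?thesis using y0 by linarith
    qed
    \<comment> \<open>This square gives r s - 2 <= (r s)^2 / 8, the passage from Gaussian to
      exponential; it produces the constant exp 2.\<close>
    have "0 \<le> (r * s - 4)\<^sup>2" by simp
    then have "r * s - 2 \<le> z * (s\<^sup>2 / 4) / 2" unfolding r(2)[symmetric]
      by (simp add: power2_eq_square algebra_simps)
    also have "\<dots> \<le> z * y / 2" using mult_left_mono[OF y, of z] assms by simp
    finally have e2: "exp (- (z * y / 2)) \<le> exp 2 * exp (- (r * s))" by (simp add: exp_add[symmetric])
    have "cosh s ^ m \<le> cosh s ^ 1" using assms(2) cosh_real_ge_1 by (intro power_increasing) auto
    then have "\<bar>cosh s ^ m * cos (\<nu> * s) * exp (- (z * cosh s))\<bar> \<le> cosh s * 1 * exp (- (z * cosh s))"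
      unfolding abs_mult by (intro mult_mono) auto
    also have "\<dots> = exp (- z) * ((1 + y) * exp (- (z * y)))"
      by (simp add: y_def algebra_simps exp_add[symmetric])
    also have "(1 + y) * exp (- (z * y)) \<le> 2 * exp (z * y / 2) * exp (- (z * y))"
      using e1 by (intro mult_right_mono) auto
    also have "\<dots> = 2 * exp (- (z * y / 2))" by (simp add: exp_add[symmetric])
    also have "\<dots> \<le> 2 * (exp 2 * exp (- (r * s)))" using e2 by simp
    finally show ?thesis by (simp add: mult_ac)
  qed
  have "\<bar>macdonald \<nu> m z\<bar> \<le> (LINT s:{0<..}|lborel. \<bar>cosh s ^ m * cos (\<nu> * s) * exp (- (z * cosh s))\<bar>)"
    unfolding macdonald_def using set_integral_norm_bound[OF macdonald_integrable, of z m \<nu>] assms by simp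
  also have "\<dots> \<le> (LINT s:{0<..}|lborel. 2 * exp 2 * exp (- z) * exp (- (r * s)))"
    using assms r
    by (intro set_integral_mono set_integrable_abs macdonald_integrable set_integrable_mult_right
        set_integrable_exp_neg pt) auto
  also have "\<dots> = 2 * exp 2 * exp (- z) * (1 / r)"
    using set_integrable_exp_neg(2)[OF r(1)] by simp
  also have "1 / r = z powr (- 1 / 2)"
    using assms by (simp add: r_def powr_half_sqrt[symmetric] powr_minus_divide)
  finally show ?thesis by (simp add: mult_ac)
qed

text \<open>For large z the integral is dominated by small s, where the cosine is at least 1/2. What
  lies beyond \<open>s0\<close> is smaller by a factor exponential in z, because cosh increases
  strictly from \<open>s1\<close> to \<open>s0\<close>.\<close>

lemma cos_weighted_integral_pos:
  fixes \<nu> :: real and w :: "real \<Rightarrow> real"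
  assumes \<nu>: "0 < \<nu>" and w: "continuous_on UNIV w" "\<And>s. 1 / 2 \<le> w s" "\<And>s. w s \<le> cosh s"
  shows "\<exists>Z. \<forall>z\<ge>Z. 0 < (LINT s:{0<..}|lborel. w s * cos (\<nu> * s) * exp (- (z * cosh s)))"
proof -
  \<comment> \<open>At \<open>s0\<close> the cosine has dropped to 1/2. Below \<open>s1\<close>,
    half of it, the integrand is at least exp (- z cosh s1) / 4, and the gap \<open>d\<close>
    between the two values of cosh is the exponential gain.\<close>
  define s0 where "s0 = pi / (3 * \<nu>)"
  define s1 where "s1 = s0 / 2"
  have s: "0 < s1" "s1 < s0" using \<nu> by (auto simp: s0_def s1_def intro!: divide_strict_left_mono)
  define M where "M = (LINT s:{0::real<..}|lborel. cosh s * exp (- (1 * cosh s)))"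
  have Mi: "set_integrable lborel {0::real<..} (\<lambda>s. cosh s * exp (- (1 * cosh s)))"
    by (rule set_integrable_cosh_exp[where z=1 and w=cosh and c=1 and m=1]) (auto intro!: continuous_intros)
  define d where "d = cosh s0 - cosh s1"
  have d: "0 < d" unfolding d_def using s cosh_real_strict_mono[of s1 s0] by simp
  have I: "{0<..} \<inter> {0<..<s1} = {0<..<s1}" by auto
  have ii: "set_integrable lborel {0<..} (\<lambda>s. indicator {0<..<s1} s :: real)"
    unfolding set_integrable_def using s by (simp add: indicator_inter_arith[symmetric] I)
  have iv: "(LINT s:{0<..}|lborel. indicator {0<..<s1} s) = s1"
    unfolding set_lebesgue_integral_def using s by (simp add: indicator_inter_arith[symmetric] I)
  have main: "s1 / 4 * exp (- (z * cosh s1)) - M * exp (- ((z - 1) * cosh s0))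
      \<le> (LINT s:{0<..}|lborel. w s * cos (\<nu> * s) * exp (- (z * cosh s)))" if z: "1 \<le> z" for z
  proof -
    have "(LINT s:{0<..}|lborel. exp (- (z * cosh s1)) / 4 * indicator {0<..<s1} s
           - exp (- ((z - 1) * cosh s0)) * (cosh s * exp (- (1 * cosh s))))
      \<le> (LINT s:{0<..}|lborel. w s * cos (\<nu> * s) * exp (- (z * cosh s)))"
    proof (rule set_integral_mono)
      show "set_integrable lborel {0<..} (\<lambda>s. exp (- (z * cosh s1)) / 4 * indicator {0<..<s1} s
           - exp (- ((z - 1) * cosh s0)) * (cosh s * exp (- (1 * cosh s))))"
        by (intro set_integral_diff(1) set_integrable_mult_right ii Mi)
      show "set_integrable lborel {0<..} (\<lambda>s. w s * cos (\<nu> * s) * exp (- (z * cosh s)))"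
      proof (rule set_integrable_cosh_exp[of _ _ 1 1])
        fix s
        have "\<bar>w s\<bar> * \<bar>cos (\<nu> * s)\<bar> \<le> cosh s * 1" using w(2,3)[of s] by (intro mult_mono) auto
        then show "\<bar>w s * cos (\<nu> * s)\<bar> \<le> 1 * cosh s ^ 1" by (simp add: abs_mult)
      qed (use z w in \<open>auto intro!: continuous_intros\<close>)
      fix s :: real assume "s \<in> {0<..}"
      then have s_pos: "0 < s" by simp
      have nn: "0 \<le> exp (- ((z - 1) * cosh s0)) * (cosh s * exp (- (1 * cosh s)))" by simp
      show "exp (- (z * cosh s1)) / 4 * indicator {0<..<s1} s
           - exp (- ((z - 1) * cosh s0)) * (cosh s * exp (- (1 * cosh s)))
          \<le> w s * cos (\<nu> * s) * exp (- (z * cosh s))"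
      proof (cases "s \<le> s0")
        case True
        have "\<nu> * s \<le> pi / 3" using True \<nu> by (simp add: s0_def field_simps)
        then have "cos (pi / 3) \<le> cos (\<nu> * s)"
          using \<nu> s_pos by (intro cos_monotone_0_pi_le) auto
        then have "1 / 2 * (1 / 2) \<le> w s * cos (\<nu> * s)"
          using w(2) by (intro mult_mono) (auto simp: cos_60 intro: order_trans[OF _ w(2)])
        then have wc: "1 / 4 * exp (- (z * cosh s)) \<le> w s * cos (\<nu> * s) * exp (- (z * cosh s))"
          by (intro mult_right_mono) auto
        have "exp (- (z * cosh s1)) / 4 * indicator {0<..<s1} s \<le> 1 / 4 * exp (- (z * cosh s))"
          using s_pos s z cosh_real_nonneg_le_iff[of s s1] by (auto simp: indicator_def)
        then show ?thesis using wc nn by linarith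
      next
        case False
        have "- (cosh s * exp (- (z * cosh s))) \<le> w s * cos (\<nu> * s) * exp (- (z * cosh s))"
        proof -
          have "\<bar>w s\<bar> * \<bar>cos (\<nu> * s)\<bar> \<le> cosh s * 1" using w(2,3)[of s] by (intro mult_mono) auto
          then have "- cosh s \<le> w s * cos (\<nu> * s)" by (simp add: abs_mult[symmetric])
          then show ?thesis using mult_right_mono[of "- cosh s" "w s * cos (\<nu> * s)" "exp (- (z * cosh s))"]
            by simp
        qed
        \<comment> \<open>One unit of z is kept in the factor exp (- cosh s), so that the tail
          remains integrable with a bound \<open>M\<close> independent of z.\<close>
        moreover have "exp (- (z * cosh s)) \<le> exp (- ((z - 1) * cosh s0)) * exp (- (1 * cosh s))"
        proof -
          have "cosh s0 \<le> cosh s" using False s by (subst cosh_real_nonneg_le_iff) auto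
          then have "(z - 1) * cosh s0 \<le> (z - 1) * cosh s" using z by (intro mult_left_mono) auto
          then show ?thesis by (simp add: exp_add[symmetric] algebra_simps)
        qed
        then have "cosh s * exp (- (z * cosh s)) \<le> cosh s * (exp (- ((z - 1) * cosh s0)) * exp (- (1 * cosh s)))"
          by (intro mult_left_mono) auto
        then have "cosh s * exp (- (z * cosh s)) \<le> exp (- ((z - 1) * cosh s0)) * (cosh s * exp (- (1 * cosh s)))"
          by (simp only: mult.left_commute)
        ultimately have "- (exp (- ((z - 1) * cosh s0)) * (cosh s * exp (- (1 * cosh s))))
            \<le> w s * cos (\<nu> * s) * exp (- (z * cosh s))" by linarith
        moreover have "indicator {0<..<s1} s = (0::real)" using False s by simp
        ultimately show ?thesis by simp
      qed
    qed
    then show ?thesis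
      using ii Mi
      by (simp only: set_integral_diff(2) set_integrable_mult_right set_integral_mult_right iv
          M_def[symmetric]) (simp add: mult_ac)
  qed
  \<comment> \<open>From here on z * d is at least 4 |M| exp (cosh s0) / s1, and exp (z * d) is
    strictly larger.\<close>
  define Z where "Z = max 1 ((4 * \<bar>M\<bar> * exp (cosh s0) / s1) / d)"
  have "0 < (LINT s:{0<..}|lborel. w s * cos (\<nu> * s) * exp (- (z * cosh s)))" if z: "Z \<le> z" for z
  proof -
    have "4 * \<bar>M\<bar> * exp (cosh s0) / s1 \<le> z * d"
      using z unfolding Z_def pos_divide_le_eq[OF d, symmetric] by linarith
    also have "\<dots> < exp (z * d)" using exp_ge_add_one_self[of "z * d"] by linarith
    finally have "4 * \<bar>M\<bar> * exp (cosh s0) < s1 * exp (z * d)" using s by (simp add: field_simps)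
    then have "(4 * \<bar>M\<bar> * exp (cosh s0)) * exp (- (z * cosh s0)) < s1 * exp (z * d) * exp (- (z * cosh s0))"
      by (intro mult_strict_right_mono) auto
    moreover have "exp (cosh s0) * exp (- (z * cosh s0)) = exp (- ((z - 1) * cosh s0))"
      "exp (z * d) * exp (- (z * cosh s0)) = exp (- (z * cosh s1))"
      by (simp_all add: d_def exp_add[symmetric] algebra_simps)
    ultimately have "4 * \<bar>M\<bar> * exp (- ((z - 1) * cosh s0)) < s1 * exp (- (z * cosh s1))"
      by (simp only: mult.assoc)
    moreover have "M * exp (- ((z - 1) * cosh s0)) \<le> \<bar>M\<bar> * exp (- ((z - 1) * cosh s0))"
      by (intro mult_right_mono) auto
    moreover have "1 \<le> z" using z by (simp add: Z_def)
    ultimately show ?thesis using main[of z] by linarith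
  qed
  then show ?thesis by blast
qed

text \<open>The second inequality is the positivity statement for the weight cosh s - 1/2. The ratio
  1/2 is dictated by the data term, in which the function of index 0 has the coefficient (\<beta> -
  1) / 2, possibly as low as -1/2.\<close>

lemma macdonald_signs:
  assumes "0 < \<nu>"
  shows "\<exists>Z\<ge>1. \<forall>z\<ge>Z. 0 < macdonald \<nu> 0 z \<and> macdonald \<nu> 0 z / 2 < macdonald \<nu> 1 z"
proof -
  obtain Z1 where Z1: "\<And>z. z \<ge> Z1 \<Longrightarrow> 0 < (LINT s:{0<..}|lborel. 1 * cos (\<nu> * s) * exp (- (z * cosh s)))"
    using cos_weighted_integral_pos[OF assms, of "\<lambda>s. 1"] cosh_real_ge_1 by auto
  have "1 / 2 \<le> cosh s - 1 / 2" for s :: real using cosh_real_ge_1[of s] by simp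
  moreover have "continuous_on UNIV (\<lambda>s::real. cosh s - 1 / 2)" by (intro continuous_intros)
  ultimately have "\<exists>Z. \<forall>z\<ge>Z. 0 < (LINT s:{0<..}|lborel. (cosh s - 1 / 2) * cos (\<nu> * s) * exp (- (z * cosh s)))"
    by (intro cos_weighted_integral_pos[OF assms]) auto
  then obtain Z2 where Z2: "\<And>z. z \<ge> Z2 \<Longrightarrow>
      0 < (LINT s:{0<..}|lborel. (cosh s - 1 / 2) * cos (\<nu> * s) * exp (- (z * cosh s)))"
    by blast
  define Z where "Z = max 1 (max Z1 Z2)"
  have "0 < macdonald \<nu> 0 z \<and> macdonald \<nu> 0 z / 2 < macdonald \<nu> 1 z" if z: "Z \<le> z" for z
  proof
    show "0 < macdonald \<nu> 0 z" using Z1[of z] z by (simp add: macdonald_def Z_def)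
    have "macdonald \<nu> 1 z - 1 / 2 * macdonald \<nu> 0 z
        = (LINT s:{0<..}|lborel. cosh s ^ 1 * cos (\<nu> * s) * exp (- (z * cosh s))
            - 1 / 2 * (cosh s ^ 0 * cos (\<nu> * s) * exp (- (z * cosh s))))"
      unfolding macdonald_def using macdonald_integrable[of z 1 \<nu>] macdonald_integrable[of z 0 \<nu>] z
      by (subst set_integral_diff(2)) (simp_all only: set_integral_mult_right, auto simp: Z_def)
    also have "\<dots> = (LINT s:{0<..}|lborel. (cosh s - 1 / 2) * cos (\<nu> * s) * exp (- (z * cosh s)))"
      by (simp add: algebra_simps)
    finally show "macdonald \<nu> 0 z / 2 < macdonald \<nu> 1 z" using Z2[of z] z by (simp add: Z_def)
  qed
  then show ?thesis by (intro exI[of _ Z]) (auto simp: Z_def)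
qed

text \<open>The substitution \<open>s = 1 + t\<close>, \<open>z = \<kappa> s\<^sup>1\<^sup>+\<^sup>l / (1 + l)\<close> turns the Bessel equation of
  order \<open>i\<nu>\<close>, where \<open>(1 + l)\<^sup>2 \<nu>\<^sup>2 = \<mu>\<^sup>2 - (1 - \<beta>)\<^sup>2 / 4\<close>, into the adjoint equation for
  \<open>s\<close> to the power \<open>(1 + \<beta>) / 2\<close> times the Macdonald function. The hypothesis \<open>(1 - \<beta>)\<^sup>2 < 4 \<mu>\<^sup>2\<close>
  makes \<open>\<nu>\<close> real, so the function oscillates near \<open>z = 0\<close>; a large \<open>\<kappa>\<close> puts all \<open>t \<ge> 0\<close>
  beyond the last sign change.\<close>

lemma decaying_time_factor:
  fixes l \<beta> \<mu> :: real
  assumes l: "-1 < l" and \<beta>: "0 \<le> \<beta>" and \<delta>: "(1 - \<beta>)\<^sup>2 - 4 * \<mu>\<^sup>2 < 0"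
  obtains \<kappa> C :: real and L L1 L2 :: "real \<Rightarrow> real"
  where "0 < \<kappa>" "0 \<le> C" "smooth_on {-1<..} L"
    "\<And>t. -1 < t \<Longrightarrow> (L has_real_derivative L1 t) (at t)"
    "\<And>t. -1 < t \<Longrightarrow> (L1 has_real_derivative L2 t) (at t)"
    "\<And>t. 0 \<le> t \<Longrightarrow> 0 < L t" "0 < \<beta> * L 0 - L1 0"
    "\<And>t. -1 < t \<Longrightarrow> L2 t - \<kappa>\<^sup>2 * (1 + t) powr (2 * l) * L t
        - (\<beta> / (1 + t) * L1 t - \<beta> / (1 + t)\<^sup>2 * L t) + \<mu>\<^sup>2 / (1 + t)\<^sup>2 * L t = 0"
    "\<And>t. 0 \<le> t \<Longrightarrow> \<bar>L t\<bar> \<le> C * (1 + t) powr ((\<beta> - l) / 2) * exp (- (\<kappa> * (((1 + t) powr (1 + l) - 1) / (1 + l))))"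
    "\<And>t. 0 \<le> t \<Longrightarrow> \<bar>L1 t\<bar> \<le> C * (1 + t) powr ((\<beta> + l) / 2) * exp (- (\<kappa> * (((1 + t) powr (1 + l) - 1) / (1 + l))))"
proof -
  define b where "b = 1 + l"
  have b: "0 < b" using l by (simp add: b_def)
  define \<nu> where "\<nu> = sqrt (\<mu>\<^sup>2 - (1 - \<beta>)\<^sup>2 / 4) / b"
  have \<nu>: "0 < \<nu>" using \<delta> b by (simp add: \<nu>_def)
  have \<nu>2: "b\<^sup>2 * \<nu>\<^sup>2 = \<mu>\<^sup>2 - (1 - \<beta>)\<^sup>2 / 4" using \<delta> b by (simp add: \<nu>_def power_divide)
  obtain Z where Z: "1 \<le> Z"
    "\<And>z. Z \<le> z \<Longrightarrow> 0 < macdonald \<nu> 0 z \<and> macdonald \<nu> 0 z / 2 < macdonald \<nu> 1 z"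
    using macdonald_signs[OF \<nu>] by auto
  \<comment> \<open>The entry \<open>Z * b\<close> puts the initial value
    \<open>\<kappa> / b\<close> of \<open>z\<close> beyond the threshold \<open>Z\<close>; the bound
    \<open>1 \<le> \<kappa>\<close> is used for the sign of the data term.\<close>
  define \<kappa> where "\<kappa> = max 1 (Z * b)"
  have \<kappa>: "1 \<le> \<kappa>" "Z \<le> \<kappa> / b" using b by (auto simp: \<kappa>_def pos_le_divide_eq)
  define z where "z = (\<lambda>t. \<kappa> / b * (1 + t) powr b)"
  \<comment> \<open>The exponent with \<open>2 * \<alpha> - 1 - \<beta> = 0\<close>: the terms in
    \<open>k 1\<close> that the weight creates cancel, and Bessel's equation remains.\<close>
  define \<alpha> where "\<alpha> = (1 + \<beta>) / 2"
  define k where "k = macdonald \<nu>"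
  define P where "P = (\<lambda>t. (1 + t) powr \<alpha>)"
  define L where "L = (\<lambda>t. P t * k 0 (z t))"
  define L1 where "L1 = (\<lambda>t. P t / (1 + t) * (\<alpha> * k 0 (z t) - b * z t * k 1 (z t)))"
  define L2 where "L2 = (\<lambda>t. P t / (1 + t)\<^sup>2 * ((\<alpha>\<^sup>2 - \<alpha>) * k 0 (z t) - (2 * \<alpha> * b + b\<^sup>2 - b) * z t * k 1 (z t)
      + b\<^sup>2 * (z t)\<^sup>2 * k 2 (z t)))"
  have zpos: "0 < z t" if "-1 < t" for t using that \<kappa> b by (simp add: z_def)
  have zZ: "Z \<le> z t" if "0 \<le> t" for t
  proof -
    have "1 \<le> (1 + t) powr b" using that b by (simp add: ge_one_powr_ge_zero)
    then have "\<kappa> / b * 1 \<le> z t" unfolding z_def using \<kappa> b by (intro mult_left_mono) auto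
    then show ?thesis using \<kappa> by simp
  qed
  have zd: "(z has_real_derivative b * z t / (1 + t)) (at t)" if "-1 < t" for t
    using that b \<kappa> unfolding z_def
    by (auto intro!: derivative_eq_intros simp: powr_diff)
  have Pd: "(P has_real_derivative \<alpha> * P t / (1 + t)) (at t)" if "-1 < t" for t
    using that unfolding P_def by (auto intro!: derivative_eq_intros simp: powr_diff)
  have kd: "((\<lambda>t. k m (z t)) has_real_derivative - (k (Suc m) (z t)) * (b * z t / (1 + t))) (at t)"
    if "-1 < t" for t m
    unfolding k_def by (rule DERIV_chain2[OF macdonald_deriv[OF zpos[OF that]] zd[OF that]])
  have Ld: "(L has_real_derivative L1 t) (at t)" if t: "-1 < t" for t
  proof -
    have "(L has_real_derivative P t * (- (k 1 (z t)) * (b * z t / (1 + t))) + \<alpha> * P t / (1 + t) * k 0 (z t)) (at t)"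
      unfolding L_def using DERIV_mult[OF Pd[OF t] kd[OF t, of 0]] by (simp add: algebra_simps)
    moreover have "P t * (- (k 1 (z t)) * (b * z t / (1 + t))) + \<alpha> * P t / (1 + t) * k 0 (z t) = L1 t"
      using t by (simp add: L1_def divide_simps) (simp add: algebra_simps)
    ultimately show ?thesis by simp
  qed
  have L1d: "(L1 has_real_derivative L2 t) (at t)" if t: "-1 < t" for t
  proof -
    have Qd: "((\<lambda>t. P t / (1 + t)) has_real_derivative (\<alpha> - 1) * P t / (1 + t)\<^sup>2) (at t)"
    proof -
      have "((\<lambda>t. 1 + t) has_real_derivative 1) (at t)" by (auto intro!: derivative_eq_intros)
      from DERIV_divide[OF Pd[OF t] this] t show ?thesis
        by (simp add: power2_eq_square left_diff_distrib)
    qed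
    have k1: "((\<lambda>t. k 1 (z t)) has_real_derivative - (k 2 (z t)) * (b * z t / (1 + t))) (at t)"
      using kd[OF t, of 1] by (simp add: numeral_2_eq_2)
    have k0: "((\<lambda>t. k 0 (z t)) has_real_derivative - (k 1 (z t)) * (b * z t / (1 + t))) (at t)"
      using kd[OF t, of 0] by simp
    have Rd: "((\<lambda>t. \<alpha> * k 0 (z t) - b * z t * k 1 (z t)) has_real_derivative
       \<alpha> * (- (k 1 (z t)) * (b * z t / (1 + t))) - (b * (b * z t / (1 + t)) * k 1 (z t)
          + b * z t * (- (k 2 (z t)) * (b * z t / (1 + t))))) (at t)"
      by (rule derivative_eq_intros refl k0 k1 zd[OF t])+ (simp add: algebra_simps)
    show ?thesis unfolding L1_def
      by (rule DERIV_cong[OF DERIV_mult[OF Qd Rd]])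
        (use t in \<open>simp add: L2_def divide_simps, simp add: algebra_simps power2_eq_square\<close>)
  qed
  have ode: "L2 t - \<kappa>\<^sup>2 * (1 + t) powr (2 * l) * L t
        - (\<beta> / (1 + t) * L1 t - \<beta> / (1 + t)\<^sup>2 * L t) + \<mu>\<^sup>2 / (1 + t)\<^sup>2 * L t = 0" if t: "-1 < t" for t
  proof -
    let ?x = "z t"
    have "b\<^sup>2 * ?x\<^sup>2 = \<kappa>\<^sup>2 * ((1 + t) powr b)\<^sup>2" using b by (simp add: z_def power_mult_distrib power_divide)
    also have "((1 + t) powr b)\<^sup>2 = (1 + t) powr (2 * l + 2)"
      by (simp add: b_def power2_eq_square powr_add[symmetric] algebra_simps)
    also have "\<dots> = (1 + t) powr (2 * l) * (1 + t)\<^sup>2"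
      using t by (simp add: powr_add)
    finally have zz: "\<kappa>\<^sup>2 * (1 + t) powr (2 * l) = b\<^sup>2 * ?x\<^sup>2 / (1 + t)\<^sup>2"
      using t by (simp add: field_simps)
    have ode0: "?x\<^sup>2 * k 2 ?x - ?x * k 1 ?x = (?x\<^sup>2 - \<nu>\<^sup>2) * k 0 ?x"
      unfolding k_def by (rule macdonald_ode[OF zpos[OF t]])
    have a2: "\<alpha>\<^sup>2 - \<alpha> - \<beta> * \<alpha> + \<beta> + \<mu>\<^sup>2 = b\<^sup>2 * \<nu>\<^sup>2" unfolding \<nu>2 \<alpha>_def
      by (simp add: power2_eq_square field_simps)
    have ab: "2 * \<alpha> - 1 - \<beta> = 0" by (simp add: \<alpha>_def field_simps)
    have "L2 t - b\<^sup>2 * ?x\<^sup>2 / (1 + t)\<^sup>2 * L t - (\<beta> / (1 + t) * L1 t - \<beta> / (1 + t)\<^sup>2 * L t) + \<mu>\<^sup>2 / (1 + t)\<^sup>2 * L t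
       = P t / (1 + t)\<^sup>2 * ((\<alpha>\<^sup>2 - \<alpha> - \<beta> * \<alpha> + \<beta> + \<mu>\<^sup>2) * k 0 ?x - b * (2 * \<alpha> - 1 - \<beta>) * ?x * k 1 ?x
          + b\<^sup>2 * (?x\<^sup>2 * k 2 ?x - ?x * k 1 ?x) - b\<^sup>2 * ?x\<^sup>2 * k 0 ?x)"
      using t unfolding L_def L1_def L2_def
      by (simp add: divide_simps) (simp add: algebra_simps power2_eq_square)
    also have "\<dots> = 0" unfolding a2 ab ode0 by (simp add: algebra_simps)
    finally show ?thesis unfolding zz .
  qed
  have smooth: "smooth_on {-1<..} L"
  proof -
    have *: "smooth_on {-1<..} (\<lambda>t. (1 + t) powr a)" for a
      by (rule smooth_on_compose[where g="\<lambda>t. 1 + t", OF _ _ smooth_on_powr])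
        (use smooth_on_affine[of _ 1 1] in \<open>auto simp: add.commute\<close>)
    have "smooth_on {-1<..} z" unfolding z_def by (intro smooth_on_mult smooth_on_const *)
    then have "smooth_on {-1<..} (\<lambda>t. k 0 (z t))" unfolding k_def
      by (rule smooth_on_compose[OF _ _ smooth_on_macdonald, rotated 2]) (auto simp: zpos)
    then show ?thesis unfolding L_def P_def by (intro smooth_on_mult *)
  qed
  have pos: "0 < L t" if "0 \<le> t" for t
    using that Z(2)[OF zZ[OF that]] by (simp add: L_def P_def k_def)
  have data: "0 < \<beta> * L 0 - L1 0"
  proof -
    have *: "0 < k 0 (z 0)" "k 0 (z 0) / 2 < k 1 (z 0)" using Z(2)[OF zZ[of 0]] by (auto simp: k_def)
    have "\<beta> * L 0 - L1 0 = (\<beta> - 1) / 2 * k 0 (z 0) + \<kappa> * k 1 (z 0)"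
      using b by (simp add: L_def L1_def P_def z_def \<alpha>_def field_simps)
    moreover have "1 * (k 0 (z 0) / 2) < \<kappa> * k 1 (z 0)"
      using * \<kappa> by (intro mult_le_less_imp_less) auto
    moreover have "0 \<le> \<beta> / 2 * k 0 (z 0)" using * \<beta> by simp
    ultimately show ?thesis by (simp add: field_simps)
  qed
  \<comment> \<open>The factor exp (- \<kappa> / b) is split off so that exp (- z t) becomes exp (-
    \<kappa> A t), where \<open>A\<close> is the propagation radius.\<close>
  define K where "K = 2 * exp 2 * (\<kappa> / b) powr (- 1 / 2) * exp (- (\<kappa> / b))"
  have K: "0 \<le> K" by (simp add: K_def)
  define A where "A = (\<lambda>t. ((1 + t) powr b - 1) / b)"
  have kb: "\<bar>k m (z t)\<bar> \<le> K * (1 + t) powr (- b / 2) * exp (- (\<kappa> * A t))" if "0 \<le> t" "m \<le> 1" for t m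
  proof -
    have "1 \<le> z t" using zZ[OF that(1)] Z(1) by simp
    then have "\<bar>k m (z t)\<bar> \<le> 2 * exp 2 * z t powr (- 1 / 2) * exp (- z t)"
      unfolding k_def using that by (intro macdonald_bound)
    also have "z t powr (- 1 / 2) = (\<kappa> / b) powr (- 1 / 2) * (1 + t) powr (- b / 2)"
    proof -
      have "z t powr (- 1 / 2) = (\<kappa> / b) powr (- 1 / 2) * ((1 + t) powr b) powr (- 1 / 2)"
        unfolding z_def by (rule powr_mult)
      then show ?thesis by (simp add: powr_powr)
    qed
    also have "exp (- z t) = exp (- (\<kappa> / b)) * exp (- (\<kappa> * A t))"
      using b by (simp add: exp_add[symmetric] z_def A_def field_simps)
    finally show ?thesis by (simp add: K_def mult_ac)
  qed
  define C where "C = K * (1 + \<alpha> + \<kappa>)"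
  have \<alpha>0: "0 \<le> \<alpha>" using \<beta> by (simp add: \<alpha>_def)
  have CK: "K \<le> C" unfolding C_def using K \<alpha>0 \<kappa> mult_left_mono[of 1 "1 + \<alpha> + \<kappa>" K] by simp
  have bL: "\<bar>L t\<bar> \<le> C * (1 + t) powr ((\<beta> - l) / 2) * exp (- (\<kappa> * A t))" if t: "0 \<le> t" for t
  proof -
    have "\<bar>L t\<bar> \<le> P t * (K * (1 + t) powr (- b / 2) * exp (- (\<kappa> * A t)))"
      unfolding L_def abs_mult using kb[OF t, of 0] by (intro mult_mono) (auto simp: P_def)
    also have "\<dots> = K * (P t * (1 + t) powr (- b / 2)) * exp (- (\<kappa> * A t))" by simp
    also have "P t * (1 + t) powr (- b / 2) = (1 + t) powr ((\<beta> - l) / 2)"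
      by (simp add: P_def powr_add[symmetric] \<alpha>_def b_def field_simps)
    also have "K * (1 + t) powr ((\<beta> - l) / 2) * exp (- (\<kappa> * A t)) \<le> C * (1 + t) powr ((\<beta> - l) / 2) * exp (- (\<kappa> * A t))"
      using CK by (intro mult_right_mono) auto
    finally show ?thesis .
  qed
  \<comment> \<open>Differentiation brings in a factor b z / (1 + t), of size (1 + t)^l, which turns
    the exponent (\<beta> - l) / 2 into (\<beta> + l) / 2.\<close>
  have bL1: "\<bar>L1 t\<bar> \<le> C * (1 + t) powr ((\<beta> + l) / 2) * exp (- (\<kappa> * A t))" if t: "0 \<le> t" for t
  proof -
    define B where "B = K * (1 + t) powr (- b / 2) * exp (- (\<kappa> * A t))"
    have B: "0 \<le> B" using K by (simp add: B_def)
    have s1: "1 \<le> (1 + t) powr b" using t b by (simp add: ge_one_powr_ge_zero)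
    have bz: "b * z t = \<kappa> * (1 + t) powr b" using b by (simp add: z_def)
    have "\<bar>\<alpha> * k 0 (z t) - b * z t * k 1 (z t)\<bar> \<le> \<alpha> * \<bar>k 0 (z t)\<bar> + b * z t * \<bar>k 1 (z t)\<bar>"
      using abs_triangle_ineq4[of "\<alpha> * k 0 (z t)" "b * z t * k 1 (z t)"] \<alpha>0 \<kappa> unfolding bz by (simp add: abs_mult)
    also have "\<dots> \<le> \<alpha> * B + b * z t * B"
      using kb[OF t, of 0] kb[OF t, of 1] \<alpha>0 \<kappa> unfolding bz B_def by (intro add_mono mult_left_mono) auto
    also have "\<dots> \<le> (1 + \<alpha> + \<kappa>) * ((1 + t) powr b * B)"
    proof -
      have "\<alpha> * 1 \<le> (1 + \<alpha>) * (1 + t) powr b" using \<alpha>0 s1 by (intro mult_mono) auto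
      then have "(\<alpha> + b * z t) * B \<le> ((1 + \<alpha> + \<kappa>) * (1 + t) powr b) * B"
        unfolding bz using B by (intro mult_right_mono) (auto simp: algebra_simps)
      then show ?thesis by (simp add: algebra_simps)
    qed
    finally have "\<bar>L1 t\<bar> \<le> P t / (1 + t) * ((1 + \<alpha> + \<kappa>) * ((1 + t) powr b * B))"
      unfolding L1_def abs_mult using t by (intro mult_mono) (auto simp: P_def)
    also have "\<dots> = C * (P t / (1 + t) * (1 + t) powr b * (1 + t) powr (- b / 2)) * exp (- (\<kappa> * A t))"
      by (simp add: B_def C_def)
    also have "P t / (1 + t) * (1 + t) powr b * (1 + t) powr (- b / 2) = (1 + t) powr (\<alpha> - 1 + b + (- b / 2))"
      using t unfolding powr_add powr_diff P_def by simp
    also have "\<alpha> - 1 + b + (- b / 2) = (\<beta> + l) / 2" by (simp add: \<alpha>_def b_def field_simps)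
    finally show ?thesis .
  qed
  have "0 < \<kappa>" "0 \<le> C" using \<kappa> CK K by auto
  then show thesis
    using that[of \<kappa> C L L1 L2, OF _ _ smooth Ld L1d pos data ode bL[unfolded A_def b_def] bL1[unfolded A_def b_def]]
    by blast
qed

section \<open>Radial eigenfunctions of the Laplacian\<close>

text \<open>Coefficients in s = r^2 of the radial eigenfunction normalised to 1 at the origin: up to
  a constant factor r^(1 - n/2) times the modified Bessel function I of order n/2 - 1 at \<kappa> r,
  and cosh (\<kappa> r) for n = 1. The variable s makes the series entire in every
  dimension.\<close>

primrec radial_coeff :: "real \<Rightarrow> nat \<Rightarrow> nat \<Rightarrow> real" where
  "radial_coeff \<kappa> n 0 = 1"
| "radial_coeff \<kappa> n (Suc k) = \<kappa>\<^sup>2 * radial_coeff \<kappa> n k / (2 * (real k + 1) * (2 * real k + real n))"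

definition radial :: "real \<Rightarrow> nat \<Rightarrow> real \<Rightarrow> real" where
  "radial \<kappa> n s = (\<Sum>k. radial_coeff \<kappa> n k * s ^ k)"

definition radial1 :: "real \<Rightarrow> nat \<Rightarrow> real \<Rightarrow> real" where
  "radial1 \<kappa> n s = (\<Sum>k. diffs (radial_coeff \<kappa> n) k * s ^ k)"

definition radial2 :: "real \<Rightarrow> nat \<Rightarrow> real \<Rightarrow> real" where
  "radial2 \<kappa> n s = (\<Sum>k. diffs (diffs (radial_coeff \<kappa> n)) k * s ^ k)"

lemma radial_coeff_nonneg: "0 \<le> radial_coeff \<kappa> n k"
  by (induction k) auto

context
  fixes \<kappa> :: real and n :: nat
  assumes n: "1 \<le> n"
begin

lemma summable_radial: "summable (\<lambda>k. radial_coeff \<kappa> n k * s ^ k)"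
proof (rule summable_ratio_test[of "1 / 2" "nat \<lceil>\<kappa>\<^sup>2 * \<bar>s\<bar>\<rceil>"])
  fix k assume "nat \<lceil>\<kappa>\<^sup>2 * \<bar>s\<bar>\<rceil> \<le> k"
  then have k: "\<kappa>\<^sup>2 * \<bar>s\<bar> \<le> real k + 1" by linarith
  define d where "d = (real k + 1) * (2 * real k + real n)"
  have d: "real k + 1 \<le> d"
    using n mult_left_mono[of 1 "2 * real k + real n" "real k + 1"] by (simp add: d_def)
  have "\<kappa>\<^sup>2 * \<bar>s\<bar> / (2 * d) \<le> 1 / 2"
    using k d by (subst divide_le_eq) auto
  then have "\<kappa>\<^sup>2 * \<bar>s\<bar> / (2 * d) * norm (radial_coeff \<kappa> n k * s ^ k)
      \<le> 1 / 2 * norm (radial_coeff \<kappa> n k * s ^ k)"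
    by (intro mult_right_mono) auto
  moreover have "radial_coeff \<kappa> n (Suc k) = \<kappa>\<^sup>2 * radial_coeff \<kappa> n k / (2 * d)"
    by (simp only: radial_coeff.simps d_def mult.assoc)
  moreover have "0 \<le> d" using d by linarith
  ultimately show "norm (radial_coeff \<kappa> n (Suc k) * s ^ Suc k) \<le> 1 / 2 * norm (radial_coeff \<kappa> n k * s ^ k)"
    by (simp del: radial_coeff.simps add: abs_mult mult_ac)
qed simp

lemma summable_radial1: "summable (\<lambda>k. diffs (radial_coeff \<kappa> n) k * s ^ k)"
  using termdiff_converges[of s "norm s + 1" "radial_coeff \<kappa> n"] summable_radial by simp

lemma summable_radial2: "summable (\<lambda>k. diffs (diffs (radial_coeff \<kappa> n)) k * s ^ k)"
  using termdiff_converges[of s "norm s + 1" "diffs (radial_coeff \<kappa> n)"] summable_radial1 by simp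

lemma smooth_on_radial: "smooth_on UNIV (radial \<kappa> n)"
  unfolding radial_def[abs_def] by (rule smooth_on_powser) (rule summable_radial)

lemma radial_deriv: "(radial \<kappa> n has_real_derivative radial1 \<kappa> n s) (at s)"
  unfolding radial_def[abs_def] radial1_def
  by (rule termdiffs_strong_converges_everywhere) (rule summable_radial)

lemma radial1_deriv: "(radial1 \<kappa> n has_real_derivative radial2 \<kappa> n s) (at s)"
  unfolding radial1_def[abs_def] radial2_def
  by (rule termdiffs_strong_converges_everywhere) (rule summable_radial1)

text \<open>In the variable s = r^2 the radial Laplacian reads 4 s u'' + 2 n u', and the recursion
  of the coefficients is this equation taken power by power.\<close>

lemma radial_ode: "4 * s * radial2 \<kappa> n s + 2 * real n * radial1 \<kappa> n s = \<kappa>\<^sup>2 * radial \<kappa> n s"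
proof -
  let ?c = "radial_coeff \<kappa> n"
  \<comment> \<open>The factor \<open>real k\<close> kills the term of index 0, which absorbs the
    index shift caused by multiplying the second derivative by s.\<close>
  define f where "f = (\<lambda>k. real k * diffs ?c k * s ^ k)"
  have fS: "f (Suc k) = s * (diffs (diffs ?c) k * s ^ k)" for k
    by (simp add: f_def diffs_def mult_ac)
  have "summable (\<lambda>k. f (Suc k))" unfolding fS by (intro summable_mult summable_radial2)
  then have fs: "summable f" by (simp only: summable_Suc_iff)
  have "s * radial2 \<kappa> n s = (\<Sum>k. f (Suc k))"
    unfolding fS radial2_def by (rule suminf_mult[symmetric]) (rule summable_radial2)
  also have "\<dots> = suminf f" using suminf_split_head[OF fs] by (simp add: f_def)
  finally have "4 * s * radial2 \<kappa> n s + 2 * real n * radial1 \<kappa> n s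
      = (\<Sum>k. 4 * f k) + (\<Sum>k. 2 * real n * (diffs ?c k * s ^ k))"
    using fs summable_radial1 by (simp add: suminf_mult radial1_def)
  also have "\<dots> = (\<Sum>k. 4 * f k + 2 * real n * (diffs ?c k * s ^ k))"
    by (rule suminf_add) (intro summable_mult fs summable_radial1)+
  also have "\<dots> = (\<Sum>k. \<kappa>\<^sup>2 * (?c k * s ^ k))"
  proof (rule suminf_cong)
    fix k
    have "2 * (real k + 1) * (2 * real k + real n) \<noteq> 0" using n by simp
    then have "2 * (real k + 1) * (2 * real k + real n) * ?c (Suc k) = \<kappa>\<^sup>2 * ?c k"
      by simp
    then have "2 * (real k + 1) * (2 * real k + real n) * ?c (Suc k) * s ^ k = \<kappa>\<^sup>2 * ?c k * s ^ k"
      by simp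
    moreover have "4 * f k + 2 * real n * (diffs ?c k * s ^ k)
        = 2 * (real k + 1) * (2 * real k + real n) * ?c (Suc k) * s ^ k"
      unfolding f_def diffs_def by (simp del: radial_coeff.simps add: algebra_simps)
    ultimately show "4 * f k + 2 * real n * (diffs ?c k * s ^ k) = \<kappa>\<^sup>2 * (?c k * s ^ k)" by simp
  qed
  also have "\<dots> = \<kappa>\<^sup>2 * radial \<kappa> n s"
    unfolding radial_def by (rule suminf_mult) (rule summable_radial)
  finally show ?thesis .
qed

lemma radial_pos: "0 \<le> s \<Longrightarrow> 0 < radial \<kappa> n s"
  unfolding radial_def
  by (rule suminf_pos2[where i=0]) (auto simp: summable_radial radial_coeff_nonneg)

lemma radial1_nonneg: "0 \<le> s \<Longrightarrow> 0 \<le> radial1 \<kappa> n s"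
  unfolding radial1_def
  by (rule suminf_nonneg, rule summable_radial1)
    (auto simp: diffs_def simp del: radial_coeff.simps intro!: mult_nonneg_nonneg radial_coeff_nonneg)

text \<open>Liouville's transformation: \<open>v r = r powr m * radial \<kappa> n (r\<^sup>2)\<close> with \<open>m = (n - 1) / 2\<close>
  satisfies \<open>v'' = (\<kappa>\<^sup>2 + (m\<^sup>2 - m) / r\<^sup>2) v\<close>, and \<open>exp (- \<kappa> r + c / r) * (v' + \<kappa> v)\<close> decreases
  when \<open>c = m\<^sup>2 / \<kappa>\<close>.\<close>

lemma radial_bound:
  assumes \<kappa>: "0 < \<kappa>"
  shows "\<exists>C\<ge>0. \<forall>r\<ge>0. radial \<kappa> n (r\<^sup>2) \<le> C * (1 + r) powr (- ((real n - 1) / 2)) * exp (\<kappa> * r)"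
proof -
  define m where "m = (real n - 1) / 2"
  have m: "0 \<le> m" using n by (simp add: m_def)
  define c where "c = m\<^sup>2 / \<kappa>"
  have c: "0 \<le> c" "c * \<kappa> = m\<^sup>2" using \<kappa> by (auto simp: c_def)
  define u where "u = (\<lambda>r. radial \<kappa> n (r\<^sup>2))"
  define u1 where "u1 = (\<lambda>r. 2 * r * radial1 \<kappa> n (r\<^sup>2))"
  have u: "0 < u r" for r unfolding u_def by (rule radial_pos) simp
  have u1: "0 \<le> u1 r" if "0 \<le> r" for r using that by (simp add: u1_def radial1_nonneg)
  have ud: "(u has_real_derivative u1 r) (at r)" for r unfolding u_def u1_def
    by (rule DERIV_cong[OF DERIV_chain2[OF radial_deriv, of "\<lambda>r. r\<^sup>2"]])
      (auto intro!: derivative_eq_intros)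
  have u1d: "(u1 has_real_derivative \<kappa>\<^sup>2 * u r - 2 * m / r * u1 r) (at r)" if "0 < r" for r
  proof -
    have "((\<lambda>r. radial1 \<kappa> n (r\<^sup>2)) has_real_derivative radial2 \<kappa> n (r\<^sup>2) * (2 * r)) (at r)"
      by (rule DERIV_chain2[OF radial1_deriv]) (auto intro!: derivative_eq_intros)
    then have "(u1 has_real_derivative 2 * radial1 \<kappa> n (r\<^sup>2) + 2 * r * (radial2 \<kappa> n (r\<^sup>2) * (2 * r))) (at r)"
      unfolding u1_def by (auto intro!: derivative_eq_intros)
    moreover have "2 * radial1 \<kappa> n (r\<^sup>2) + 2 * r * (radial2 \<kappa> n (r\<^sup>2) * (2 * r)) = \<kappa>\<^sup>2 * u r - 2 * m / r * u1 r"
    proof -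
      have "2 * m / r * u1 r = 2 * (real n - 1) * radial1 \<kappa> n (r\<^sup>2)"
        using that by (simp add: u1_def m_def)
      then show ?thesis
        unfolding u_def radial_ode[symmetric] by (simp add: power2_eq_square algebra_simps)
    qed
    ultimately show ?thesis by simp
  qed
  \<comment> \<open>The product of \<open>E\<close> and \<open>S\<close> is the decreasing quantity:
    v = r^m u satisfies v' + \<kappa> v = r^m S, and the power r^m is placed in
    \<open>E\<close>.\<close>
  define E where "E = (\<lambda>r. r powr m * exp (- \<kappa> * r + c / r))"
  define S where "S = (\<lambda>r. u1 r + (\<kappa> + m / r) * u r)"
  have Q: "E r * S r \<le> E 1 * S 1" if r: "1 \<le> r" for r
  proof (rule DERIV_nonpos_imp_nonincreasing[OF r, of "\<lambda>r. E r * S r"])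
    fix x :: real assume "1 \<le> x" "x \<le> r"
    then have x: "0 < x" by simp
    have pd: "((\<lambda>r. r powr m) has_real_derivative x powr m * (m / x)) (at x)"
      using x by (auto intro!: derivative_eq_intros simp: powr_diff)
    have ed: "((\<lambda>r. exp (- \<kappa> * r + c / r)) has_real_derivative exp (- \<kappa> * x + c / x) * (- \<kappa> - c / x\<^sup>2)) (at x)"
      using x by (auto intro!: derivative_eq_intros simp: power2_eq_square)
    have Ed: "(E has_real_derivative E x * (m / x - \<kappa> - c / x\<^sup>2)) (at x)"
      unfolding E_def by (rule DERIV_cong[OF DERIV_mult[OF pd ed]]) (simp add: algebra_simps)
    have id: "((\<lambda>r. \<kappa> + m / r) has_real_derivative - m / x\<^sup>2) (at x)"
      using x by (auto intro!: derivative_eq_intros simp: power2_eq_square)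
    have Sd: "(S has_real_derivative \<kappa>\<^sup>2 * u x - 2 * m / x * u1 x + (- m / x\<^sup>2 * u x + (\<kappa> + m / x) * u1 x)) (at x)"
      unfolding S_def using DERIV_add[OF u1d[OF x] DERIV_mult[OF id ud]] by (simp add: algebra_simps)
    have "((\<lambda>r. E r * S r) has_real_derivative E x * (- (c / x\<^sup>2) * u1 x + (m\<^sup>2 - m - c * \<kappa> - c * m / x) / x\<^sup>2 * u x)) (at x)"
      by (rule DERIV_cong[OF DERIV_mult[OF Ed Sd]])
        (use x in \<open>simp add: S_def divide_simps, simp add: algebra_simps power2_eq_square\<close>)
    moreover have "E x * (- (c / x\<^sup>2) * u1 x + (m\<^sup>2 - m - c * \<kappa> - c * m / x) / x\<^sup>2 * u x) \<le> 0"
    proof (rule mult_nonneg_nonpos)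
      \<comment> \<open>By the choice of \<open>c\<close>, the product \<open>c * \<kappa>\<close>
        cancels m^2, the only term of the wrong sign.\<close>
      have "(m\<^sup>2 - m - c * \<kappa> - c * m / x) / x\<^sup>2 \<le> 0"
      proof (rule divide_nonpos_pos)
        have "0 \<le> c * m / x" using m c(1) x by simp
        then show "m\<^sup>2 - m - c * \<kappa> - c * m / x \<le> 0" unfolding c(2) using m by linarith
      qed (use x in simp)
      then have "(m\<^sup>2 - m - c * \<kappa> - c * m / x) / x\<^sup>2 * u x \<le> 0"
        using u[of x] by (intro mult_nonpos_nonneg) auto
      moreover have "0 \<le> c / x\<^sup>2 * u1 x" using c(1) u1[of x] x by simp
      ultimately show "- (c / x\<^sup>2) * u1 x + (m\<^sup>2 - m - c * \<kappa> - c * m / x) / x\<^sup>2 * u x \<le> 0" by simp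
    qed (simp add: E_def)
    ultimately show "\<exists>y. ((\<lambda>r. E r * S r) has_real_derivative y) (at x) \<and> y \<le> 0" by blast
  qed
  define K where "K = E 1 * S 1 / \<kappa>"
  have K: "0 \<le> K" unfolding K_def E_def S_def using u[of 1] u1[of 1] m \<kappa> by simp
  \<comment> \<open>\<open>K\<close> covers r >= 1, \<open>u 1\<close> covers r < 1 by monotonicity
    of \<open>u\<close>, and 2^m pays for the factor (1 + r)^(-m) in both cases.\<close>
  define C where "C = 2 powr m * (u 1 + K)"
  have "u r \<le> C * (1 + r) powr (- m) * exp (\<kappa> * r)" if r: "0 \<le> r" for r
  proof (cases "1 \<le> r")
    case True
    have "r powr m * exp (- \<kappa> * r) * (\<kappa> * u r) \<le> E r * S r"
      unfolding E_def using True c m u[of r] u1[of r] \<kappa>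
      by (intro mult_mono) (auto simp: S_def algebra_simps)
    also have "\<dots> \<le> \<kappa> * K" using Q[OF True] \<kappa> by (simp add: K_def)
    finally have "\<kappa> * (u r * (r powr m * exp (- \<kappa> * r))) \<le> \<kappa> * K" by (simp add: mult_ac)
    then have "u r * (r powr m * exp (- \<kappa> * r)) \<le> K" using \<kappa> by simp
    then have "u r \<le> K / (r powr m * exp (- \<kappa> * r))"
      using True by (subst pos_le_divide_eq) auto
    also have "\<dots> = K * r powr (- m) * exp (\<kappa> * r)"
      using True by (simp add: powr_minus exp_minus divide_inverse)
    also have "r powr (- m) \<le> 2 powr m * (1 + r) powr (- m)"
    proof -
      have "(1 + r) powr m \<le> (2 * r) powr m" using True m by (intro powr_mono2) auto
      also have "\<dots> = 2 powr m * r powr m" using True by (simp add: powr_mult)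
      finally show ?thesis using True by (simp add: powr_minus field_simps)
    qed
    also have "K * (2 powr m * (1 + r) powr (- m)) * exp (\<kappa> * r) \<le> C * (1 + r) powr (- m) * exp (\<kappa> * r)"
      unfolding C_def using u[of 1] K by (auto intro!: mult_right_mono simp: algebra_simps)
    finally show ?thesis using K by (simp add: mult_left_mono mult_right_mono)
  next
    case False
    have "u r \<le> u 1"
      by (rule DERIV_nonneg_imp_nondecreasing[of r 1 u]) (use False r ud u1 in fastforce)+
    also have "\<dots> \<le> (u 1 + K) * (2 powr m * (1 + r) powr (- m)) * exp (\<kappa> * r)"
    proof -
      have "(1 + r) powr m \<le> 2 powr m" using r False m by (intro powr_mono2) auto
      then have 1: "1 \<le> 2 powr m * (1 + r) powr (- m)" using r by (simp add: powr_minus field_simps)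
      have 2: "1 \<le> exp (\<kappa> * r)" using \<kappa> r by simp
      have "u 1 * 1 * 1 \<le> (u 1 + K) * (2 powr m * (1 + r) powr (- m)) * exp (\<kappa> * r)"
        using 1 2 u[of 1] K by (intro mult_mono) auto
      then show ?thesis by simp
    qed
    finally show ?thesis by (simp add: C_def mult_ac)
  qed
  moreover have "0 \<le> C" using u[of 1] K by (simp add: C_def)
  ultimately show ?thesis unfolding u_def m_def by blast
qed

end

text \<open>For \<kappa> = 0 the spatial factor is constant, so one identity for separated functions
  also covers cutoffs in time alone.\<close>

lemma radial_0 [simp]: "1 \<le> n \<Longrightarrow> radial 0 n s = 1"
proof -
  assume "1 \<le> n"
  have "radial_coeff 0 n (Suc k) = 0" for k by simp
  then show ?thesis
    using suminf_split_head[OF summable_radial[OF \<open>1 \<le> n\<close>, of 0 s]]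
    by (simp add: radial_def del: radial_coeff.simps(2)) 
qed

text \<open>Along a coordinate line the squared norm is a quadratic polynomial in h, so the
  one-variable chain rule suffices; summing the squared coordinates restores the squared
  norm.\<close>

lemma laplacian_radial:
  fixes x :: "'a::euclidean_space"
  assumes B: "\<And>s. (B has_real_derivative B1 s) (at s)" "\<And>s. (B1 has_real_derivative B2 s) (at s)"
  shows "laplacian (\<lambda>x. B ((norm x)\<^sup>2)) x
    = 4 * (norm x)\<^sup>2 * B2 ((norm x)\<^sup>2) + 2 * real DIM('a) * B1 ((norm x)\<^sup>2)"
proof -
  have "(deriv ^^ 2) (\<lambda>h. B ((norm (x + h *\<^sub>R b))\<^sup>2)) 0
      = 4 * B2 ((norm x)\<^sup>2) * ((x \<bullet> b) * (x \<bullet> b)) + 2 * B1 ((norm x)\<^sup>2)" if b: "b \<in> Basis" for b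
  proof -
    define q where "q = (\<lambda>h. (norm x)\<^sup>2 + 2 * h * (x \<bullet> b) + h\<^sup>2)"
    have q: "(norm (x + h *\<^sub>R b))\<^sup>2 = q h" for h
      unfolding q_def power2_norm_eq_inner using b
      by (simp add: inner_add inner_commute[of b x] power2_eq_square algebra_simps)
    have qd: "(q has_real_derivative 2 * (x \<bullet> b) + 2 * h) (at h)" for h
      unfolding q_def by (auto intro!: derivative_eq_intros)
    have "deriv (\<lambda>h. B (q h)) = (\<lambda>h. B1 (q h) * (2 * (x \<bullet> b) + 2 * h))"
      by (intro ext DERIV_imp_deriv DERIV_chain2[OF B(1) qd])
    moreover have "((\<lambda>h. B1 (q h) * (2 * (x \<bullet> b) + 2 * h)) has_real_derivative
        B2 (q 0) * (2 * (x \<bullet> b) + 2 * 0) * (2 * (x \<bullet> b) + 2 * 0) + B1 (q 0) * 2) (at 0)"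
      by (rule derivative_eq_intros refl DERIV_chain2[OF B(2) qd])+ simp
    ultimately have "deriv (deriv (\<lambda>h. B (q h))) 0
      = B2 (q 0) * (2 * (x \<bullet> b) + 2 * 0) * (2 * (x \<bullet> b) + 2 * 0) + B1 (q 0) * 2"
      by (simp only: DERIV_imp_deriv)
    then show ?thesis unfolding q by (simp add: q_def numeral_2_eq_2 algebra_simps)
  qed
  then have "laplacian (\<lambda>x. B ((norm x)\<^sup>2)) x
      = 4 * B2 ((norm x)\<^sup>2) * (\<Sum>b\<in>Basis. (x \<bullet> b) * (x \<bullet> b)) + 2 * B1 ((norm x)\<^sup>2) * real DIM('a)"
    unfolding laplacian_def by (simp add: sum.distrib sum_distrib_left[symmetric])
  then show ?thesis
    unfolding euclidean_inner[symmetric] power2_norm_eq_inner by (simp add: mult_ac)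
qed

section \<open>Integral estimates\<close>

lemma power_Suc_diff_le:
  fixes a b :: real
  assumes "0 \<le> b" "b \<le> a"
  shows "a ^ Suc m - b ^ Suc m \<le> real (Suc m) * a ^ m * (a - b)"
proof (induction m)
  case (Suc m)
  have "a ^ Suc (Suc m) - b ^ Suc (Suc m) = a * (a ^ Suc m - b ^ Suc m) + b ^ Suc m * (a - b)"
    by (simp add: algebra_simps)
  also have "\<dots> \<le> a * (real (Suc m) * a ^ m * (a - b)) + a ^ Suc m * (a - b)"
    using assms Suc by (intro add_mono mult_left_mono mult_right_mono power_mono) auto
  finally show ?case by (simp add: algebra_simps)
qed simp

text \<open>The outer radius \<open>a\<close> may be any number up to r, negative ones included, so
  that all shells at integer depth below the sphere of radius r obey one bound. For 0 <= a < 1 the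
  inner ball is empty and the full ball is measured.\<close>

lemma emeasure_shell_le:
  assumes "a \<le> r" "0 \<le> r"
  shows "emeasure lborel (cball (0::'a::euclidean_space) a - cball 0 (a - 1))
    \<le> ennreal (unit_ball_vol DIM('a) * real DIM('a) * (1 + r) ^ (DIM('a) - 1))"
proof -
  obtain m where m: "DIM('a) = Suc m" using DIM_positive[where 'a='a] gr0_implies_Suc by blast
  let ?V = "unit_ball_vol (real (Suc m))"
  consider "a < 0" | "0 \<le> a" "a < 1" | "1 \<le> a" by linarith
  then show ?thesis
  proof cases
    case 2
    have "emeasure lborel (cball (0::'a) a - cball 0 (a - 1)) \<le> emeasure lborel (cball (0::'a) a)"
      by (intro emeasure_mono) auto
    also have "\<dots> = ennreal (?V * a ^ Suc m)"
      using emeasure_cball[of a "0::'a"] 2 m by simp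
    also have "\<dots> \<le> ennreal (?V * (real (Suc m) * (1 + r) ^ m))"
    proof (intro ennreal_leI mult_left_mono)
      have "a ^ Suc m \<le> 1" using 2 by (intro power_le_one) auto
      also have "1 \<le> real (Suc m) * (1 + r) ^ m"
        using assms mult_mono[of 1 "real (Suc m)" 1 "(1 + r) ^ m"] by simp
      finally show "a ^ Suc m \<le> real (Suc m) * (1 + r) ^ m" by simp
    qed simp
    finally show ?thesis by (simp add: m mult_ac)
  next
    case 3
    have "emeasure lborel (cball (0::'a) a - cball 0 (a - 1))
        = emeasure lborel (cball (0::'a) a) - emeasure lborel (cball (0::'a) (a - 1))"
      using 3 emeasure_cball[of "a - 1" "0::'a"] by (intro emeasure_Diff) auto
    also have "\<dots> = ennreal (?V * a ^ Suc m) - ennreal (?V * (a - 1) ^ Suc m)"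
      using emeasure_cball[of a "0::'a"] emeasure_cball[of "a - 1" "0::'a"] 3 m by simp
    also have "\<dots> = ennreal (?V * (a ^ Suc m - (a - 1) ^ Suc m))"
      using 3 by (subst ennreal_minus) (auto simp: right_diff_distrib)
    also have "\<dots> \<le> ennreal (?V * (real (Suc m) * (1 + r) ^ m))"
    proof (intro ennreal_leI mult_left_mono)
      have "a ^ Suc m - (a - 1) ^ Suc m \<le> real (Suc m) * a ^ m"
        using power_Suc_diff_le[of "a - 1" a m] 3 by simp
      also have "\<dots> \<le> real (Suc m) * (1 + r) ^ m"
        using assms 3 by (intro mult_left_mono power_mono) auto
      finally show "a ^ Suc m - (a - 1) ^ Suc m \<le> real (Suc m) * (1 + r) ^ m" .
    qed simp
    finally show ?thesis by (simp add: m mult_ac)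
  qed simp
qed

text \<open>The ball is cut into shells of thickness 1. At depth j the weight is at most exp (- c j)
  and the volume of order (1 + r)^(n - 1), so a geometric series leaves the size of the boundary
  sphere.\<close>

lemma nn_integral_exp_boundary_layer:
  assumes c: "0 < c"
  shows "\<exists>C\<ge>0. \<forall>r\<ge>0. (\<integral>\<^sup>+x\<in>cball (0::'a::euclidean_space) r. ennreal (exp (c * (norm x - r))) \<partial>lborel)
    \<le> ennreal (C * (1 + r) powr (real DIM('a) - 1))"
proof -
  define N where "N = DIM('a) - 1"
  define W where "W = unit_ball_vol DIM('a) * real DIM('a)"
  have W: "0 \<le> W" by (simp add: W_def)
  define C where "C = (1 / (1 - exp (- c))) * W"
  have C: "0 \<le> C" using c W by (simp add: C_def)
  have "(\<integral>\<^sup>+x\<in>cball (0::'a) r. ennreal (exp (c * (norm x - r))) \<partial>lborel)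
    \<le> ennreal (C * (1 + r) powr (real DIM('a) - 1))" if r: "0 \<le> r" for r
  proof -
    define S where "S = (\<lambda>j::nat. cball (0::'a) (r - real j) - cball 0 (r - real j - 1))"
    have [measurable]: "S j \<in> sets borel" for j by (simp add: S_def)
    have "(\<integral>\<^sup>+x\<in>cball (0::'a) r. ennreal (exp (c * (norm x - r))) \<partial>lborel)
        \<le> (\<integral>\<^sup>+x. (\<Sum>j. ennreal (exp (- c) ^ j) * indicator (S j) x) \<partial>lborel)"
    proof (intro nn_integral_mono)
      fix x :: 'a
      show "ennreal (exp (c * (norm x - r))) * indicator (cball 0 r) x
          \<le> (\<Sum>j. ennreal (exp (- c) ^ j) * indicator (S j) x)"
      proof (cases "norm x \<le> r")
        case True
        define j where "j = nat \<lfloor>r - norm x\<rfloor>"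
        have j: "real j \<le> r - norm x" "r - norm x < real j + 1" using True by (auto simp: j_def)
        then have xS: "x \<in> S j" by (auto simp: S_def)
        have "c * (norm x - r) \<le> c * (- real j)" using c j by (intro mult_left_mono) auto
        then have "exp (c * (norm x - r)) \<le> exp (- c) ^ j"
          by (simp add: exp_of_nat_mult[symmetric] mult.commute)
        then have "ennreal (exp (c * (norm x - r))) \<le> (\<Sum>j\<in>{j}. ennreal (exp (- c) ^ j) * indicator (S j) x)"
          using xS by (simp add: ennreal_leI)
        also have "\<dots> \<le> (\<Sum>j. ennreal (exp (- c) ^ j) * indicator (S j) x)"
          by (intro sum_le_suminf) auto
        finally show ?thesis using True by simp
      qed simp
    qed
    also have "\<dots> = (\<Sum>j. ennreal (exp (- c) ^ j) * emeasure lborel (S j))"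
      by (subst nn_integral_suminf) (auto simp: nn_integral_cmult)
    also have "\<dots> \<le> (\<Sum>j. ennreal (exp (- c) ^ j) * ennreal (W * (1 + r) ^ N))"
      unfolding S_def W_def N_def using r
      by (intro suminf_le mult_left_mono emeasure_shell_le) auto
    also have "\<dots> = (\<Sum>j. ennreal (exp (- c) ^ j)) * ennreal (W * (1 + r) ^ N)"
      by (rule ennreal_suminf_multc)
    also have "(\<Sum>j. ennreal (exp (- c) ^ j)) = ennreal (1 / (1 - exp (- c)))"
      using c by (subst suminf_ennreal2) (auto simp: suminf_geometric summable_geometric)
    also have "ennreal (1 / (1 - exp (- c))) * ennreal (W * (1 + r) ^ N) = ennreal (C * (1 + r) ^ N)"
      using c W r by (subst ennreal_mult[symmetric]) (auto simp: C_def)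
    also have "(1 + r) ^ N = (1 + r) powr (real DIM('a) - 1)"
      using r DIM_positive[where 'a='a] by (simp add: N_def powr_realpow[symmetric] of_nat_diff)
    finally show ?thesis .
  qed
  then show ?thesis using C by blast
qed

lemma one_plus_powr_le_exp:
  fixes m d :: real
  assumes "0 \<le> m" "0 < d"
  shows "\<exists>A\<ge>0. \<forall>y\<ge>0. (1 + y) powr m \<le> A * exp (d * y)"
proof -
  \<comment> \<open>The denominator m + 1 covers m = 0 and gives \<open>e * m \<le> d\<close>; the
    claim is then 1 + e y <= exp (e y) raised to the power m.\<close>
  define e where "e = d / (m + 1)"
  have e: "0 < e" "e * m \<le> d" using assms by (auto simp: e_def field_simps)
  define A where "A = (max 1 (1 / e)) powr m"
  have "(1 + y) powr m \<le> A * exp (d * y)" if y: "0 \<le> y" for y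
  proof -
    have "1 + y \<le> max 1 (1 / e) * (1 + e * y)"
    proof (cases "e \<le> 1")
      case True
      then have "max 1 (1 / e) = 1 / e" using e by (simp add: max_def field_simps)
      then show ?thesis using e y True by (simp add: field_simps)
    next
      case False
      then have "max 1 (1 / e) = 1" using e by (simp add: max_def field_simps)
      then show ?thesis using mult_right_mono[of 1 e y] False y by simp
    qed
    also have "\<dots> \<le> max 1 (1 / e) * exp (e * y)" by (intro mult_left_mono exp_ge_add_one_self) auto
    finally have "(1 + y) powr m \<le> (max 1 (1 / e) * exp (e * y)) powr m"
      using y assms by (intro powr_mono2) auto
    also have "\<dots> = A * exp (e * m * y)"
      unfolding powr_mult A_def by (simp add: powr_def[of "exp (e * y)"] mult_ac)
    also have "\<dots> \<le> A * exp (d * y)"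
      using e y by (intro mult_left_mono) (auto simp: A_def intro!: mult_right_mono)
    finally show ?thesis .
  qed
  then show ?thesis by (intro exI[of _ A]) (auto simp: A_def)
qed

text \<open>Passing from radius r to s loses at most the factor (1 + (r - s))^m, which half of exp
  (\<kappa> (s - r)) absorbs. After scaling by exp (- \<kappa> r) the eigenfunction thus
  concentrates at the sphere of radius r.\<close>

lemma radial_boundary_layer:
  assumes n: "1 \<le> n" and \<kappa>: "0 < \<kappa>"
  shows "\<exists>C\<ge>0. \<forall>s r. 0 \<le> s \<and> s \<le> r \<longrightarrow>
    radial \<kappa> n (s\<^sup>2) * exp (- (\<kappa> * r)) \<le> C * (1 + r) powr (- ((real n - 1) / 2)) * exp (\<kappa> / 2 * (s - r))"
proof -
  define m where "m = (real n - 1) / 2"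
  have m: "0 \<le> m" using n by (simp add: m_def)
  obtain C where C: "0 \<le> C" "\<And>r. 0 \<le> r \<Longrightarrow> radial \<kappa> n (r\<^sup>2) \<le> C * (1 + r) powr (- m) * exp (\<kappa> * r)"
    using radial_bound[OF n \<kappa>] unfolding m_def by blast
  obtain A where A: "0 \<le> A" "\<And>y. 0 \<le> y \<Longrightarrow> (1 + y) powr m \<le> A * exp (\<kappa> / 2 * y)"
    using one_plus_powr_le_exp[OF m, of "\<kappa> / 2"] \<kappa> by auto
  have "radial \<kappa> n (s\<^sup>2) * exp (- (\<kappa> * r)) \<le> C * A * (1 + r) powr (- m) * exp (\<kappa> / 2 * (s - r))"
    if s: "0 \<le> s" "s \<le> r" for s r
  proof -
    have "1 + r \<le> (1 + s) * (1 + (r - s))" using s mult_nonneg_nonneg[of s "r - s"] by (simp add: algebra_simps)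
    then have "(1 + r) powr m \<le> ((1 + s) * (1 + (r - s))) powr m"
      using s m by (intro powr_mono2) auto
    also have "\<dots> = (1 + s) powr m * (1 + (r - s)) powr m" by (rule powr_mult)
    also have "\<dots> \<le> (1 + s) powr m * (A * exp (\<kappa> / 2 * (r - s)))"
      using s by (intro mult_left_mono A(2)) auto
    finally have 1: "(1 + s) powr (- m) \<le> A * exp (\<kappa> / 2 * (r - s)) * (1 + r) powr (- m)"
      using s by (simp add: powr_minus field_simps)
    have "radial \<kappa> n (s\<^sup>2) * exp (- (\<kappa> * r)) \<le> C * (1 + s) powr (- m) * exp (\<kappa> * s) * exp (- (\<kappa> * r))"
      using s by (intro mult_right_mono C(2)) auto
    also have "\<dots> = C * (1 + s) powr (- m) * exp (\<kappa> * (s - r))"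
      by (simp add: mult.assoc exp_add[symmetric] algebra_simps)
    also have "\<dots> \<le> C * (A * exp (\<kappa> / 2 * (r - s)) * (1 + r) powr (- m)) * exp (\<kappa> * (s - r))"
      using 1 C(1) by (intro mult_right_mono mult_left_mono) auto
    also have "\<dots> = C * A * (1 + r) powr (- m) * (exp (\<kappa> / 2 * (r - s)) * exp (\<kappa> * (s - r)))" by simp
    also have "exp (\<kappa> / 2 * (r - s)) * exp (\<kappa> * (s - r)) = exp (\<kappa> / 2 * (s - r))"
      by (simp add: exp_add[symmetric] field_simps)
    finally show ?thesis .
  qed
  then show ?thesis using C(1) A(1) unfolding m_def by (intro exI[of _ "C * A"]) auto
qed

text \<open>In the exponent, n - 1 is the growth of the boundary sphere and - q (n - 1) / 2 comes
  from the q-th power of the amplitude there.\<close>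

lemma nn_integral_radial_powr:
  fixes \<kappa> q :: real
  assumes \<kappa>: "0 < \<kappa>" and q: "0 < q"
  shows "\<exists>C\<ge>0. \<forall>r\<ge>0. (\<integral>\<^sup>+x\<in>cball (0::'a::euclidean_space) r.
      ennreal ((radial \<kappa> DIM('a) ((norm x)\<^sup>2) * exp (- (\<kappa> * r))) powr q) \<partial>lborel)
    \<le> ennreal (C * (1 + r) powr ((real DIM('a) - 1) * (1 - q / 2)))"
proof -
  let ?n = "DIM('a)"
  have n: "1 \<le> ?n" using DIM_positive[where 'a='a] by simp
  define m where "m = (real ?n - 1) / 2"
  obtain C where C: "0 \<le> C" "\<And>s r. 0 \<le> s \<Longrightarrow> s \<le> r \<Longrightarrow>
    radial \<kappa> ?n (s\<^sup>2) * exp (- (\<kappa> * r)) \<le> C * (1 + r) powr (- m) * exp (\<kappa> / 2 * (s - r))"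
    using radial_boundary_layer[OF n \<kappa>] unfolding m_def by blast
  obtain D where D: "0 \<le> D" "\<And>r. 0 \<le> r \<Longrightarrow>
      (\<integral>\<^sup>+x\<in>cball (0::'a) r. ennreal (exp (\<kappa> * q / 2 * (norm x - r))) \<partial>lborel)
      \<le> ennreal (D * (1 + r) powr (real ?n - 1))"
    using nn_integral_exp_boundary_layer[of "\<kappa> * q / 2", where 'a='a] \<kappa> q by auto
  have "(\<integral>\<^sup>+x\<in>cball (0::'a) r. ennreal ((radial \<kappa> ?n ((norm x)\<^sup>2) * exp (- (\<kappa> * r))) powr q) \<partial>lborel)
    \<le> ennreal (C powr q * D * (1 + r) powr ((real ?n - 1) * (1 - q / 2)))" if r: "0 \<le> r" for r
  proof -
    define K where "K = C powr q * (1 + r) powr (- m * q)"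
    have K: "0 \<le> K" by (simp add: K_def)
    have [measurable]: "cball (0::'a) r \<in> sets borel" by simp
    have "(\<integral>\<^sup>+x\<in>cball (0::'a) r. ennreal ((radial \<kappa> ?n ((norm x)\<^sup>2) * exp (- (\<kappa> * r))) powr q) \<partial>lborel)
      \<le> (\<integral>\<^sup>+x\<in>cball (0::'a) r. ennreal K * ennreal (exp (\<kappa> * q / 2 * (norm x - r))) \<partial>lborel)"
    proof (intro nn_integral_mono)
      fix x :: 'a
      show "ennreal ((radial \<kappa> ?n ((norm x)\<^sup>2) * exp (- (\<kappa> * r))) powr q) * indicator (cball 0 r) x
        \<le> ennreal K * ennreal (exp (\<kappa> * q / 2 * (norm x - r))) * indicator (cball 0 r) x"
      proof (cases "norm x \<le> r")
        case True
        have "(radial \<kappa> ?n ((norm x)\<^sup>2) * exp (- (\<kappa> * r))) powr q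
          \<le> (C * (1 + r) powr (- m) * exp (\<kappa> / 2 * (norm x - r))) powr q"
          using C(2)[OF _ True] radial_pos[OF n, of "(norm x)\<^sup>2" \<kappa>] q by (intro powr_mono2) auto
        also have "\<dots> = K * exp (\<kappa> * q / 2 * (norm x - r))"
          by (simp add: powr_mult powr_powr K_def powr_def[of "exp _"] mult_ac)
        finally show ?thesis using True K by (simp add: ennreal_mult[symmetric] ennreal_leI)
      qed simp
    qed
    also have "\<dots> = ennreal K * (\<integral>\<^sup>+x\<in>cball (0::'a) r. ennreal (exp (\<kappa> * q / 2 * (norm x - r))) \<partial>lborel)"
      unfolding mult.assoc by (rule nn_integral_cmult) measurable
    also have "\<dots> \<le> ennreal K * ennreal (D * (1 + r) powr (real ?n - 1))"
      using r by (intro mult_left_mono D(2)) auto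
    also have "\<dots> = ennreal (C powr q * D * ((1 + r) powr (- m * q) * (1 + r) powr (real ?n - 1)))"
      using K D(1) by (simp add: ennreal_mult[symmetric] K_def mult_ac)
    also have "(1 + r) powr (- m * q) * (1 + r) powr (real ?n - 1) = (1 + r) powr ((real ?n - 1) * (1 - q / 2))"
      by (simp add: powr_add[symmetric] m_def field_simps)
    finally show ?thesis .
  qed
  then show ?thesis using D(1) by (intro exI[of _ "C powr q * D"]) auto
qed

section \<open>Supports and null sets in space-time\<close>

lemma ess_support_AE: "AE x in lebesgue. x \<notin> ess_support u \<longrightarrow> u x = 0"
proof -
  let ?F = "{U. open U \<and> (AE x in lebesgue. x \<in> U \<longrightarrow> u x = 0)}"
  \<comment> \<open>The open sets on which \<open>u\<close> vanishes almost everywhere may form an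
    uncountable family; Lindelof's theorem reduces their union to a countable one.\<close>
  obtain F where F: "F \<subseteq> ?F" "countable F" "\<Union>F = \<Union>?F"
    using Lindelof[of ?F] by blast
  have "AE x in lebesgue. \<forall>U\<in>F. x \<in> U \<longrightarrow> u x = 0"
    using F by (subst AE_ball_countable) auto
  moreover have "- ess_support u = \<Union>F" using F by (simp add: ess_support_def)
  then have "x \<notin> ess_support u \<longleftrightarrow> (\<exists>U\<in>F. x \<in> U)" for x by blast
  ultimately show ?thesis by (auto elim: AE_mp)
qed

text \<open>A Lebesgue set need not belong to the product sigma-algebra, but it is Borel up to a
  null set. The Borel part has null sections, and Tonelli's theorem makes it null.\<close>

lemma AE_lebesgue_pairI:
  fixes E :: "(real \<times> 'a::euclidean_space) set"
  assumes E: "E \<in> sets lebesgue" and sec: "\<And>t. AE x in lebesgue. (t, x) \<notin> E"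
  shows "AE z in lebesgue. z \<notin> E"
proof -
  obtain S N N' where S: "E = S \<union> N" "N \<subseteq> N'" "N' \<in> null_sets lborel" "S \<in> sets lborel"
    using sets_completionE[OF E] by metis
  have S': "S \<in> sets (lborel \<Otimes>\<^sub>M lborel)" using S(4) by (simp only: lborel_prod)
  have "emeasure lborel (Pair t -` S) = 0" for t
  proof -
    have m: "Pair t -` S \<in> sets lborel" using sets_Pair1[OF S'] by simp
    have "AE x in lebesgue. x \<notin> Pair t -` S" using sec[of t] S(1) by (auto elim: AE_mp)
    moreover have "{x \<in> space lborel. x \<notin> Pair t -` S} \<in> sets lborel" using m by measurable
    ultimately have "AE x in lborel. x \<notin> Pair t -` S"
      using AE_completion_iff[of "\<lambda>x. x \<notin> Pair t -` S" lborel] by auto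
    then show ?thesis using m by (subst (asm) AE_iff_measurable[OF m]) auto
  qed
  then have "emeasure (lborel \<Otimes>\<^sub>M lborel) S = 0"
    using S' by (simp add: lborel.emeasure_pair_measure_alt)
  then have "S \<in> null_sets lborel" using S(4) by (simp add: lborel_prod null_sets_def)
  then have "S \<union> N' \<in> null_sets lebesgue" using S(3) by (auto intro: null_sets_completionI)
  then have "AE z in lebesgue. z \<notin> S \<union> N'" by (rule AE_not_in)
  then show ?thesis using S by (auto elim: AE_mp)
qed

section \<open>Testing with separated functions\<close>

lemma propagation_eq:
  assumes "-1 < l" "0 \<le> t"
  shows "propagation l t = ((1 + t) powr (1 + l) - 1) / (1 + l)"
proof -
  have "((\<lambda>s. (1 + s) powr l) has_integral (1 + t) powr (1 + l) / (1 + l) - (1 + 0) powr (1 + l) / (1 + l)) {0..t}"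
  proof (rule fundamental_theorem_of_calculus)
    fix s assume s: "s \<in> {0..t}"
    show "((\<lambda>t. (1 + t) powr (1 + l) / (1 + l)) has_vector_derivative (1 + s) powr l) (at s within {0..t})"
      unfolding has_real_derivative_iff_has_vector_derivative[symmetric]
      by (rule has_field_derivative_at_within) (use assms s in \<open>auto intro!: derivative_eq_intros\<close>)
  qed (use assms in simp)
  then show ?thesis unfolding propagation_def by (simp add: integral_unique diff_divide_distrib)
qed

lemma propagation_mono:
  assumes "-1 < l" "0 \<le> s" "s \<le> t"
  shows "propagation l s \<le> propagation l t"
  using assms by (auto simp: propagation_eq intro!: divide_right_mono powr_mono2)

lemma propagation_nonneg:
  assumes "-1 < l" "0 \<le> t"
  shows "0 \<le> propagation l t"
  using propagation_mono[OF assms(1) order.refl assms(2)] by (simp add: propagation_def)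

lemma smooth_on_derivative:
  assumes "smooth_on UNIV a" "\<And>t. (a has_real_derivative a1 t) (at t)"
  shows "smooth_on UNIV a1"
proof -
  obtain a' where a': "\<And>t. (a has_real_derivative a' t) (at t)" "smooth_on UNIV a'"
    using smooth_onE[OF assms(1)] by auto
  have "a' = a1" using DERIV_unique[OF a'(1) assms(2)] by auto
  then show ?thesis using a' by simp
qed

lemma derivative_zero_on_open:
  fixes a :: "real \<Rightarrow> real"
  assumes "open U" "\<And>t. t \<in> U \<Longrightarrow> a t = 0" "t \<in> U" "(a has_real_derivative d) (at t)"
  shows "d = 0"
proof -
  have "(a has_real_derivative 0) (at t)"
    by (rule has_field_derivative_transform_within_open[OF DERIV_const[of 0] assms(1,3)])
      (use assms(2) in auto)
  then show ?thesis using DERIV_unique assms(4) by blast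
qed

lemma smooth_borel_measurable: "smooth_on UNIV a \<Longrightarrow> a \<in> borel_measurable borel"
  by (intro borel_measurable_continuous_onI smooth_on_continuous)

lemma borel_measurable_lebesgueI: "h \<in> borel_measurable borel \<Longrightarrow> h \<in> borel_measurable lebesgue"
  by (rule measurable_completion) simp

lemma fst_borel_measurable [measurable]:
  "(fst :: 'a::euclidean_space \<times> 'b::euclidean_space \<Rightarrow> 'a) \<in> borel_measurable borel"
  by (intro borel_measurable_continuous_onI continuous_intros)

lemma snd_borel_measurable [measurable]:
  "(snd :: 'a::euclidean_space \<times> 'b::euclidean_space \<Rightarrow> 'b) \<in> borel_measurable borel"
  by (intro borel_measurable_continuous_onI continuous_intros)

text \<open>Uncurried and extended by zero outside the time interval, so that integrals over the
  domain of the solution become integrals over all of space-time.\<close>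

definition trunc :: "ereal \<Rightarrow> (real \<Rightarrow> 'a \<Rightarrow> real) \<Rightarrow> real \<times> 'a \<Rightarrow> real" where
  "trunc T w z = (if fst z \<in> time_interval T then w (fst z) (snd z) else 0)"

lemma time_interval_borel: "time_interval T \<times> (UNIV :: 'a::euclidean_space set) \<in> sets borel"
proof -
  have "time_interval T = {0..} \<inter> {t. ereal t < T}" by (auto simp: time_interval_def)
  moreover have "{t. ereal t < T} \<in> sets borel" by measurable
  ultimately have "time_interval T \<in> sets borel" by auto
  then show ?thesis by (intro borel_Times) auto
qed

text \<open>Fixes a single solution. Constants that must be uniform in \<open>\<epsilon>\<close>,
  \<open>T\<close> and \<open>w\<close> are therefore produced outside this locale.\<close>

locale weak_sol =
  fixes l \<beta> \<mu> p :: real and f g :: "real^'n \<Rightarrow> real" and \<epsilon> R\<^sub>0 :: real and T :: ereal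
    and w :: "real \<Rightarrow> real^'n \<Rightarrow> real"
  assumes l: "-1 < l" and p: "1 < p" and R: "0 < R\<^sub>0"
    and sol: "weak_solution l \<beta> \<mu> p f g \<epsilon> R\<^sub>0 T w"
    and supp: "tsupport f \<union> tsupport g \<subseteq> cball 0 R\<^sub>0"
begin

abbreviation "W \<equiv> trunc T w"

lemma W_measurable: "W \<in> borel_measurable lebesgue"
proof -
  have "(\<lambda>(t, x). w t x) \<in> borel_measurable (lebesgue_on (time_interval T \<times> UNIV))"
    using sol unfolding weak_solution_def Lp_loc_on_def by blast
  then have "(\<lambda>z. indicator (time_interval T \<times> UNIV) z *\<^sub>R (case z of (t, x) \<Rightarrow> w t x)) \<in> borel_measurable lebesgue"
    using time_interval_borel[of T, where 'a="real^'n"]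
    by (subst (asm) borel_measurable_restrict_space_iff) auto
  moreover have "(\<lambda>z. indicator (time_interval T \<times> UNIV) z *\<^sub>R (case z of (t, x) \<Rightarrow> w t x)) = W"
    by (auto simp: trunc_def indicator_def fun_eq_iff)
  ultimately show ?thesis by simp
qed

text \<open>Finite propagation is given separately at each time; the criterion by null sections
  turns it into a statement almost everywhere in space-time.\<close>

lemma W_supp:
  "AE z in lebesgue. W z \<noteq> 0 \<longrightarrow> 0 \<le> fst z \<and> ereal (fst z) < T \<and> norm (snd z) \<le> R\<^sub>0 + propagation l (fst z)"
proof -
  have es: "ess_support (w t) \<subseteq> cball 0 (R\<^sub>0 + propagation l t)" if "t \<in> time_interval T" for t
    using sol that unfolding weak_solution_def by blast
  define B where "B = {z::real \<times> (real^'n). 0 \<le> fst z \<and> R\<^sub>0 + ((1 + fst z) powr (1 + l) - 1) / (1 + l) < norm (snd z)}"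
  have [measurable]: "B \<in> sets borel"
  proof -
    have "{z \<in> space borel. 0 \<le> fst z \<and> R\<^sub>0 + ((1 + fst z) powr (1 + l) - 1) / (1 + l) < norm (snd z)} \<in>
        sets (borel :: (real \<times> (real^'n)) measure)" by measurable
    then show ?thesis by (simp add: B_def)
  qed
  define E where "E = {z. W z \<noteq> 0} \<inter> B"
  have "AE z in lebesgue. z \<notin> E"
  proof (rule AE_lebesgue_pairI)
    have "{z \<in> space lebesgue. W z \<noteq> 0} \<in> sets lebesgue" using W_measurable by measurable
    then show "E \<in> sets lebesgue" unfolding E_def by (intro sets.Int) auto
    fix t
    show "AE x in lebesgue. (t, x) \<notin> E"
    proof (cases "t \<in> time_interval T")
      case True
      then have "0 \<le> t" by (simp add: time_interval_def)
      show ?thesis using ess_support_AE[of "w t"]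
      proof (rule AE_mp, intro AE_I2 impI)
        fix x assume *: "x \<notin> ess_support (w t) \<longrightarrow> w t x = 0"
        show "(t, x) \<notin> E"
          using * es[OF True] True \<open>0 \<le> t\<close>
          by (auto simp: E_def B_def trunc_def propagation_eq[OF l])
      qed
    next
      case False
      then show ?thesis by (auto simp: E_def trunc_def)
    qed
  qed
  then show ?thesis
    by (rule AE_mp)
      (auto intro!: AE_I2 simp: E_def B_def trunc_def time_interval_def propagation_eq[OF l] split: if_splits)
qed

text \<open>A compact cylinder, on which local integrability applies directly; since the propagation
  radius increases, it contains the cone up to time \<tau>.\<close>

definition region :: "real \<Rightarrow> (real \<times> (real^'n)) set" where
  "region \<tau> = {0..\<tau>} \<times> cball 0 (R\<^sub>0 + propagation l \<tau>)"

lemma region_sets [measurable]: "region \<tau> \<in> sets borel"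
  unfolding region_def by (intro borel_Times) auto

lemma region_integrable: "integrable lebesgue (indicator (region \<tau>) :: _ \<Rightarrow> real)"
proof -
  have "region \<tau> \<in> lmeasurable"
    unfolding region_def by (intro lmeasurable_compact compact_Times) auto
  then show ?thesis by (simp add: lmeasurable_iff_integrable)
qed

lemma W_supp_region:
  "AE z in lebesgue. W z \<noteq> 0 \<longrightarrow> fst z \<le> \<tau> \<longrightarrow> z \<in> region \<tau>"
  using W_supp
proof (rule AE_mp, intro AE_I2 impI)
  fix z
  assume *: "W z \<noteq> 0 \<longrightarrow> 0 \<le> fst z \<and> ereal (fst z) < T \<and> norm (snd z) \<le> R\<^sub>0 + propagation l (fst z)"
    and **: "W z \<noteq> 0" "fst z \<le> \<tau>"
  show "z \<in> region \<tau>"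
    using * ** propagation_mono[OF l, of "fst z" \<tau>] by (cases z) (auto simp: region_def)
qed

lemma W_powr_integrable:
  assumes "0 \<le> \<tau>" "ereal \<tau> < T"
  shows "integrable lebesgue (\<lambda>z. indicator (region \<tau>) z * \<bar>W z\<bar> powr p)"
proof -
  have "compact (region \<tau>)" unfolding region_def by (intro compact_Times) auto
  moreover have sub: "region \<tau> \<subseteq> time_interval T \<times> UNIV"
    using assms(2) by (auto simp: region_def time_interval_def intro: le_less_trans[of _ "ereal \<tau>"])
  ultimately have "(\<lambda>z. \<bar>case z of (t, x) \<Rightarrow> w t x\<bar> powr p) absolutely_integrable_on region \<tau>"
    using sol unfolding weak_solution_def Lp_loc_on_def by blast
  then have "integrable lebesgue (\<lambda>z. indicator (region \<tau>) z *\<^sub>R (\<bar>case z of (t, x) \<Rightarrow> w t x\<bar> powr p))"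
    by (simp add: set_integrable_def)
  moreover have "(\<lambda>z. indicator (region \<tau>) z *\<^sub>R (\<bar>case z of (t, x) \<Rightarrow> w t x\<bar> powr p))
      = (\<lambda>z. indicator (region \<tau>) z * \<bar>W z\<bar> powr p)"
    using sub by (auto simp: fun_eq_iff indicator_def trunc_def)
  ultimately show ?thesis by simp
qed

text \<open>On a region of finite measure |w| <= 1 + |w|^p, so integrability of |w|^p gives both
  claims. The bound on \<open>h\<close> is asked only on the region, since before time \<tau> the
  solution vanishes off it and afterwards \<open>h\<close> vanishes.\<close>

lemma W_bounded_integrable:
  assumes \<tau>: "0 \<le> \<tau>" "ereal \<tau> < T" and h: "h \<in> borel_measurable borel"
    and H: "\<And>z. z \<in> region \<tau> \<Longrightarrow> \<bar>h z\<bar> \<le> H" and h0: "\<And>z. \<tau> < fst z \<Longrightarrow> h z = 0"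
  shows "integrable lebesgue (\<lambda>z. W z * h z)" "integrable lebesgue (\<lambda>z. \<bar>W z\<bar> powr p * h z)"
proof -
  note [measurable] = W_measurable borel_measurable_lebesgueI[OF h]
  define D where "D = (\<lambda>z. (indicator (region \<tau>) z :: real))"
  have i: "integrable lebesgue (\<lambda>z. H * (D z + D z * \<bar>W z\<bar> powr p))"
    unfolding D_def by (intro integrable_mult_right Bochner_Integration.integrable_add
        region_integrable W_powr_integrable \<tau>)
  have ae: "AE z in lebesgue. (W z * h z = 0 \<or> z \<in> region \<tau>)"
    using W_supp_region[of \<tau>] by (rule AE_mp) (auto intro!: AE_I2 simp: h0 not_le[symmetric])
  show "integrable lebesgue (\<lambda>z. W z * h z)"
  proof (rule Bochner_Integration.integrable_bound[OF i])
    show "AE z in lebesgue. norm (W z * h z) \<le> norm (H * (D z + D z * \<bar>W z\<bar> powr p))"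
      using ae
    proof (rule AE_mp, intro AE_I2 impI)
      fix z assume *: "W z * h z = 0 \<or> z \<in> region \<tau>"
      show "norm (W z * h z) \<le> norm (H * (D z + D z * \<bar>W z\<bar> powr p))"
      proof (cases "W z * h z = 0")
        case False
        then have z: "z \<in> region \<tau>" using * by simp
        have "\<bar>W z\<bar> \<le> 1 + \<bar>W z\<bar> powr p"
        proof (cases "\<bar>W z\<bar> \<le> 1")
          case True
          then show ?thesis using powr_ge_zero[of "\<bar>W z\<bar>" p] by linarith
        next
          case False
          then show ?thesis using powr_mono[of 1 p "\<bar>W z\<bar>"] p by simp
        qed
        then have "\<bar>W z\<bar> * \<bar>h z\<bar> \<le> (1 + \<bar>W z\<bar> powr p) * H"
          using H[OF z] by (intro mult_mono) auto
        also have "\<dots> \<le> \<bar>(1 + \<bar>W z\<bar> powr p) * H\<bar>" by simp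
        finally show ?thesis using z by (simp add: D_def abs_mult mult.commute)
      qed auto
    qed
  qed simp
  show "integrable lebesgue (\<lambda>z. \<bar>W z\<bar> powr p * h z)"
  proof (rule Bochner_Integration.integrable_bound[OF i])
    show "AE z in lebesgue. norm (\<bar>W z\<bar> powr p * h z) \<le> norm (H * (D z + D z * \<bar>W z\<bar> powr p))"
      using ae
    proof (rule AE_mp, intro AE_I2 impI)
      fix z assume *: "W z * h z = 0 \<or> z \<in> region \<tau>"
      show "norm (\<bar>W z\<bar> powr p * h z) \<le> norm (H * (D z + D z * \<bar>W z\<bar> powr p))"
      proof (cases "W z * h z = 0")
        case False
        then have z: "z \<in> region \<tau>" using * by simp
        have "\<bar>W z\<bar> powr p * \<bar>h z\<bar> \<le> (1 + \<bar>W z\<bar> powr p) * H"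
          using H[OF z] by (intro mult_mono) auto
        also have "\<dots> \<le> \<bar>(1 + \<bar>W z\<bar> powr p) * H\<bar>" by simp
        finally show ?thesis using z by (simp add: D_def abs_mult mult.commute)
      qed auto
    qed
  qed simp
qed

text \<open>The formal adjoint applied to a(t) \<Phi>(x) and divided by \<Phi>, when the Laplacian
  multiplies \<Phi> by \<kappa>^2. The arguments \<open>a1\<close> and \<open>a2\<close> stand for
  the derivatives of \<open>a\<close>.\<close>

definition adjoint :: "real \<Rightarrow> (real \<Rightarrow> real) \<Rightarrow> (real \<Rightarrow> real) \<Rightarrow> (real \<Rightarrow> real) \<Rightarrow> real \<Rightarrow> real" where
  "adjoint \<kappa> a a1 a2 t = a2 t - \<kappa>\<^sup>2 * (1 + t) powr (2 * l) * a t
     - (\<beta> / (1 + t) * a1 t - \<beta> / (1 + t)\<^sup>2 * a t) + \<mu>\<^sup>2 / (1 + t)\<^sup>2 * a t"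

abbreviation "\<Phi> \<kappa> x \<equiv> radial \<kappa> CARD('n) ((norm (x :: real^'n))\<^sup>2)"

text \<open>A separated test function \<open>a t * \<Phi> \<kappa> x\<close> need not have compact support in \<open>x\<close>: by finite
  propagation it can be cut off without changing any of the integrals.\<close>

lemma separated_identity:
  assumes a: "smooth_on UNIV a" "\<And>t. (a has_real_derivative a1 t) (at t)"
    "\<And>t. (a1 has_real_derivative a2 t) (at t)"
    and a0: "\<And>t. t \<le> -1/2 \<Longrightarrow> a t = 0" "\<And>t. \<tau> \<le> t \<Longrightarrow> a t = 0"
    and \<tau>: "0 \<le> \<tau>" "ereal \<tau> < T"
  shows "(\<integral>z. W z * (adjoint \<kappa> a a1 a2 (fst z) * \<Phi> \<kappa> (snd z)) \<partial>lebesgue)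
    = (\<integral>z. \<bar>W z\<bar> powr p * (a (fst z) * \<Phi> \<kappa> (snd z)) \<partial>lebesgue)
      + \<epsilon> * (\<integral>x. (g x * a 0 + f x * (\<beta> * a 0 - a1 0)) * \<Phi> \<kappa> x \<partial>lebesgue)"
proof -
  let ?n = "CARD('n)"
  have n: "1 \<le> ?n" by simp
  define r where "r = R\<^sub>0 + propagation l \<tau>"
  have r: "R\<^sub>0 \<le> r" "0 < r" using R propagation_nonneg[OF l \<tau>(1)] by (auto simp: r_def)
  \<comment> \<open>The margin between r and r + 1 makes the cutoff equal to 1 on a neighbourhood of
    the support, so that the derivatives of \<open>B\<close> agree there with those of the radial
    function.\<close>
  define S where "S = (r + 1)\<^sup>2"
  define B where "B = (\<lambda>s. radial \<kappa> ?n s * smooth_step ((-1) * s + (S + 1)))"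
  have Bs: "smooth_on UNIV B" unfolding B_def
    by (intro smooth_on_mult smooth_on_radial n smooth_on_affine_compose smooth_step_smooth)
  obtain B1 where B1: "\<And>s. (B has_real_derivative B1 s) (at s)" "smooth_on UNIV B1"
    using smooth_onE[OF Bs] by auto
  obtain B2 where B2: "\<And>s. (B1 has_real_derivative B2 s) (at s)" "smooth_on UNIV B2"
    using smooth_onE[OF B1(2)] by auto
  have BS: "B s = radial \<kappa> ?n s" if "s < S" for s using that by (simp add: B_def)
  have B1S: "B1 s = radial1 \<kappa> ?n s" if "s < S" for s
  proof (rule DERIV_unique[OF B1(1)])
    show "(B has_real_derivative radial1 \<kappa> ?n s) (at s)"
      by (rule has_field_derivative_transform_within_open[OF radial_deriv[OF n], where S="{..<S}"])
        (use that BS in auto)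
  qed
  have B2S: "B2 s = radial2 \<kappa> ?n s" if "s < S" for s
  proof (rule DERIV_unique[OF B2(1)])
    show "(B1 has_real_derivative radial2 \<kappa> ?n s) (at s)"
      by (rule has_field_derivative_transform_within_open[OF radial1_deriv[OF n], where S="{..<S}"])
        (use that B1S in auto)
  qed
  have B0: "B s = 0" if "S + 1 \<le> s" for s using that by (simp add: B_def)
  have a1s: "smooth_on UNIV a1" using smooth_on_derivative[OF a(1,2)] .
  have a2s: "smooth_on UNIV a2" using smooth_on_derivative[OF a1s a(3)] .
  have a1z: "a1 t = 0" if "\<tau> < t" for t
    by (rule derivative_zero_on_open[of "{\<tau><..}" a, OF _ _ _ a(2)]) (use that a0 in auto)
  have a2z: "a2 t = 0" if "\<tau> < t" for t
    by (rule derivative_zero_on_open[of "{\<tau><..}" a1, OF _ _ _ a(3)]) (use that a1z in auto)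
  define \<phi> where "\<phi> = (\<lambda>z :: real \<times> (real^'n). a (fst z) * B ((norm (snd z))\<^sup>2))"
  have test: "\<phi> \<in> test_functions T"
  proof -
    have Ck: "Ck k \<phi>" for k unfolding \<phi>_def
      by (intro Ck_mult Ck_compose[OF a(1)] Ck_compose[OF Bs] Ck_linear Ck_norm_square
          bounded_linear_fst bounded_linear_snd)
    define K where "K = {-1/2..\<tau>} \<times> cball (0::real^'n) (sqrt (S + 1))"
    have K: "compact K" unfolding K_def by (intro compact_Times) auto
    have "{z. \<phi> z \<noteq> 0} \<subseteq> K"
    proof
      fix z assume "z \<in> {z. \<phi> z \<noteq> 0}"
      then have "a (fst z) \<noteq> 0" "B ((norm (snd z))\<^sup>2) \<noteq> 0" by (auto simp: \<phi>_def)
      then have "-1/2 \<le> fst z" "fst z \<le> \<tau>" "(norm (snd z))\<^sup>2 \<le> S + 1"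
        using a0(1)[of "fst z"] a0(2)[of "fst z"] B0[of "(norm (snd z))\<^sup>2"] by force+
      then show "z \<in> K" by (cases z) (auto simp: K_def intro: real_le_rsqrt)
    qed
    then have sub: "tsupport \<phi> \<subseteq> K" unfolding tsupport_def
      using K closure_minimal compact_imp_closed by blast
    then have "compact (tsupport \<phi>)"
      using K by (metis closed_closure compact_closure compact_eq_bounded_closed bounded_subset tsupport_def)
    moreover have "tsupport \<phi> \<subseteq> {(t, x). ereal t < T}"
    proof -
      have "ereal t < T" if "(t, x) \<in> K" for t x
        using that \<tau>(2) le_less_trans[of "ereal t" "ereal \<tau>" T] by (simp add: K_def)
      then show ?thesis using sub by auto
    qed
    ultimately show ?thesis using Ck by (simp add: test_functions_def Cc_infty_def)
  qed
  define b where "b = (\<lambda>z :: real \<times> (real^'n). B ((norm (snd z))\<^sup>2))"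
  define M where "M = (\<lambda>z :: real \<times> (real^'n). a2 (fst z) * b z
     - (1 + fst z) powr (2 * l) * (a (fst z) * (4 * (norm (snd z))\<^sup>2 * B2 ((norm (snd z))\<^sup>2)
          + 2 * real ?n * B1 ((norm (snd z))\<^sup>2)))
     - (\<beta> / (1 + fst z) * a1 (fst z) - \<beta> / (1 + fst z)\<^sup>2 * a (fst z)) * b z
     + \<mu>\<^sup>2 / (1 + fst z)\<^sup>2 * (a (fst z) * b z))"
  have d2: "(deriv ^^ 2) (\<lambda>s. \<phi> (s, x)) t = a2 t * b (t, x)" for t x
  proof -
    have "deriv (\<lambda>s. \<phi> (s, x)) = (\<lambda>s. a1 s * b (s, x))"
      unfolding \<phi>_def b_def by (intro ext DERIV_imp_deriv) (auto intro!: derivative_eq_intros a(2))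
    moreover have "deriv (\<lambda>s. a1 s * b (s, x)) t = a2 t * b (t, x)"
      unfolding b_def by (intro DERIV_imp_deriv) (auto intro!: derivative_eq_intros a(3))
    ultimately show ?thesis by (simp add: numeral_2_eq_2)
  qed
  have d1: "deriv (\<lambda>s. \<beta> / (1 + s) * \<phi> (s, x)) t = (\<beta> / (1 + t) * a1 t - \<beta> / (1 + t)\<^sup>2 * a t) * b (t, x)"
    if "0 \<le> t" for t x
  proof (rule DERIV_imp_deriv)
    have "((\<lambda>s. \<beta> / (1 + s)) has_real_derivative - \<beta> / (1 + t)\<^sup>2) (at t)"
      using that by (auto intro!: derivative_eq_intros simp: power2_eq_square)
    moreover have "((\<lambda>s. \<phi> (s, x)) has_real_derivative a1 t * b (t, x)) (at t)"
      unfolding \<phi>_def b_def by (auto intro!: derivative_eq_intros a(2))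
    ultimately have "((\<lambda>s. \<beta> / (1 + s) * \<phi> (s, x)) has_real_derivative
        (- \<beta> / (1 + t)\<^sup>2) * \<phi> (t, x) + a1 t * b (t, x) * (\<beta> / (1 + t))) (at t)"
      by (rule DERIV_mult)
    moreover have "(- \<beta> / (1 + t)\<^sup>2) * \<phi> (t, x) + a1 t * b (t, x) * (\<beta> / (1 + t))
        = (\<beta> / (1 + t) * a1 t - \<beta> / (1 + t)\<^sup>2 * a t) * b (t, x)"
      by (simp add: \<phi>_def b_def algebra_simps)
    ultimately show "((\<lambda>s. \<beta> / (1 + s) * \<phi> (s, x)) has_real_derivative
        (\<beta> / (1 + t) * a1 t - \<beta> / (1 + t)\<^sup>2 * a t) * b (t, x)) (at t)" by simp
  qed
  have lap: "laplacian (\<lambda>y. \<phi> (t, y)) x = a t * (4 * (norm x)\<^sup>2 * B2 ((norm x)\<^sup>2) + 2 * real ?n * B1 ((norm x)\<^sup>2))"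
    for t x
  proof -
    have "laplacian (\<lambda>y. (\<lambda>s. a t * B s) ((norm y)\<^sup>2)) x
      = 4 * (norm x)\<^sup>2 * (a t * B2 ((norm x)\<^sup>2)) + 2 * real DIM(real^'n) * (a t * B1 ((norm x)\<^sup>2))"
      by (rule laplacian_radial[where ?B1.0="\<lambda>s. a t * B1 s"])
        (auto intro!: derivative_eq_intros B1(1) B2(1))
    then show ?thesis by (simp add: \<phi>_def algebra_simps)
  qed
  have lhs: "(LINT (t, x):(time_interval T \<times> UNIV)|lebesgue.
           w t x * ((deriv ^^ 2) (\<lambda>s. \<phi> (s, x)) t
                    - (1 + t) powr (2 * l) * laplacian (\<lambda>y. \<phi> (t, y)) x
                    - deriv (\<lambda>s. \<beta> / (1 + s) * \<phi> (s, x)) t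
                    + \<mu>\<^sup>2 / (1 + t)\<^sup>2 * \<phi> (t, x))) = (\<integral>z. W z * M z \<partial>lebesgue)"
    unfolding set_lebesgue_integral_def d2 lap
  proof (intro Bochner_Integration.integral_cong refl)
    fix z :: "real \<times> (real^'n)"
    obtain t x where z: "z = (t, x)" by (cases z)
    show "indicator (time_interval T \<times> UNIV) z *\<^sub>R (case z of (t, x) \<Rightarrow>
           w t x * (a2 t * b (t, x)
                    - (1 + t) powr (2 * l) * (a t * (4 * (norm x)\<^sup>2 * B2 ((norm x)\<^sup>2) + 2 * real ?n * B1 ((norm x)\<^sup>2)))
                    - deriv (\<lambda>s. \<beta> / (1 + s) * \<phi> (s, x)) t
                    + \<mu>\<^sup>2 / (1 + t)\<^sup>2 * \<phi> (t, x))) = W z * M z"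
    proof (cases "t \<in> time_interval T")
      case True
      then have "0 \<le> t" by (simp add: time_interval_def)
      show ?thesis unfolding z split_conv d1[OF \<open>0 \<le> t\<close>]
        using True by (simp add: trunc_def M_def \<phi>_def b_def)
    qed (simp add: z trunc_def)
  qed
  have rhs: "(LINT (t, x):(time_interval T \<times> UNIV)|lebesgue. \<bar>w t x\<bar> powr p * \<phi> (t, x))
      = (\<integral>z. \<bar>W z\<bar> powr p * \<phi> z \<partial>lebesgue)"
    unfolding set_lebesgue_integral_def
    by (intro Bochner_Integration.integral_cong refl) (auto simp: trunc_def indicator_def)
  have fg: "f x = 0 \<and> g x = 0" if "R\<^sub>0 < norm x" for x
  proof -
    have "x \<notin> tsupport f" "x \<notin> tsupport g" using supp that by auto
    then show ?thesis unfolding tsupport_def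
      using closure_subset[of "{x. f x \<noteq> 0}"] closure_subset[of "{x. g x \<noteq> 0}"] by auto
  qed
  have small: "(norm x)\<^sup>2 < S" if "norm x \<le> r" for x :: "real^'n"
    unfolding S_def using that r by (intro power_strict_mono) auto
  have data: "(LINT x|lebesgue. (g x + \<beta> * f x) * \<phi> (0, x) - f x * deriv (\<lambda>s. \<phi> (s, x)) 0)
     = (\<integral>x. (g x * a 0 + f x * (\<beta> * a 0 - a1 0)) * \<Phi> \<kappa> x \<partial>lebesgue)"
  proof (intro Bochner_Integration.integral_cong refl)
    fix x
    have "deriv (\<lambda>s. \<phi> (s, x)) 0 = a1 0 * b (0, x)"
      unfolding \<phi>_def b_def by (intro DERIV_imp_deriv) (auto intro!: derivative_eq_intros a(2))
    moreover have "b (0, x) = \<Phi> \<kappa> x" if "norm x \<le> R\<^sub>0"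
      unfolding b_def using BS[OF small, of x] that r by simp
    ultimately show "(g x + \<beta> * f x) * \<phi> (0, x) - f x * deriv (\<lambda>s. \<phi> (s, x)) 0
      = (g x * a 0 + f x * (\<beta> * a 0 - a1 0)) * \<Phi> \<kappa> x"
      using fg[of x] by (cases "norm x \<le> R\<^sub>0") (auto simp: \<phi>_def b_def algebra_simps)
  qed
  note [measurable] = W_measurable smooth_borel_measurable[OF a(1)] smooth_borel_measurable[OF a1s]
    smooth_borel_measurable[OF a2s] smooth_borel_measurable[OF Bs] smooth_borel_measurable[OF B1(2)]
    smooth_borel_measurable[OF B2(2)] smooth_borel_measurable[OF smooth_on_radial[OF n, of \<kappa>]]
  have [measurable]: "b \<in> borel_measurable borel" unfolding b_def by measurable
  have Mm: "M \<in> borel_measurable borel" unfolding M_def by measurable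
  have am: "(\<lambda>z. adjoint \<kappa> a a1 a2 (fst z) * \<Phi> \<kappa> (snd z)) \<in> borel_measurable borel"
    unfolding adjoint_def by measurable
  have pm: "\<phi> \<in> borel_measurable borel" unfolding \<phi>_def by measurable
  have pm': "(\<lambda>z. a (fst z) * \<Phi> \<kappa> (snd z)) \<in> borel_measurable borel" by measurable
  \<comment> \<open>Where w lives, the cutoff is invisible and the eigenvalue equation applies;
    after \<tau> everything vanishes together with \<open>a\<close>.\<close>
  have ae: "AE z in lebesgue. W z = 0 \<or> (M z = adjoint \<kappa> a a1 a2 (fst z) * \<Phi> \<kappa> (snd z)
      \<and> \<phi> z = a (fst z) * \<Phi> \<kappa> (snd z))"
    using W_supp_region[of \<tau>]
  proof (rule AE_mp, intro AE_I2 impI)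
    fix z assume *: "W z \<noteq> 0 \<longrightarrow> fst z \<le> \<tau> \<longrightarrow> z \<in> region \<tau>"
    show "W z = 0 \<or> (M z = adjoint \<kappa> a a1 a2 (fst z) * \<Phi> \<kappa> (snd z)
      \<and> \<phi> z = a (fst z) * \<Phi> \<kappa> (snd z))"
    proof (cases "W z \<noteq> 0 \<and> fst z \<le> \<tau>")
      case True
      then have "norm (snd z) \<le> r" using * by (auto simp: region_def r_def)
      note sm = small[OF this]
      let ?s = "(norm (snd z))\<^sup>2"
      have ode: "4 * ?s * radial2 \<kappa> ?n ?s + 2 * real ?n * radial1 \<kappa> ?n ?s = \<kappa>\<^sup>2 * radial \<kappa> ?n ?s"
        by (rule radial_ode[OF n])
      have "M z = adjoint \<kappa> a a1 a2 (fst z) * \<Phi> \<kappa> (snd z)"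
        unfolding M_def b_def BS[OF sm] B1S[OF sm] B2S[OF sm] ode adjoint_def
        by (simp add: algebra_simps)
      then show ?thesis by (simp add: \<phi>_def BS[OF sm])
    next
      case False
      then show ?thesis
        using a0(2)[of "fst z"] a1z[of "fst z"] a2z[of "fst z"] by (auto simp: M_def adjoint_def \<phi>_def)
    qed
  qed
  have Wp: "(\<lambda>z. \<bar>W z\<bar> powr p) \<in> borel_measurable lebesgue" by measurable
  note le = borel_measurable_lebesgueI
  have "(\<integral>z. W z * M z \<partial>lebesgue) = (\<integral>z. W z * (adjoint \<kappa> a a1 a2 (fst z) * \<Phi> \<kappa> (snd z)) \<partial>lebesgue)"
    by (rule integral_cong_AE[OF borel_measurable_times[OF W_measurable le[OF Mm]]
          borel_measurable_times[OF W_measurable le[OF am]]]) (use ae in \<open>eventually_elim, auto\<close>)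
  moreover have "(\<integral>z. \<bar>W z\<bar> powr p * \<phi> z \<partial>lebesgue) = (\<integral>z. \<bar>W z\<bar> powr p * (a (fst z) * \<Phi> \<kappa> (snd z)) \<partial>lebesgue)"
    by (rule integral_cong_AE[OF borel_measurable_times[OF Wp le[OF pm]]
          borel_measurable_times[OF Wp le[OF pm']]]) (use ae in \<open>eventually_elim, auto\<close>)
  moreover have "(\<integral>z. W z * M z \<partial>lebesgue) = (\<integral>z. \<bar>W z\<bar> powr p * \<phi> z \<partial>lebesgue)
      + \<epsilon> * (\<integral>x. (g x * a 0 + f x * (\<beta> * a 0 - a1 0)) * \<Phi> \<kappa> x \<partial>lebesgue)"
    using sol test unfolding weak_solution_def lhs[symmetric] rhs[symmetric] data[symmetric] by blast
  ultimately show ?thesis by simp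
qed

end

section \<open>The upper bound\<close>

lemma bounded_of_bounded_support:
  fixes h :: "real \<Rightarrow> real"
  assumes "continuous_on UNIV h" "\<And>t. t < a \<Longrightarrow> h t = 0" "\<And>t. b < t \<Longrightarrow> h t = 0"
  shows "\<exists>M\<ge>0. \<forall>t. \<bar>h t\<bar> \<le> M"
proof -
  have "bounded (h ` {a..b})"
    using assms(1) by (intro compact_imp_bounded compact_continuous_image) (auto intro: continuous_on_subset)
  then obtain M where M: "0 < M" "\<And>t. t \<in> {a..b} \<Longrightarrow> \<bar>h t\<bar> \<le> M"
    by (auto simp: bounded_pos)
  have "\<bar>h t\<bar> \<le> M" for t using M assms(2,3)[of t] by (cases "t \<in> {a..b}") auto
  then show ?thesis using M(1) by (intro exI[of _ M]) auto
qed

text \<open>The profile is a high power Q^k. Two derivatives leave at least Q^(k - 2), which is at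
  most (Q^k)^(1 / p) once k / p <= k - 2; this allows Young's inequality to absorb the term with
  |w|^p.\<close>

lemma bump_profile:
  assumes p: "1 < (p::real)"
  obtains P P1 P2 :: "real \<Rightarrow> real" and K :: real
  where "smooth_on UNIV P" "\<And>y. (P has_real_derivative P1 y) (at y)"
    "\<And>y. (P1 has_real_derivative P2 y) (at y)"
    "\<And>y. 0 \<le> P y" "\<And>y. P y \<le> 1" "\<And>y. y \<le> 1/2 \<Longrightarrow> P y = 0" "\<And>y. 3 \<le> y \<Longrightarrow> P y = 0"
    "\<And>y. 1 \<le> y \<Longrightarrow> y \<le> 2 \<Longrightarrow> P y = 1"
    "0 \<le> K" "\<And>y. \<bar>P1 y\<bar> \<le> K * P y powr (1 / p)" "\<And>y. \<bar>P2 y\<bar> \<le> K * P y powr (1 / p)"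
proof -
  \<comment> \<open>The condition k / p <= k - 2 reads k >= 2 p / (p - 1); adding 3 keeps k - 2
    positive, so that Q^(k - 2) vanishes where Q does.\<close>
  define k where "k = nat \<lceil>2 * p / (p - 1)\<rceil> + 3"
  have k: "3 \<le> k" "2 * p / (p - 1) \<le> real k" unfolding k_def by linarith+
  have kp: "real k / p \<le> real k - 2"
  proof -
    have "2 * p \<le> real k * (p - 1)" using k(2) p by (simp add: pos_divide_le_eq)
    then show ?thesis using p by (simp add: field_simps)
  qed
  \<comment> \<open>The first step rises on [1/2, 1], the second falls on [2, 3].\<close>
  define Q where "Q = (\<lambda>y::real. smooth_step (2 * y + (-1)) * smooth_step ((-1) * y + 3))"
  have Qs: "smooth_on UNIV Q" unfolding Q_def
    by (intro smooth_on_mult smooth_on_affine_compose smooth_step_smooth)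
  obtain Q1 where Q1: "\<And>s. (Q has_real_derivative Q1 s) (at s)" "smooth_on UNIV Q1"
    using smooth_onE[OF Qs] by auto
  obtain Q2 where Q2: "\<And>s. (Q1 has_real_derivative Q2 s) (at s)" "smooth_on UNIV Q2"
    using smooth_onE[OF Q1(2)] by auto
  have Q01: "0 \<le> Q y" "Q y \<le> 1" for y
    unfolding Q_def by (auto intro: mult_le_one)
  have Q0: "Q y = 0" if "y \<le> 1/2 \<or> 3 \<le> y" for y using that by (auto simp: Q_def)
  have Q10: "Q1 y = 0" if "y < 1/2 \<or> 3 < y" for y
    by (rule derivative_zero_on_open[of "{..<1/2} \<union> {3<..}" Q, OF _ _ _ Q1(1)]) (use that Q0 in auto)
  have Q20: "Q2 y = 0" if "y < 1/2 \<or> 3 < y" for y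
    by (rule derivative_zero_on_open[of "{..<1/2} \<union> {3<..}" Q1, OF _ _ _ Q2(1)]) (use that Q10 in auto)
  obtain M1 where M1: "0 \<le> M1" "\<And>y. \<bar>Q1 y\<bar> \<le> M1"
    using bounded_of_bounded_support[OF smooth_on_continuous[OF Q1(2)], of "1/2" 3] Q10 by auto
  obtain M2 where M2: "0 \<le> M2" "\<And>y. \<bar>Q2 y\<bar> \<le> M2"
    using bounded_of_bounded_support[OF smooth_on_continuous[OF Q2(2)], of "1/2" 3] Q20 by auto
  define P where "P = (\<lambda>y. Q y ^ k)"
  define P1 where "P1 = (\<lambda>y. real k * (Q y ^ (k - 1) * Q1 y))"
  define P2 where "P2 = (\<lambda>y. real k * (Q y ^ (k - 1) * Q2 y + real (k - 1) * Q y ^ (k - 2) * Q1 y * Q1 y))"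
  define K where "K = real k * (M1 + M2 + real k * M1 * M1)"
  have K: "0 \<le> K" unfolding K_def using M1 M2 by simp
  have Qk: "Q y ^ (k - 2) \<le> P y powr (1 / p)" for y
  proof (cases "Q y = 0")
    case True
    then show ?thesis using k by (simp add: P_def power_0_left)
  next
    case False
    then have q: "0 < Q y" using Q01[of y] by simp
    have "Q y ^ (k - 2) = Q y powr (real k - 2)"
      using q k by (simp add: powr_realpow[symmetric] of_nat_diff)
    also have "\<dots> \<le> Q y powr (real k / p)" using kp q Q01(2)[of y] by (intro powr_mono') auto
    also have "\<dots> = P y powr (1 / p)" using q by (simp add: P_def powr_realpow[symmetric] powr_powr)
    finally show ?thesis .
  qed
  have Qk1: "Q y ^ (k - 1) \<le> Q y ^ (k - 2)" for y
    using Q01[of y] by (intro power_decreasing) auto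
  have b1: "\<bar>P1 y\<bar> \<le> K * P y powr (1 / p)" for y
  proof -
    have "\<bar>P1 y\<bar> = real k * \<bar>Q1 y\<bar> * Q y ^ (k - 1)" unfolding P1_def using Q01[of y] by (simp add: abs_mult)
    also have "\<dots> \<le> (real k * (M1 + M2 + real k * M1 * M1)) * P y powr (1 / p)"
    proof (intro mult_mono mult_left_mono)
      have "0 \<le> real k * M1 * M1" using M1(1) by simp
      then show "\<bar>Q1 y\<bar> \<le> M1 + M2 + real k * M1 * M1" using M1(2)[of y] M2(1) by linarith
      show "Q y ^ (k - 1) \<le> P y powr (1 / p)" by (rule order_trans[OF Qk1 Qk])
    qed (use M1 M2 Q01 in auto)
    finally show ?thesis by (simp add: K_def)
  qed
  have b2: "\<bar>P2 y\<bar> \<le> K * P y powr (1 / p)" for y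
  proof -
    have "\<bar>Q y ^ (k - 1) * Q2 y\<bar> \<le> P y powr (1 / p) * M2"
      unfolding abs_mult using order_trans[OF Qk1 Qk] M2 Q01[of y] by (intro mult_mono) auto
    moreover have "\<bar>real (k - 1) * Q y ^ (k - 2) * Q1 y * Q1 y\<bar> \<le> real k * P y powr (1 / p) * M1 * M1"
      unfolding abs_mult using Qk[of y] M1 Q01[of y] by (intro mult_mono) auto
    ultimately have "\<bar>Q y ^ (k - 1) * Q2 y + real (k - 1) * Q y ^ (k - 2) * Q1 y * Q1 y\<bar>
        \<le> P y powr (1 / p) * M2 + real k * P y powr (1 / p) * M1 * M1" by linarith
    also have "\<dots> = (M2 + real k * M1 * M1) * P y powr (1 / p)" by (simp add: algebra_simps)
    also have "\<dots> \<le> (M1 + M2 + real k * M1 * M1) * P y powr (1 / p)"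
      using M1 by (intro mult_right_mono) auto
    finally have "real k * \<bar>Q y ^ (k - 1) * Q2 y + real (k - 1) * Q y ^ (k - 2) * Q1 y * Q1 y\<bar>
        \<le> real k * ((M1 + M2 + real k * M1 * M1) * P y powr (1 / p))"
      by (rule mult_left_mono) simp
    then show ?thesis unfolding P2_def K_def abs_mult[of "real k"] by (simp only: abs_of_nat mult.assoc)
  qed
  have Pd: "(P has_real_derivative P1 y) (at y)" for y
    unfolding P_def P1_def by (rule DERIV_cong[OF DERIV_power[OF Q1(1)]]) simp
  have P1d: "(P1 has_real_derivative P2 y) (at y)" for y
    unfolding P1_def P2_def
    by (rule DERIV_cong[OF DERIV_cmult[OF DERIV_mult[OF DERIV_power[OF Q1(1)] Q2(1)]]])
      (simp add: algebra_simps numeral_2_eq_2)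
  have one: "P y = 1" if "1 \<le> y" "y \<le> 2" for y using that by (simp add: P_def Q_def)
  have Ps: "smooth_on UNIV P" unfolding P_def by (intro smooth_on_power Qs)
  show thesis
    by (rule that[of P P1 P2 K, OF Ps Pd P1d _ _ _ _ one K b1 b2])
      (use Q01 Q0 k in \<open>auto simp: P_def power_le_one\<close>)
qed

lemma measure_region_le:
  assumes "-1 < l" "0 < R"
  shows "\<exists>C\<ge>0. \<forall>\<tau>\<ge>1. measure lebesgue ({0..3 * \<tau>} \<times> cball (0::real^'n) (R + propagation l (3 * \<tau>)))
    \<le> C * \<tau> powr (1 + real CARD('n) * (1 + l))"
proof -
  define b where "b = 1 + l"
  have b: "0 < b" using assms by (simp add: b_def)
  \<comment> \<open>For \<tau> >= 1 both 1 + 3 \<tau> <= 4 \<tau> and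
    \<open>1 \<le> \<tau> powr b\<close> hold.\<close>
  define c where "c = R + 4 powr b / b"
  define V where "V = unit_ball_vol (real CARD('n))"
  have c: "0 < c" unfolding c_def using assms b by (intro add_pos_pos) auto
  have "measure lebesgue ({0..3 * \<tau>} \<times> cball (0::real^'n) (R + propagation l (3 * \<tau>)))
      \<le> 3 * V * c ^ CARD('n) * \<tau> powr (1 + real CARD('n) * (1 + l))" if \<tau>: "1 \<le> \<tau>" for \<tau>
  proof -
    let ?r = "R + propagation l (3 * \<tau>)"
    have r0: "0 \<le> ?r" using assms \<tau> propagation_nonneg[OF assms(1), of "3 * \<tau>"] by simp
    have "?r \<le> c * \<tau> powr b"
    proof -
      have "1 \<le> \<tau> powr b" using \<tau> b by (simp add: ge_one_powr_ge_zero)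
      then have "R \<le> R * \<tau> powr b" using assms(2) by simp
      moreover have "propagation l (3 * \<tau>) \<le> (1 + 3 * \<tau>) powr b / b"
        using assms(1) \<tau> b by (simp add: propagation_eq b_def divide_right_mono)
      moreover have "(1 + 3 * \<tau>) powr b / b \<le> (4 * \<tau>) powr b / b"
        using \<tau> b by (intro divide_right_mono powr_mono2) auto
      ultimately show ?thesis by (simp add: c_def powr_mult algebra_simps)
    qed
    then have rn: "?r ^ CARD('n) \<le> (c * \<tau> powr b) ^ CARD('n)" using r0 by (intro power_mono) auto
    have "emeasure lborel ({0..3 * \<tau>} \<times> cball (0::real^'n) ?r)
        = emeasure (lborel \<Otimes>\<^sub>M lborel) ({0..3 * \<tau>} \<times> cball (0::real^'n) ?r)" by (simp only: lborel_prod)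
    also have "\<dots> = emeasure lborel {0..3 * \<tau>} * emeasure lborel (cball (0::real^'n) ?r)"
      by (rule lborel.emeasure_pair_measure_Times) auto
    also have "\<dots> = ennreal (3 * \<tau> * (V * ?r ^ CARD('n)))"
      using \<tau> emeasure_cball[OF r0, of "0::real^'n"] by (simp add: V_def ennreal_mult r0)
    finally have "measure lborel ({0..3 * \<tau>} \<times> cball (0::real^'n) ?r) = 3 * \<tau> * (V * ?r ^ CARD('n))"
      using \<tau> r0 by (intro measure_eq_emeasure_eq_ennreal) (auto simp: V_def)
    moreover have "{0..3 * \<tau>} \<times> cball (0::real^'n) ?r \<in> sets lborel"
      by (simp, intro borel_Times) auto
    ultimately have "measure lebesgue ({0..3 * \<tau>} \<times> cball (0::real^'n) ?r) = 3 * \<tau> * (V * ?r ^ CARD('n))"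
      by simp
    also have "\<dots> \<le> 3 * \<tau> * (V * (c * \<tau> powr b) ^ CARD('n))"
      using \<tau> rn by (intro mult_left_mono) (auto simp: V_def)
    also have "\<dots> = 3 * V * c ^ CARD('n) * (\<tau> powr 1 * \<tau> powr (real CARD('n) * b))"
      using \<tau> by (simp add: power_mult_distrib powr_realpow[symmetric] powr_powr mult_ac)
    also have "\<tau> powr 1 * \<tau> powr (real CARD('n) * b) = \<tau> powr (1 + real CARD('n) * (1 + l))"
      unfolding powr_add[symmetric] b_def ..
    finally show ?thesis .
  qed
  moreover have "0 \<le> 3 * V * c ^ CARD('n)" using c by (simp add: V_def)
  ultimately show ?thesis by blast
qed

text \<open>The support of w provides the restriction in x. On these times the bump equals 1, and
  the cutoff of the second estimate is differentiated only there, so the same integral of |w|^p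
  occurs in both estimates.\<close>

definition slab :: "real \<Rightarrow> (real \<times> 'a) set" where
  "slab \<tau> = {\<tau>..2 * \<tau>} \<times> UNIV"

lemma slab_sets [measurable]: "(slab \<tau> :: (real \<times> 'a::euclidean_space) set) \<in> sets borel"
  unfolding slab_def by (intro borel_Times) auto

context weak_sol
begin

lemma slab_integrable:
  assumes "1 \<le> \<tau>" "ereal (3 * \<tau>) < T"
  shows "integrable lebesgue (\<lambda>z. \<bar>W z\<bar> powr p * indicator (slab \<tau>) z)"
proof (rule W_bounded_integrable(2)[of "3 * \<tau>" _ 1])
  show "indicator (slab \<tau>) z = (0::real)" if "3 * \<tau> < fst z" for z :: "real \<times> (real^'n)"
    using that assms by (cases z) (auto simp: slab_def)
qed (use assms in auto)

text \<open>Testing with the cutoff alone, the case \<kappa> = 0, gives an identity without data.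
  The operator costs \<tau>^(-2) and leaves the power 1 / p of the cutoff, so Young's inequality
  returns the fraction 1 / p of the left side, which is absorbed.\<close>

lemma slab_upper_bound:
  assumes \<beta>: "0 \<le> \<beta>" and \<tau>: "1 \<le> \<tau>" "ereal (3 * \<tau>) < T"
    and P: "smooth_on UNIV P" "\<And>y. (P has_real_derivative P1 y) (at y)"
    "\<And>y. (P1 has_real_derivative P2 y) (at y)"
    "\<And>y. 0 \<le> P y" "\<And>y. P y \<le> 1" "\<And>y. y \<le> 1/2 \<Longrightarrow> P y = 0" "\<And>y. 3 \<le> y \<Longrightarrow> P y = 0"
    "\<And>y. 1 \<le> y \<Longrightarrow> y \<le> 2 \<Longrightarrow> P y = 1"
    "0 \<le> K" "\<And>y. \<bar>P1 y\<bar> \<le> K * P y powr (1 / p)" "\<And>y. \<bar>P2 y\<bar> \<le> K * P y powr (1 / p)"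
    and K': "K' = K + (2 * \<beta> * K + 4 * \<beta>) + 4 * \<mu>\<^sup>2"
  shows "(\<integral>z. \<bar>W z\<bar> powr p * indicator (slab \<tau>) z \<partial>lebesgue)
    \<le> (K' / \<tau>\<^sup>2) powr (p / (p - 1)) * measure lebesgue (region (3 * \<tau>))"
proof -
  define q where "q = p / (p - 1)"
  have q: "1 < q" "1 / p + 1 / q = 1" using p by (auto simp: q_def field_simps)
  have t0: "0 < \<tau>" using \<tau> by simp
  define a where "a = (\<lambda>t. P (1 / \<tau> * t + 0))"
  define a1 where "a1 = (\<lambda>t. P1 (1 / \<tau> * t + 0) / \<tau>)"
  define a2 where "a2 = (\<lambda>t. P2 (1 / \<tau> * t + 0) / \<tau>\<^sup>2)"
  have as: "smooth_on UNIV a" unfolding a_def by (rule smooth_on_affine_compose[OF P(1)])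
  have lin: "((\<lambda>t. 1 / \<tau> * t + 0) has_real_derivative 1 / \<tau>) (at t)" for t
    using t0 by (auto intro!: derivative_eq_intros)
  have ad: "(a has_real_derivative a1 t) (at t)" for t
    unfolding a_def a1_def by (rule DERIV_cong[OF DERIV_chain2[OF P(2) lin]]) simp
  have a1d: "(a1 has_real_derivative a2 t) (at t)" for t
    unfolding a1_def a2_def
    by (rule DERIV_cong[OF DERIV_cdivide[OF DERIV_chain2[OF P(3) lin]]])
      (use t0 in \<open>simp add: power2_eq_square\<close>)
  have a_lo: "a t = 0" if "t \<le> \<tau> / 2" for t
    unfolding a_def by (rule P(6)) (use that t0 in \<open>simp add: field_simps\<close>)
  have a_hi: "a t = 0" if "3 * \<tau> \<le> t" for t
    unfolding a_def by (rule P(7)) (use that t0 in \<open>simp add: field_simps\<close>)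
  have a_one: "a t = 1" if "\<tau> \<le> t" "t \<le> 2 * \<tau>" for t
    unfolding a_def by (rule P(8)) (use that t0 in \<open>simp_all add: field_simps\<close>)
  have a01: "0 \<le> a t" "a t \<le> 1" for t using P(4,5) by (auto simp: a_def)
  have a1b: "\<bar>a1 t\<bar> \<le> K * a t powr (1 / p) / \<tau>" for t
    unfolding a1_def a_def using P(10) t0 by (simp add: divide_right_mono)
  have a2b: "\<bar>a2 t\<bar> \<le> K * a t powr (1 / p) / \<tau>\<^sup>2" for t
    unfolding a2_def a_def using P(11) t0 by (simp add: divide_right_mono)
  define m where "m = adjoint 0 a a1 a2"
  have mb: "\<bar>m t\<bar> \<le> K' / \<tau>\<^sup>2 * a t powr (1 / p)" if t: "0 \<le> t" for t
  proof (cases "t \<le> \<tau> / 2")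
    case True
    then have "a t = 0" "a1 t = 0" "a2 t = 0" using a_lo a1b[of t] a2b[of t] by auto
    then show ?thesis by (simp add: m_def adjoint_def)
  next
    case False
    define v where "v = a t powr (1 / p)"
    have v: "0 \<le> v" by (simp add: v_def)
    have av: "a t \<le> v"
    proof (cases "a t = 0")
      case False
      then show ?thesis unfolding v_def
        using powr_mono'[of "1 / p" 1 "a t"] a01[of t] p by (simp add: field_simps)
    qed (simp add: v)
    \<comment> \<open>In this case t > \<tau> / 2, so every factor 1 / (1 + t) costs 2 / \<tau>;
      hence the terms 2 \<beta> K, 4 \<beta> and 4 \<mu>^2 in \<open>K'\<close>.\<close>
    have s: "1 / (1 + t) \<le> 2 / \<tau>" using False t0 by (simp add: field_simps)
    have s2: "1 / (1 + t)\<^sup>2 \<le> 4 / \<tau>\<^sup>2"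
      using power_mono[OF s, of 2] t by (simp add: power_divide)
    have "\<bar>\<beta> / (1 + t) * a1 t\<bar> \<le> \<beta> * (2 / \<tau>) * (K * v / \<tau>)"
    proof -
      have "\<bar>\<beta> / (1 + t) * a1 t\<bar> = \<beta> * (1 / (1 + t)) * \<bar>a1 t\<bar>" using \<beta> t by (simp add: abs_mult)
      also have "\<dots> \<le> \<beta> * (2 / \<tau>) * (K * v / \<tau>)"
        using s a1b[of t] \<beta> t t0 unfolding v_def by (intro mult_mono) auto
      finally show ?thesis .
    qed
    moreover have "\<bar>\<beta> / (1 + t)\<^sup>2 * a t\<bar> \<le> \<beta> * (4 / \<tau>\<^sup>2) * v"
    proof -
      have "\<bar>\<beta> / (1 + t)\<^sup>2 * a t\<bar> = \<beta> * (1 / (1 + t)\<^sup>2) * a t" using \<beta> a01[of t] by (simp add: abs_mult)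
      also have "\<dots> \<le> \<beta> * (4 / \<tau>\<^sup>2) * v" using s2 av a01[of t] \<beta> by (intro mult_mono) auto
      finally show ?thesis .
    qed
    moreover have "\<bar>\<mu>\<^sup>2 / (1 + t)\<^sup>2 * a t\<bar> \<le> \<mu>\<^sup>2 * (4 / \<tau>\<^sup>2) * v"
    proof -
      have "\<bar>\<mu>\<^sup>2 / (1 + t)\<^sup>2 * a t\<bar> = \<mu>\<^sup>2 * (1 / (1 + t)\<^sup>2) * a t" using a01[of t] by (simp add: abs_mult)
      also have "\<dots> \<le> \<mu>\<^sup>2 * (4 / \<tau>\<^sup>2) * v" using s2 av a01[of t] by (intro mult_mono) auto
      finally show ?thesis .
    qed
    moreover have "\<bar>a2 t\<bar> \<le> K * v / \<tau>\<^sup>2" using a2b by (simp add: v_def)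
    moreover have "m t = a2 t - (\<beta> / (1 + t) * a1 t - \<beta> / (1 + t)\<^sup>2 * a t) + \<mu>\<^sup>2 / (1 + t)\<^sup>2 * a t"
      by (simp add: m_def adjoint_def)
    moreover have "\<bar>V - (X - Y) + Z\<bar> \<le> v' + (x + y) + z"
      if "\<bar>X\<bar> \<le> x" "\<bar>Y\<bar> \<le> y" "\<bar>Z\<bar> \<le> z" "\<bar>V\<bar> \<le> v'" for X Y Z V x y z v' :: real
      using that by linarith
    ultimately have "\<bar>m t\<bar> \<le> K * v / \<tau>\<^sup>2 + (\<beta> * (2 / \<tau>) * (K * v / \<tau>) + \<beta> * (4 / \<tau>\<^sup>2) * v) + \<mu>\<^sup>2 * (4 / \<tau>\<^sup>2) * v"
      by presburger
    also have "\<dots> = K' / \<tau>\<^sup>2 * v"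
      using t0 unfolding K' by (simp add: field_simps power2_eq_square)
    finally show ?thesis unfolding v_def .
  qed
  have K'0: "0 \<le> K'" unfolding K' using P(9) \<beta> by simp
  have m_hi: "m t = 0" if "3 * \<tau> < t" for t
    using that a_hi[of t] a1b[of t] a2b[of t] by (simp add: m_def adjoint_def)
  have n1: "1 \<le> CARD('n)" by simp
  have id: "(\<integral>z. W z * m (fst z) \<partial>lebesgue) = (\<integral>z. \<bar>W z\<bar> powr p * a (fst z) \<partial>lebesgue)"
  proof -
    have "a 0 = 0" "a1 0 = 0" using a_lo[of 0] a1b[of 0] t0 by auto
    then show ?thesis
      using separated_identity[OF as ad a1d, of "3 * \<tau>" 0] a_lo a_hi t0 \<tau>
      by (simp add: radial_0[OF n1] m_def)
  qed
  have [measurable]: "a \<in> borel_measurable borel" "a1 \<in> borel_measurable borel" "a2 \<in> borel_measurable borel"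
    using as smooth_on_derivative[OF as ad] smooth_on_derivative[OF smooth_on_derivative[OF as ad] a1d]
    by (auto intro: smooth_borel_measurable)
  have [measurable]: "m \<in> borel_measurable borel" unfolding m_def adjoint_def[abs_def] by measurable
  define v where "v = K' / \<tau>\<^sup>2"
  have v: "0 \<le> v" using K'0 by (simp add: v_def)
  have ap: "a t powr (1 / p) \<le> 1" for t using a01[of t] p by (intro powr_le1) auto
  have i1: "integrable lebesgue (\<lambda>z. W z * m (fst z))"
  proof (rule W_bounded_integrable(1)[of "3 * \<tau>" _ v])
    fix z :: "real \<times> (real^'n)" assume "z \<in> region (3 * \<tau>)"
    then have "0 \<le> fst z" by (auto simp: region_def)
    then have "\<bar>m (fst z)\<bar> \<le> v * a (fst z) powr (1 / p)" using mb by (simp add: v_def)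
    also have "\<dots> \<le> v * 1" using ap v by (intro mult_left_mono) auto
    finally show "\<bar>m (fst z)\<bar> \<le> v" by simp
  qed (use \<tau> m_hi in auto)
  have i2: "integrable lebesgue (\<lambda>z. \<bar>W z\<bar> powr p * a (fst z))"
    by (rule W_bounded_integrable(2)[of "3 * \<tau>" _ 1]) (use \<tau> a01 a_hi in auto)
  define I where "I = (\<integral>z. \<bar>W z\<bar> powr p * a (fst z) \<partial>lebesgue)"
  have "I \<le> (\<integral>z. \<bar>W z\<bar> powr p * a (fst z) / p + v powr q / q * indicator (region (3 * \<tau>)) z \<partial>lebesgue)"
    unfolding I_def id[symmetric]
  proof (rule integral_mono_AE[OF i1])
    show "integrable lebesgue (\<lambda>z. \<bar>W z\<bar> powr p * a (fst z) / p + v powr q / q * indicator (region (3 * \<tau>)) z)"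
      by (intro Bochner_Integration.integrable_add integrable_divide i2 integrable_mult_right region_integrable)
    show "AE z in lebesgue. W z * m (fst z) \<le> \<bar>W z\<bar> powr p * a (fst z) / p + v powr q / q * indicator (region (3 * \<tau>)) z"
      using W_supp_region[of "3 * \<tau>"]
    proof eventually_elim
      fix z assume *: "W z \<noteq> 0 \<longrightarrow> fst z \<le> 3 * \<tau> \<longrightarrow> z \<in> region (3 * \<tau>)"
      show "W z * m (fst z) \<le> \<bar>W z\<bar> powr p * a (fst z) / p + v powr q / q * indicator (region (3 * \<tau>)) z"
      proof (cases "W z \<noteq> 0 \<and> fst z \<le> 3 * \<tau>")
        case True
        then have z: "z \<in> region (3 * \<tau>)" using * by simp
        then have t: "0 \<le> fst z" by (auto simp: region_def)
        have "W z * m (fst z) \<le> \<bar>W z\<bar> * \<bar>m (fst z)\<bar>" by (simp add: abs_mult[symmetric])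
        also have "\<dots> \<le> \<bar>W z\<bar> * (v * a (fst z) powr (1 / p))"
          using mb[OF t] by (intro mult_left_mono) (auto simp: v_def)
        also have "\<dots> = (\<bar>W z\<bar> * a (fst z) powr (1 / p)) * v" by simp
        also have "\<dots> \<le> (\<bar>W z\<bar> * a (fst z) powr (1 / p)) powr p / p + v powr q / q"
          using p q v by (intro Youngs_inequality) auto
        also have "(\<bar>W z\<bar> * a (fst z) powr (1 / p)) powr p = \<bar>W z\<bar> powr p * a (fst z)"
          using p a01[of "fst z"] by (simp add: powr_mult powr_powr)
        finally show ?thesis using z by simp
      next
        case False
        then have e: "W z * m (fst z) = 0" using m_hi by auto
        show ?thesis unfolding e using a01[of "fst z"] p q by (intro add_nonneg_nonneg) auto
      qed
    qed
  qed
  also have "\<dots> = I / p + v powr q / q * measure lebesgue (region (3 * \<tau>))"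
    using i2 region_integrable by (simp add: I_def)
  finally have "I * (1 - 1 / p) \<le> v powr q / q * measure lebesgue (region (3 * \<tau>))"
    by (simp add: right_diff_distrib)
  moreover have "1 - 1 / p = 1 / q" using q by simp
  ultimately have "I \<le> v powr q * measure lebesgue (region (3 * \<tau>))"
    using q by (simp add: divide_le_cancel)
  moreover have "(\<integral>z. \<bar>W z\<bar> powr p * indicator (slab \<tau>) z \<partial>lebesgue) \<le> I"
    unfolding I_def
    by (intro integral_mono slab_integrable \<tau> i2 mult_left_mono)
      (use a01 a_one in \<open>auto simp: slab_def indicator_def\<close>)
  ultimately show ?thesis by (simp add: v_def q_def)
qed

end

text \<open>The constant precedes \<open>\<epsilon>\<close>, \<open>T\<close> and \<open>w\<close>
  because the test function vanishes near the initial time. The exponent is that of the volume of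
  the cylinder, lowered by 2 q.\<close>

lemma energy_upper_bound:
  fixes l \<beta> \<mu> p R\<^sub>0 :: real and f g :: "real^'n \<Rightarrow> real"
  assumes "-1 < l" "0 \<le> \<beta>" "1 < p" "0 < R\<^sub>0"
  shows "\<exists>C>0. \<forall>\<epsilon> T w \<tau>. weak_sol l \<beta> \<mu> p f g \<epsilon> R\<^sub>0 T w \<and> 1 \<le> \<tau> \<and> ereal (3 * \<tau>) < T \<longrightarrow>
    (\<integral>z. \<bar>trunc T w z\<bar> powr p * indicator (slab \<tau>) z \<partial>lebesgue)
      \<le> C * \<tau> powr (1 + real CARD('n) * (1 + l) - 2 * (p / (p - 1)))"
proof -
  obtain P P1 P2 K where P: "smooth_on UNIV P" "\<And>y. (P has_real_derivative P1 y) (at y)"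
    "\<And>y. (P1 has_real_derivative P2 y) (at y)"
    "\<And>y. 0 \<le> P y" "\<And>y. P y \<le> 1" "\<And>y. y \<le> 1/2 \<Longrightarrow> P y = 0" "\<And>y. 3 \<le> y \<Longrightarrow> P y = 0"
    "\<And>y. 1 \<le> y \<Longrightarrow> y \<le> 2 \<Longrightarrow> P y = 1"
    "0 \<le> K" "\<And>y. \<bar>P1 y\<bar> \<le> K * P y powr (1 / p)" "\<And>y. \<bar>P2 y\<bar> \<le> K * P y powr (1 / p)"
    using bump_profile[OF assms(3)] by blast
  obtain D where D: "0 \<le> D" "\<And>\<tau>. 1 \<le> \<tau> \<Longrightarrow>
      measure lebesgue ({0..3 * \<tau>} \<times> cball (0::real^'n) (R\<^sub>0 + propagation l (3 * \<tau>)))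
      \<le> D * \<tau> powr (1 + real CARD('n) * (1 + l))"
    using measure_region_le[OF assms(1,4)] by blast
  define K' where "K' = K + (2 * \<beta> * K + 4 * \<beta>) + 4 * \<mu>\<^sup>2"
  have K': "0 \<le> K'" using P(9) assms by (simp add: K'_def)
  define q where "q = p / (p - 1)"
  have "(\<integral>z. \<bar>trunc T w z\<bar> powr p * indicator (slab \<tau>) z \<partial>lebesgue)
      \<le> (K' powr q * D + 1) * \<tau> powr (1 + real CARD('n) * (1 + l) - 2 * q)"
    if ws: "weak_sol l \<beta> \<mu> p f g \<epsilon> R\<^sub>0 T w" and \<tau>: "1 \<le> \<tau>" "ereal (3 * \<tau>) < T" for \<epsilon> T w \<tau>
  proof -
    interpret weak_sol l \<beta> \<mu> p f g \<epsilon> R\<^sub>0 T w by (rule ws)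
    have "(\<integral>z. \<bar>W z\<bar> powr p * indicator (slab \<tau>) z \<partial>lebesgue)
       \<le> (K' / \<tau>\<^sup>2) powr q * measure lebesgue (region (3 * \<tau>))"
      unfolding q_def by (rule slab_upper_bound[OF assms(2) \<tau> P K'_def])
    also have "\<dots> \<le> (K' / \<tau>\<^sup>2) powr q * (D * \<tau> powr (1 + real CARD('n) * (1 + l)))"
      unfolding region_def using D(2)[OF \<tau>(1)] by (intro mult_left_mono) auto
    also have "(K' / \<tau>\<^sup>2) powr q = K' powr q * \<tau> powr (- 2 * q)"
    proof -
      have "\<tau>\<^sup>2 = \<tau> powr 2" using \<tau> by simp
      then have "(K' / \<tau>\<^sup>2) powr q = K' powr q / (\<tau> powr 2) powr q"
        using \<tau> K' by (simp add: powr_divide)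
      then show ?thesis by (simp add: powr_powr powr_minus_divide)
    qed
    also have "K' powr q * \<tau> powr (- 2 * q) * (D * \<tau> powr (1 + real CARD('n) * (1 + l)))
      = K' powr q * D * \<tau> powr (1 + real CARD('n) * (1 + l) - 2 * q)"
      by (simp add: powr_add[symmetric] powr_diff powr_minus_divide)
    also have "\<dots> \<le> (K' powr q * D + 1) * \<tau> powr (1 + real CARD('n) * (1 + l) - 2 * q)"
      by (intro mult_right_mono) auto
    finally show ?thesis .
  qed
  moreover have "0 < K' powr q * D + 1" using D(1) by (simp add: add_nonneg_pos)
  ultimately show ?thesis unfolding q_def by blast
qed

section \<open>The lower bound\<close>

text \<open>The sum of two powers serves either sign of the exponent: the lower constant matters for
  negative \<open>a\<close>, the upper one otherwise.\<close>

lemma powr_comparable: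
  fixes x y c1 c2 a :: real
  assumes "0 < c1" "0 < x" "c1 * x \<le> y" "y \<le> c2 * x"
  shows "y powr a \<le> (c1 powr a + c2 powr a) * x powr a"
proof (cases "0 \<le> a")
  case True
  have "0 < y" using assms by (meson less_le_trans mult_pos_pos)
  then have "y powr a \<le> (c2 * x) powr a" using True assms by (intro powr_mono2) auto
  also have "\<dots> = c2 powr a * x powr a" by (rule powr_mult)
  also have "\<dots> \<le> (c1 powr a + c2 powr a) * x powr a" by (intro mult_right_mono) auto
  finally show ?thesis .
next
  case False
  have "y powr a \<le> (c1 * x) powr a" using False assms by (intro powr_mono2') auto
  also have "\<dots> = c1 powr a * x powr a" by (rule powr_mult)
  also have "\<dots> \<le> (c1 powr a + c2 powr a) * x powr a" by (intro mult_right_mono) auto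
  finally show ?thesis .
qed

lemma integral_pos_of_continuous:
  fixes h :: "'a::euclidean_space \<Rightarrow> real"
  assumes h: "continuous_on UNIV h" "\<And>x. 0 \<le> h x" "h x0 \<noteq> 0" and supp: "\<And>x. R < norm x \<Longrightarrow> h x = 0"
  shows "0 < (\<integral>x. h x \<partial>lebesgue)"
proof -
  have "integrable lborel (\<lambda>x. indicator (cball 0 R) x *\<^sub>R h x)"
    by (rule borel_integrable_compact) (use h(1) in \<open>auto intro: continuous_on_subset\<close>)
  moreover have "(\<lambda>x. indicator (cball 0 R) x *\<^sub>R h x) = h"
    using supp by (auto simp: fun_eq_iff indicator_def)
  ultimately have "integrable lborel h" by simp
  moreover have hm: "h \<in> borel_measurable lborel" using borel_measurable_continuous_onI[OF h(1)] by simp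
  ultimately have i: "integrable lebesgue h" by (simp add: integrable_completion)
  have op: "open {x. h x \<noteq> 0}" using h(1) by (intro open_Collect_neq) auto
  then have [measurable]: "{x. h x \<noteq> 0} \<in> sets lebesgue" by (simp add: lborelD)
  have "(\<integral>x. h x \<partial>lebesgue) \<noteq> 0"
  proof
    assume "(\<integral>x. h x \<partial>lebesgue) = 0"
    then have "AE x in lebesgue. h x = 0"
      using integral_nonneg_eq_0_iff_AE[OF i] h(2) by simp
    then have "{x. h x \<noteq> 0} \<in> null_sets lebesgue"
      by (subst (asm) AE_iff_null) auto
    then have "negligible {x. h x \<noteq> 0}" by (simp add: negligible_iff_null_sets)
    then show False using open_not_negligible[OF op] h(3) by auto
  qed
  moreover have "0 \<le> (\<integral>x. h x \<partial>lebesgue)" by (intro integral_nonneg_AE) (auto simp: h(2))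
  ultimately show ?thesis by simp
qed

section \<open>The moment of the weight over the light cone\<close>

lemma integral_le_of_nn_integral_lborel:
  fixes G :: "'a::euclidean_space \<Rightarrow> real"
  assumes G: "G \<in> borel_measurable borel" "\<And>x. 0 \<le> G x" and C: "0 \<le> C"
    and le: "(\<integral>\<^sup>+x. ennreal (G x) \<partial>lborel) \<le> ennreal C"
  shows "integrable lebesgue G" "(\<integral>x. G x \<partial>lebesgue) \<le> C"
proof -
  have m: "G \<in> borel_measurable lborel" using G by simp
  have fin: "(\<integral>\<^sup>+x. ennreal (G x) \<partial>lborel) < \<infinity>" using le_less_trans[OF le] by simp
  have i: "integrable lborel G" by (rule integrableI_nonneg) (use m G fin in auto)
  then show "integrable lebesgue G" using m by (simp add: integrable_completion)
  have "(\<integral>x. G x \<partial>lebesgue) = (\<integral>x. G x \<partial>lborel)" using m by (simp add: integral_completion)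
  also have "\<dots> = enn2real (\<integral>\<^sup>+x. ennreal (G x) \<partial>lborel)"
    by (rule integral_eq_nn_integral) (use m G in auto)
  also have "\<dots> \<le> C" using le C by (simp add: enn2real_leI)
  finally show "(\<integral>x. G x \<partial>lebesgue) \<le> C" .
qed

text \<open>The bound on \<open>norm (snd z)\<close> is \<open>R + propagation l (fst z)\<close> in closed form.\<close>

definition cone_slab :: "real \<Rightarrow> real \<Rightarrow> real \<Rightarrow> (real \<times> (real^'n)) set" where
  "cone_slab l R \<tau> = {z. \<tau> \<le> fst z \<and> fst z \<le> 2 * \<tau> \<and> norm (snd z) \<le> R + ((1 + fst z) powr (1 + l) - 1) / (1 + l)}"

lemma cone_slab_sets [measurable]: "(cone_slab l R \<tau> :: (real \<times> (real^'n)) set) \<in> sets borel"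
proof -
  have "(\<lambda>z :: real \<times> (real^'n). R + ((1 + fst z) powr (1 + l) - 1) / (1 + l)) \<in> borel_measurable borel"
    "(\<lambda>z :: real \<times> (real^'n). norm (snd z)) \<in> borel_measurable borel" by measurable
  from borel_measurable_le[OF this(2) this(1)]
  have 1: "{z :: real \<times> (real^'n). norm (snd z) \<le> R + ((1 + fst z) powr (1 + l) - 1) / (1 + l)} \<in> sets borel"
    by (simp only: space_borel UNIV_I simp_thms)
  have 2: "{z :: real \<times> (real^'n). \<tau> \<le> fst z} \<in> sets borel" "{z :: real \<times> (real^'n). fst z \<le> 2 * \<tau>} \<in> sets borel"
    by (auto intro!: borel_closed closed_Collect_le continuous_intros)
  have "cone_slab l R \<tau> = {z :: real \<times> (real^'n). \<tau> \<le> fst z} \<inter> {z. fst z \<le> 2 * \<tau>}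
      \<inter> {z. norm (snd z) \<le> R + ((1 + fst z) powr (1 + l) - 1) / (1 + l)}"
    by (auto simp: cone_slab_def)
  then show ?thesis using 1 2 by (simp only: sets.Int)
qed

text \<open>At time t the cone section is a ball of radius r = R + A(t), and exp (- \<kappa> A(t))
  is a constant multiple of exp (- \<kappa> r), so the boundary layer estimate applies. As 1 + r is
  comparable to \<tau>^(1 + l), integrating over a time of length \<tau> adds 1 to the
  exponent.\<close>

lemma cone_slab_integral:
  fixes l R \<kappa> q :: real
  assumes l: "-1 < l" "l < 0" and R: "0 < R" and \<kappa>: "0 < \<kappa>" and q: "0 < q"
  defines "G \<equiv> \<lambda>\<tau> z :: real \<times> (real^'n). indicator (cone_slab l R \<tau>) z *
      (exp (- (\<kappa> * (((1 + fst z) powr (1 + l) - 1) / (1 + l)))) * radial \<kappa> CARD('n) ((norm (snd z))\<^sup>2)) powr q"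
  shows "\<exists>C\<ge>0. \<forall>\<tau>\<ge>1. integrable lebesgue (G \<tau>) \<and>
    (\<integral>z. G \<tau> z \<partial>lebesgue) \<le> C * \<tau> powr (1 + (1 + l) * ((real CARD('n) - 1) * (1 - q / 2)))"
proof -
  define b where "b = 1 + l"
  have b: "0 < b" "b < 1" using l by (auto simp: b_def)
  define A where "A = (\<lambda>t. ((1 + t) powr b - 1) / b)"
  define e where "e = (real CARD('n) - 1) * (1 - q / 2)"
  have n: "1 \<le> CARD('n)" by simp
  obtain D where D: "0 \<le> D" "\<And>r. 0 \<le> r \<Longrightarrow> (\<integral>\<^sup>+x\<in>cball (0::real^'n) r.
      ennreal ((radial \<kappa> CARD('n) ((norm x)\<^sup>2) * exp (- (\<kappa> * r))) powr q) \<partial>lborel)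
    \<le> ennreal (D * (1 + r) powr e)"
    using nn_integral_radial_powr[OF \<kappa> q, where 'a="real^'n"] unfolding e_def by auto
  define c2 where "c2 = 1 + R + 3 powr b / b"
  define E where "E = exp (\<kappa> * R) powr q"
  define C where "C = E * D * (1 powr e + c2 powr e)"
  have C: "0 \<le> C" using D(1) by (simp add: C_def E_def)
  have inner: "(\<integral>\<^sup>+x. ennreal (G \<tau> (t, x)) \<partial>lborel) \<le> ennreal (C * \<tau> powr (b * e)) * indicator {\<tau>..2 * \<tau>} t"
    if \<tau>: "1 \<le> \<tau>" for \<tau> t
  proof (cases "\<tau> \<le> t \<and> t \<le> 2 * \<tau>")
    case True
    define r where "r = R + A t"
    have pw: "1 \<le> (1 + t) powr b" "\<tau> powr b \<le> (1 + t) powr b" "(1 + t) powr b \<le> (3 * \<tau>) powr b" "1 \<le> \<tau> powr b"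
      using True \<tau> b by (auto intro!: powr_mono2 simp: ge_one_powr_ge_zero)
    have A0: "(1 + t) powr b - 1 \<le> A t"
      unfolding A_def using pw(1) b by (simp add: pos_le_divide_eq mult_left_le)
    have r0: "0 \<le> r" using A0 pw(1) R by (simp add: r_def)
    have lo: "1 * \<tau> powr b \<le> 1 + r" using A0 pw R by (simp add: r_def)
    have hi: "1 + r \<le> c2 * \<tau> powr b"
    proof -
      have "A t \<le> (3 * \<tau>) powr b / b" unfolding A_def using pw(3) b by (intro divide_right_mono) auto
      also have "\<dots> = 3 powr b / b * \<tau> powr b" by (simp add: powr_mult)
      finally have "A t \<le> 3 powr b / b * \<tau> powr b" .
      moreover have "(1 + R) * 1 \<le> (1 + R) * \<tau> powr b" using R pw(4) by (intro mult_left_mono) auto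
      ultimately show ?thesis by (simp add: r_def c2_def distrib_right)
    qed
    have pc: "(1 + r) powr e \<le> (1 powr e + c2 powr e) * \<tau> powr (b * e)"
      using powr_comparable[OF _ _ lo hi, of e] \<tau> by (simp add: powr_powr)
    have [measurable]: "cball (0::real^'n) r \<in> sets borel" by simp
    have [measurable]: "(radial \<kappa> CARD('n)) \<in> borel_measurable borel"
      by (rule smooth_borel_measurable[OF smooth_on_radial[OF n]])
    have "(\<integral>\<^sup>+x. ennreal (G \<tau> (t, x)) \<partial>lborel)
        = (\<integral>\<^sup>+x. ennreal E * (ennreal ((radial \<kappa> CARD('n) ((norm x)\<^sup>2) * exp (- (\<kappa> * r))) powr q) * indicator (cball (0::real^'n) r) x) \<partial>lborel)"
    proof (intro nn_integral_cong)
      fix x :: "real^'n"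
      have "exp (- (\<kappa> * A t)) = exp (\<kappa> * R) * exp (- (\<kappa> * r))"
        by (simp add: r_def exp_add[symmetric] algebra_simps)
      then have "(exp (- (\<kappa> * A t)) * radial \<kappa> CARD('n) ((norm x)\<^sup>2)) powr q
          = E * (radial \<kappa> CARD('n) ((norm x)\<^sup>2) * exp (- (\<kappa> * r))) powr q"
        unfolding E_def powr_mult[symmetric] by (simp add: mult_ac)
      moreover have "(t, x) \<in> cone_slab l R \<tau> \<longleftrightarrow> norm x \<le> r"
        using True by (simp add: cone_slab_def r_def A_def b_def)
      ultimately show "ennreal (G \<tau> (t, x)) = ennreal E * (ennreal ((radial \<kappa> CARD('n) ((norm x)\<^sup>2) * exp (- (\<kappa> * r))) powr q) * indicator (cball (0::real^'n) r) x)"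
        by (simp add: G_def A_def b_def indicator_def ennreal_mult E_def)
    qed
    also have "\<dots> = ennreal E * (\<integral>\<^sup>+x\<in>cball (0::real^'n) r. ennreal ((radial \<kappa> CARD('n) ((norm x)\<^sup>2) * exp (- (\<kappa> * r))) powr q) \<partial>lborel)"
      by (rule nn_integral_cmult) measurable
    also have "\<dots> \<le> ennreal E * ennreal (D * (1 + r) powr e)"
      by (intro mult_left_mono D(2) r0) auto
    also have "\<dots> = ennreal (E * D * (1 + r) powr e)"
      using D(1) by (simp add: E_def ennreal_mult[symmetric] mult.assoc)
    also have "\<dots> \<le> ennreal (E * D * ((1 powr e + c2 powr e) * \<tau> powr (b * e)))"
      using pc D(1) by (intro ennreal_leI mult_left_mono) (auto simp: E_def)
    finally show ?thesis using True by (simp add: C_def mult.assoc)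
  next
    case False
    then have "G \<tau> (t, x) = 0" for x by (auto simp: G_def cone_slab_def)
    then show ?thesis by simp
  qed
  have "integrable lebesgue (G \<tau>) \<and> (\<integral>z. G \<tau> z \<partial>lebesgue) \<le> C * \<tau> powr (1 + (1 + l) * e)"
    if \<tau>: "1 \<le> \<tau>" for \<tau>
  proof -
    have [measurable]: "(radial \<kappa> CARD('n)) \<in> borel_measurable borel"
      by (rule smooth_borel_measurable[OF smooth_on_radial[OF n]])
    have Gm: "G \<tau> \<in> borel_measurable borel" unfolding G_def by measurable
    then have Gm': "(\<lambda>z. ennreal (G \<tau> z)) \<in> borel_measurable (lborel \<Otimes>\<^sub>M lborel)"
      by (simp add: lborel_prod)
    have "(\<integral>\<^sup>+z. ennreal (G \<tau> z) \<partial>lborel) = (\<integral>\<^sup>+t. \<integral>\<^sup>+x. ennreal (G \<tau> (t, x)) \<partial>lborel \<partial>lborel)"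
      using lborel.nn_integral_fst[OF Gm'] by (simp add: lborel_prod)
    also have "\<dots> \<le> (\<integral>\<^sup>+t. ennreal (C * \<tau> powr (b * e)) * indicator {\<tau>..2 * \<tau>} t \<partial>lborel)"
      by (intro nn_integral_mono inner \<tau>)
    also have "\<dots> = ennreal (C * \<tau> powr (b * e)) * ennreal \<tau>"
      using \<tau> by (simp add: nn_integral_cmult)
    also have "\<dots> = ennreal (C * (\<tau> powr 1 * \<tau> powr (b * e)))"
      using \<tau> C by (simp add: ennreal_mult[symmetric] mult_ac)
    also have "\<tau> powr 1 * \<tau> powr (b * e) = \<tau> powr (1 + (1 + l) * e)"
      unfolding b_def powr_add[symmetric] ..
    finally show ?thesis
      using integral_le_of_nn_integral_lborel[OF Gm, of "C * \<tau> powr (1 + (1 + l) * e)"] C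
      by (auto simp: G_def)
  qed
  then show ?thesis using C unfolding e_def by blast
qed

lemma step_profile:
  obtains e e1 e2 :: "real \<Rightarrow> real" and M :: real
  where "smooth_on UNIV e" "\<And>y. (e has_real_derivative e1 y) (at y)"
    "\<And>y. (e1 has_real_derivative e2 y) (at y)"
    "\<And>y. 0 \<le> e y" "\<And>y. y \<le> 1 \<Longrightarrow> e y = 1" "\<And>y. 2 \<le> y \<Longrightarrow> e y = 0"
    "\<And>y. y < 1 \<or> 2 < y \<Longrightarrow> e1 y = 0 \<and> e2 y = 0"
    "0 \<le> M" "\<And>y. \<bar>e1 y\<bar> \<le> M" "\<And>y. \<bar>e2 y\<bar> \<le> M"
proof -
  define e where "e = (\<lambda>y::real. smooth_step ((-1) * y + 2))"
  have es: "smooth_on UNIV e" unfolding e_def by (rule smooth_on_affine_compose[OF smooth_step_smooth])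
  obtain e1 where e1: "\<And>s. (e has_real_derivative e1 s) (at s)" "smooth_on UNIV e1"
    using smooth_onE[OF es] by auto
  obtain e2 where e2: "\<And>s. (e1 has_real_derivative e2 s) (at s)" "smooth_on UNIV e2"
    using smooth_onE[OF e1(2)] by auto
  have e_lo: "e y = 1" if "y \<le> 1" for y using that by (simp add: e_def)
  have e_hi: "e y = 0" if "2 \<le> y" for y using that by (simp add: e_def)
  have e1z: "e1 y = 0" if "y < 1 \<or> 2 < y" for y
  proof (cases "y < 1")
    case True
    have "((\<lambda>y. e y - 1) has_real_derivative e1 y) (at y)" by (auto intro!: derivative_eq_intros e1(1))
    then show ?thesis
      by (rule derivative_zero_on_open[of "{..<1}" "\<lambda>y. e y - 1", rotated 3]) (use True e_lo in auto)
  next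
    case False
    then show ?thesis
      by (intro derivative_zero_on_open[of "{2<..}" e, OF _ _ _ e1(1)]) (use that e_hi in auto)
  qed
  have e2z: "e2 y = 0" if "y < 1 \<or> 2 < y" for y
    by (rule derivative_zero_on_open[of "{..<1} \<union> {2<..}" e1, OF _ _ _ e2(1)]) (use that e1z in auto)
  obtain M1 where M1: "0 \<le> M1" "\<And>y. \<bar>e1 y\<bar> \<le> M1"
    using bounded_of_bounded_support[OF smooth_on_continuous[OF e1(2)], of 1 2] e1z by auto
  obtain M2 where M2: "0 \<le> M2" "\<And>y. \<bar>e2 y\<bar> \<le> M2"
    using bounded_of_bounded_support[OF smooth_on_continuous[OF e2(2)], of 1 2] e2z by auto
  show thesis
  proof (rule that[of e e1 e2 "M1 + M2"])
    show "\<bar>e1 y\<bar> \<le> M1 + M2" for y using M1(2)[of y] M2(1) by linarith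
    show "\<bar>e2 y\<bar> \<le> M1 + M2" for y using M2(2)[of y] M1(1) by linarith
    show "0 \<le> e y" for y by (simp add: e_def)
  qed (use es e1 e2 e_lo e_hi e1z e2z M1 M2 in auto)
qed

text \<open>The undifferentiated cutoff multiplies the adjoint equation of L \<Phi> and contributes
  nothing, so only derivatives of the cutoff remain, all on the slab. The integral of |w|^p against
  the test function is nonnegative and dropped. The parameter \<open>s\<close> is the free weight in
  Young's inequality, to be chosen after both integrals are bounded.\<close>

lemma (in weak_sol) data_lower_bound:
  assumes \<beta>: "0 \<le> \<beta>" and \<tau>: "1 \<le> \<tau>" "ereal (3 * \<tau>) < T" and s: "0 < s"
    and \<kappa>: "0 < \<kappa>" and C: "0 \<le> C" and L: "smooth_on {-1<..} L"
    and Ld: "\<And>t. -1 < t \<Longrightarrow> (L has_real_derivative L1 t) (at t)"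
    "\<And>t. -1 < t \<Longrightarrow> (L1 has_real_derivative L2 t) (at t)"
    and Lpos: "\<And>t. 0 \<le> t \<Longrightarrow> 0 < L t"
    and ode: "\<And>t. -1 < t \<Longrightarrow> L2 t - \<kappa>\<^sup>2 * (1 + t) powr (2 * l) * L t
        - (\<beta> / (1 + t) * L1 t - \<beta> / (1 + t)\<^sup>2 * L t) + \<mu>\<^sup>2 / (1 + t)\<^sup>2 * L t = 0"
    and Lb: "\<And>t. 0 \<le> t \<Longrightarrow> \<bar>L t\<bar> \<le> C * (1 + t) powr ((\<beta> - l) / 2) * exp (- (\<kappa> * (((1 + t) powr (1 + l) - 1) / (1 + l))))"
    "\<And>t. 0 \<le> t \<Longrightarrow> \<bar>L1 t\<bar> \<le> C * (1 + t) powr ((\<beta> + l) / 2) * exp (- (\<kappa> * (((1 + t) powr (1 + l) - 1) / (1 + l))))"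
    and e: "smooth_on UNIV e" "\<And>y. (e has_real_derivative e1 y) (at y)"
    "\<And>y. (e1 has_real_derivative e2 y) (at y)"
    "\<And>y. 0 \<le> e y" "\<And>y. y \<le> 1 \<Longrightarrow> e y = 1" "\<And>y. 2 \<le> y \<Longrightarrow> e y = 0"
    "\<And>y. y < 1 \<or> 2 < y \<Longrightarrow> e1 y = 0 \<and> e2 y = 0"
    "0 \<le> M" "\<And>y. \<bar>e1 y\<bar> \<le> M" "\<And>y. \<bar>e2 y\<bar> \<le> M"
    and K: "K = (5 + 3 * \<beta>) * M * C * (1 powr ((\<beta> + l) / 2) + 3 powr ((\<beta> + l) / 2))"
    and G: "integrable lebesgue (\<lambda>z :: real \<times> (real^'n). indicator (cone_slab l R\<^sub>0 \<tau>) z *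
      (exp (- (\<kappa> * (((1 + fst z) powr (1 + l) - 1) / (1 + l)))) * \<Phi> \<kappa> (snd z)) powr (p / (p - 1)))"
      "(\<integral>z. indicator (cone_slab l R\<^sub>0 \<tau>) (z :: real \<times> (real^'n)) *
      (exp (- (\<kappa> * (((1 + fst z) powr (1 + l) - 1) / (1 + l)))) * \<Phi> \<kappa> (snd z)) powr (p / (p - 1)) \<partial>lebesgue) \<le> Y"
  shows "\<epsilon> * (\<integral>x. (g x * L 0 + f x * (\<beta> * L 0 - L1 0)) * \<Phi> \<kappa> x \<partial>lebesgue)
    \<le> s powr p * (\<integral>z. \<bar>W z\<bar> powr p * indicator (slab \<tau>) z \<partial>lebesgue)
      + s powr (- (p / (p - 1))) * ((K * \<tau> powr ((\<beta> + l) / 2 - 1)) powr (p / (p - 1)) * Y)"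
proof -
  define q where "q = p / (p - 1)"
  have q: "1 < q" "1 / p + 1 / q = 1" using p by (auto simp: q_def field_simps)
  have t0: "0 < \<tau>" using \<tau> by simp
  define E where "E = (\<lambda>t. exp (- (\<kappa> * (((1 + t) powr (1 + l) - 1) / (1 + l)))))"
  have E0: "0 \<le> E t" for t by (simp add: E_def)
  \<comment> \<open>\<open>L\<close> is controlled only for t > -1. The step rises from t = -1/2 to
    t = -1/4 and is 1 on a neighbourhood of all t >= 0, so neither values nor derivatives at these
    times change.\<close>
  define a where "a = (\<lambda>t. smooth_step (4 * t + 2) * e (1 / \<tau> * t + 0) * L t)"
  have a_lo: "a t = 0" if "t \<le> -1/2" for t using that by (simp add: a_def)
  have as: "smooth_on UNIV a"
  proof -
    have 1: "smooth_on {-1<..} a" unfolding a_def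
      by (intro smooth_on_mult L smooth_on_subset[OF smooth_on_affine_compose]
          smooth_step_smooth e(1)) auto
    have 2: "smooth_on {..<-1/2} a"
      by (rule smooth_on_cong[of _ "\<lambda>t. 0"]) (use a_lo in auto)
    have "{-1<..} \<union> {..<-1/2} = (UNIV :: real set)" by auto
    then show ?thesis using smooth_on_union[OF _ _ 1 2] by simp
  qed
  obtain a1 where a1: "\<And>t. (a has_real_derivative a1 t) (at t)" "smooth_on UNIV a1"
    using smooth_onE[OF as] by auto
  obtain a2 where a2: "\<And>t. (a1 has_real_derivative a2 t) (at t)" "smooth_on UNIV a2"
    using smooth_onE[OF a1(2)] by auto
  define c where "c = (\<lambda>t. e (1 / \<tau> * t + 0))"
  define c1 where "c1 = (\<lambda>t. e1 (1 / \<tau> * t + 0) / \<tau>)"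
  define c2 where "c2 = (\<lambda>t. e2 (1 / \<tau> * t + 0) / \<tau>\<^sup>2)"
  have lin: "((\<lambda>t. 1 / \<tau> * t + 0) has_real_derivative 1 / \<tau>) (at t)" for t
    using t0 by (auto intro!: derivative_eq_intros)
  have cd: "(c has_real_derivative c1 t) (at t)" for t
    unfolding c_def c1_def by (rule DERIV_cong[OF DERIV_chain2[OF e(2) lin]]) simp
  have c1d: "(c1 has_real_derivative c2 t) (at t)" for t
    unfolding c1_def c2_def
    by (rule DERIV_cong[OF DERIV_cdivide[OF DERIV_chain2[OF e(3) lin]]])
      (use t0 in \<open>simp add: power2_eq_square\<close>)
  have aeq: "a t = c t * L t" if "-1/4 < t" for t
    using that by (simp add: a_def c_def)
  have a1eq: "a1 t = c1 t * L t + L1 t * c t" if t: "-1/4 < t" for t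
  proof (rule DERIV_unique[OF a1(1)])
    have "((\<lambda>t. c t * L t) has_real_derivative c1 t * L t + L1 t * c t) (at t)"
      by (rule DERIV_mult[OF cd Ld(1)]) (use t in simp)
    then show "(a has_real_derivative c1 t * L t + L1 t * c t) (at t)"
      by (rule has_field_derivative_transform_within_open[where S="{-1/4<..}"]) (use t aeq in auto)
  qed
  have a2eq: "a2 t = (c2 t * L t + L1 t * c1 t) + (L2 t * c t + c1 t * L1 t)" if t: "-1/4 < t" for t
  proof (rule DERIV_unique[OF a2(1)])
    have "((\<lambda>t. c1 t * L t + L1 t * c t) has_real_derivative
        (c2 t * L t + L1 t * c1 t) + (L2 t * c t + c1 t * L1 t)) (at t)"
      by (intro DERIV_add DERIV_mult c1d cd Ld) (use t in simp_all)
    then show "(a1 has_real_derivative (c2 t * L t + L1 t * c1 t) + (L2 t * c t + c1 t * L1 t)) (at t)"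
      by (rule has_field_derivative_transform_within_open[where S="{-1/4<..}"]) (use t a1eq in auto)
  qed
  have a_hi: "a t = 0" if "2 * \<tau> \<le> t" for t
  proof -
    have "2 \<le> 1 / \<tau> * t + 0" using that t0 by (simp add: field_simps)
    then show ?thesis by (simp add: a_def e(6))
  qed
  have c0: "c 0 = 1" "c1 0 = 0" using e(5)[of 0] e(7)[of 0] by (simp_all add: c_def c1_def)
  have a00: "a 0 = L 0" "a1 0 = L1 0" using aeq[of 0] a1eq[of 0] c0 by auto
  define m where "m = adjoint \<kappa> a a1 a2"
  \<comment> \<open>Leibniz' rule: the part with the undifferentiated cutoff is \<open>c t\<close>
    times the equation satisfied by \<open>L\<close>.\<close>
  have meq: "m t = c2 t * L t + 2 * c1 t * L1 t - \<beta> / (1 + t) * (c1 t * L t)" if t: "0 \<le> t" for t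
  proof -
    have "m t = c t * (L2 t - \<kappa>\<^sup>2 * (1 + t) powr (2 * l) * L t
        - (\<beta> / (1 + t) * L1 t - \<beta> / (1 + t)\<^sup>2 * L t) + \<mu>\<^sup>2 / (1 + t)\<^sup>2 * L t)
        + (c2 t * L t + 2 * c1 t * L1 t - \<beta> / (1 + t) * (c1 t * L t))"
      using t unfolding m_def adjoint_def by (simp add: aeq a1eq a2eq algebra_simps)
    then show ?thesis using ode[of t] t by simp
  qed
  have m_out: "m t = 0" if t: "0 \<le> t" "t < \<tau> \<or> 2 * \<tau> < t" for t
  proof -
    have "1 / \<tau> * t + 0 < 1 \<or> 2 < 1 / \<tau> * t + 0" using that t0 by (auto simp: field_simps)
    then have "c1 t = 0" "c2 t = 0" using e(7) by (auto simp: c1_def c2_def)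
    then show ?thesis using meq[OF t(1)] by simp
  qed
  define N where "N = K * \<tau> powr ((\<beta> + l) / 2 - 1)"
  have K0: "0 \<le> K" unfolding K using \<beta> e(8) C by (intro mult_nonneg_nonneg) auto
  have N0: "0 \<le> N" using K0 by (simp add: N_def)
  have mb: "\<bar>m t\<bar> \<le> N * E t" if t: "\<tau> \<le> t" "t \<le> 2 * \<tau>" for t
  proof -
    have t1: "0 \<le> t" "0 < 1 + t" using t t0 by auto
    define H where "H = C * (1 + t) powr ((\<beta> + l) / 2) * E t"
    have H: "0 \<le> H" using C by (simp add: H_def E_def)
    have c1b: "\<bar>c1 t\<bar> \<le> M / \<tau>" unfolding c1_def using e(9) t0 by (simp add: divide_right_mono)
    have c2b: "\<bar>c2 t\<bar> \<le> M / \<tau> * (1 / \<tau>)"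
      unfolding c2_def using e(10) t0 by (simp add: divide_right_mono power2_eq_square)
    have L1b: "\<bar>L1 t\<bar> \<le> H" using Lb(2)[OF t1(1)] by (simp add: H_def E_def)
    \<comment> \<open>Because l > -1, dividing the bound of L by 1 + t brings it below that of its
      derivative. On the slab 1 / \<tau> is at most 3 / (1 + t), so all remaining terms are of size
      H / \<tau>.\<close>
    have LH: "\<bar>L t\<bar> / (1 + t) \<le> H"
    proof -
      have "\<bar>L t\<bar> / (1 + t) \<le> C * (1 + t) powr ((\<beta> - l) / 2) * E t / (1 + t)"
        using Lb(1)[OF t1(1)] t1 by (intro divide_right_mono) (auto simp: E_def)
      also have "\<dots> = C * (1 + t) powr ((\<beta> - l) / 2 - 1) * E t"
        using t1 by (simp add: powr_diff)
      also have "\<dots> \<le> C * (1 + t) powr ((\<beta> + l) / 2) * E t"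
        using l t1 C E0[of t] by (intro mult_right_mono mult_left_mono powr_mono) (auto simp: field_simps)
      finally show ?thesis by (simp add: H_def)
    qed
    have tinv: "1 / \<tau> \<le> 3 / (1 + t)" using t \<tau>(1) t1 by (simp add: field_simps)
    have "\<bar>c2 t * L t\<bar> \<le> M / \<tau> * (3 * H)"
    proof -
      have "\<bar>c2 t * L t\<bar> \<le> M / \<tau> * (1 / \<tau>) * \<bar>L t\<bar>"
        unfolding abs_mult using c2b by (intro mult_right_mono) auto
      also have "\<dots> \<le> M / \<tau> * (3 / (1 + t)) * \<bar>L t\<bar>"
        using tinv e(8) t0 by (intro mult_right_mono mult_left_mono) auto
      also have "\<dots> = M / \<tau> * (3 * (\<bar>L t\<bar> / (1 + t)))" by simp
      also have "\<dots> \<le> M / \<tau> * (3 * H)" using LH e(8) t0 by (intro mult_left_mono) auto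
      finally show ?thesis .
    qed
    moreover have "\<bar>2 * c1 t * L1 t\<bar> \<le> M / \<tau> * (2 * H)"
    proof -
      have "\<bar>c1 t\<bar> * \<bar>L1 t\<bar> \<le> M / \<tau> * H" using c1b L1b e(8) t0 by (intro mult_mono) auto
      then have "2 * (\<bar>c1 t\<bar> * \<bar>L1 t\<bar>) \<le> 2 * (M / \<tau> * H)" by linarith
      then show ?thesis by (simp add: abs_mult mult_ac)
    qed
    moreover have "\<bar>\<beta> / (1 + t) * (c1 t * L t)\<bar> \<le> M / \<tau> * (\<beta> * H)"
    proof -
      have "\<bar>\<beta> / (1 + t) * (c1 t * L t)\<bar> = \<bar>c1 t\<bar> * (\<beta> * (\<bar>L t\<bar> / (1 + t)))"
        using \<beta> t1 by (simp add: abs_mult)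
      also have "\<dots> \<le> M / \<tau> * (\<beta> * H)"
        using c1b LH \<beta> e(8) t0 H t1 by (intro mult_mono) auto
      finally show ?thesis .
    qed
    ultimately have "\<bar>m t\<bar> \<le> M / \<tau> * (3 * H) + M / \<tau> * (2 * H) + M / \<tau> * (\<beta> * H)"
      unfolding meq[OF t1(1)] by (smt (verit))
    also have "\<dots> = M / \<tau> * ((5 + \<beta>) * H)" by (simp add: algebra_simps add_divide_distrib)
    also have "\<dots> \<le> M / \<tau> * ((5 + 3 * \<beta>) * H)"
      using H \<beta> e(8) t0 by (intro mult_left_mono mult_right_mono) auto
    also have "H \<le> C * ((1 powr ((\<beta> + l) / 2) + 3 powr ((\<beta> + l) / 2)) * \<tau> powr ((\<beta> + l) / 2)) * E t"
      unfolding H_def using t \<tau>(1) C E0[of t]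
      by (intro mult_right_mono mult_left_mono powr_comparable) auto
    then have "M / \<tau> * ((5 + 3 * \<beta>) * H) \<le> M / \<tau> * ((5 + 3 * \<beta>) * (C * ((1 powr ((\<beta> + l) / 2) + 3 powr ((\<beta> + l) / 2)) * \<tau> powr ((\<beta> + l) / 2)) * E t))"
      using \<beta> e(8) t0 by (intro mult_left_mono) auto
    also have "\<dots> = K * (\<tau> powr ((\<beta> + l) / 2) / \<tau>) * E t" unfolding K by simp
    also have "\<tau> powr ((\<beta> + l) / 2) / \<tau> = \<tau> powr ((\<beta> + l) / 2 - 1)" using t0 by (simp add: powr_diff)
    finally show ?thesis by (simp add: N_def)
  qed
  have n1: "1 \<le> CARD('n)" by simp
  have \<Phi>0: "0 < \<Phi> \<kappa> x" for x by (rule radial_pos[OF n1]) simp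
  have a0: "0 \<le> a t" if "0 \<le> t" for t
    using that Lpos[OF that] e(4) by (simp add: aeq c_def)
  have \<tau>2: "0 \<le> 2 * \<tau>" "ereal (2 * \<tau>) < T"
    using \<tau> t0 by (auto intro: le_less_trans[of _ "ereal (3 * \<tau>)"])
  define d where "d = (\<integral>x. (g x * L 0 + f x * (\<beta> * L 0 - L1 0)) * \<Phi> \<kappa> x \<partial>lebesgue)"
  have id: "(\<integral>z. W z * (m (fst z) * \<Phi> \<kappa> (snd z)) \<partial>lebesgue)
      = (\<integral>z. \<bar>W z\<bar> powr p * (a (fst z) * \<Phi> \<kappa> (snd z)) \<partial>lebesgue) + \<epsilon> * d"
    unfolding m_def d_def a00[symmetric]
    by (rule separated_identity[OF as a1(1) a2(1) a_lo a_hi \<tau>2])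
  have nn: "0 \<le> (\<integral>z. \<bar>W z\<bar> powr p * (a (fst z) * \<Phi> \<kappa> (snd z)) \<partial>lebesgue)"
  proof (rule integral_nonneg_AE)
    show "AE z in lebesgue. 0 \<le> \<bar>W z\<bar> powr p * (a (fst z) * \<Phi> \<kappa> (snd z))"
      using W_supp
    proof eventually_elim
      fix z assume *: "W z \<noteq> 0 \<longrightarrow> 0 \<le> fst z \<and> ereal (fst z) < T \<and> norm (snd z) \<le> R\<^sub>0 + propagation l (fst z)"
      show "0 \<le> \<bar>W z\<bar> powr p * (a (fst z) * \<Phi> \<kappa> (snd z))"
        using * a0[of "fst z"] \<Phi>0[of "snd z"] by (cases "W z = 0") auto
    qed
  qed
  have a1z: "a1 t = 0" if "2 * \<tau> < t" for t
    by (rule derivative_zero_on_open[of "{2 * \<tau><..}" a, OF _ _ _ a1(1)]) (use that a_hi in auto)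
  have a2z: "a2 t = 0" if "2 * \<tau> < t" for t
    by (rule derivative_zero_on_open[of "{2 * \<tau><..}" a1, OF _ _ _ a2(1)]) (use that a1z in auto)
  have mz: "m t = 0" if "2 * \<tau> < t" for t using that a1z a2z a_hi by (simp add: m_def adjoint_def)
  have [measurable]: "radial \<kappa> CARD('n) \<in> borel_measurable borel"
    by (rule smooth_borel_measurable[OF smooth_on_radial[OF n1]])
  have [measurable]: "a \<in> borel_measurable borel" "a1 \<in> borel_measurable borel" "a2 \<in> borel_measurable borel"
    using as a1(2) a2(2) by (auto intro: smooth_borel_measurable)
  have [measurable]: "m \<in> borel_measurable borel" unfolding m_def adjoint_def[abs_def] by measurable
  define F where "F = (\<lambda>z :: real \<times> (real^'n). indicator (cone_slab l R\<^sub>0 \<tau>) z * (E (fst z) * \<Phi> \<kappa> (snd z)) powr q)"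
  have Fi: "integrable lebesgue F" and FY: "(\<integral>z. F z \<partial>lebesgue) \<le> Y"
    using G by (simp_all add: F_def E_def q_def)
  have i1: "integrable lebesgue (\<lambda>z. W z * (m (fst z) * \<Phi> \<kappa> (snd z)))"
  proof -
    have "compact (region (2 * \<tau>))" unfolding region_def by (intro compact_Times) auto
    moreover have "continuous_on UNIV (\<lambda>z :: real \<times> (real^'n). \<Phi> \<kappa> (snd z))"
      by (rule continuous_on_compose2[OF smooth_on_continuous[OF smooth_on_radial[OF n1]]])
        (auto intro!: continuous_intros)
    ultimately have "compact ((\<lambda>z. \<Phi> \<kappa> (snd z)) ` region (2 * \<tau>))"
      by (intro compact_continuous_image) (auto intro: continuous_on_subset)
    then obtain B where B: "0 < B" "\<And>z. z \<in> region (2 * \<tau>) \<Longrightarrow> \<bar>\<Phi> \<kappa> (snd z)\<bar> \<le> B"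
      by (force dest!: compact_imp_bounded simp: bounded_pos)
    show ?thesis
    proof (rule W_bounded_integrable(1)[OF \<tau>2, of _ "N * B"])
      fix z assume z: "z \<in> region (2 * \<tau>)"
      then have t: "0 \<le> fst z" "fst z \<le> 2 * \<tau>" by (auto simp: region_def)
      have "E (fst z) \<le> 1"
      proof -
        have "0 \<le> ((1 + fst z) powr (1 + l) - 1) / (1 + l)"
          using propagation_nonneg[OF l t(1)] propagation_eq[OF l t(1)] by simp
        from mult_nonneg_nonneg[OF less_imp_le[OF \<kappa>] this] show ?thesis by (simp add: E_def)
      qed
      then have "N * E (fst z) \<le> N" using N0 by (simp add: mult_left_le)
      then have "\<bar>m (fst z)\<bar> \<le> N"
        using mb[of "fst z"] m_out[of "fst z"] t N0 by (cases "\<tau> \<le> fst z") auto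
      then show "\<bar>m (fst z) * \<Phi> \<kappa> (snd z)\<bar> \<le> N * B"
        unfolding abs_mult using B(2)[OF z] N0 by (intro mult_mono) auto
    qed (use mz in auto)
  qed
  have "\<epsilon> * d \<le> (\<integral>z. W z * (m (fst z) * \<Phi> \<kappa> (snd z)) \<partial>lebesgue)" using id nn by linarith
  also have "\<dots> \<le> (\<integral>z. s powr p * (\<bar>W z\<bar> powr p * indicator (slab \<tau>) z) + s powr (- q) * N powr q * F z \<partial>lebesgue)"
  proof (rule integral_mono_AE[OF i1])
    show "integrable lebesgue (\<lambda>z. s powr p * (\<bar>W z\<bar> powr p * indicator (slab \<tau>) z) + s powr (- q) * N powr q * F z)"
      by (intro Bochner_Integration.integrable_add integrable_mult_right Fi slab_integrable \<tau>)
    show "AE z in lebesgue. W z * (m (fst z) * \<Phi> \<kappa> (snd z))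
        \<le> s powr p * (\<bar>W z\<bar> powr p * indicator (slab \<tau>) z) + s powr (- q) * N powr q * F z"
      using W_supp
    proof eventually_elim
      fix z assume *: "W z \<noteq> 0 \<longrightarrow> 0 \<le> fst z \<and> ereal (fst z) < T \<and> norm (snd z) \<le> R\<^sub>0 + propagation l (fst z)"
      show "W z * (m (fst z) * \<Phi> \<kappa> (snd z))
        \<le> s powr p * (\<bar>W z\<bar> powr p * indicator (slab \<tau>) z) + s powr (- q) * N powr q * F z"
      proof (cases "W z \<noteq> 0 \<and> \<tau> \<le> fst z \<and> fst z \<le> 2 * \<tau>")
        case True
        then have z: "0 \<le> fst z" "norm (snd z) \<le> R\<^sub>0 + propagation l (fst z)" using * by auto
        have "z \<in> cone_slab l R\<^sub>0 \<tau>" using True z by (simp add: cone_slab_def propagation_eq[OF l])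
        moreover have "z \<in> slab \<tau>" using True by (cases z) (auto simp: slab_def)
        moreover have "W z * (m (fst z) * \<Phi> \<kappa> (snd z))
            \<le> s powr p * \<bar>W z\<bar> powr p + s powr (- q) * N powr q * (E (fst z) * \<Phi> \<kappa> (snd z)) powr q"
        proof -
          \<comment> \<open>The weights s and 1 / s are distributed over the two factors before
            Young's inequality; the divisors p and q, both larger than 1, are then
            discarded.\<close>
          define v where "v = N * (E (fst z) * \<Phi> \<kappa> (snd z)) / s"
          have v: "0 \<le> v" using N0 E0 \<Phi>0[of "snd z"] s by (simp add: v_def)
          have "W z * (m (fst z) * \<Phi> \<kappa> (snd z)) \<le> \<bar>W z\<bar> * (\<bar>m (fst z)\<bar> * \<Phi> \<kappa> (snd z))"
            using \<Phi>0[of "snd z"] abs_ge_self[of "W z * (m (fst z) * \<Phi> \<kappa> (snd z))"] by (simp add: abs_mult)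
          also have "\<dots> \<le> \<bar>W z\<bar> * (N * E (fst z) * \<Phi> \<kappa> (snd z))"
            using mb[of "fst z"] True \<Phi>0[of "snd z"] by (intro mult_left_mono mult_right_mono) auto
          also have "\<dots> = (s * \<bar>W z\<bar>) * v" using s by (simp add: v_def)
          also have "\<dots> \<le> (s * \<bar>W z\<bar>) powr p / p + v powr q / q"
            using p q v s by (intro Youngs_inequality) auto
          also have "\<dots> \<le> (s * \<bar>W z\<bar>) powr p + v powr q"
            using p q by (intro add_mono) (auto simp: divide_le_eq mult_left_le mult_le_cancel_left1)
          also have "v powr q = s powr (- q) * N powr q * (E (fst z) * \<Phi> \<kappa> (snd z)) powr q"
            unfolding v_def using s N0 E0 \<Phi>0[of "snd z"]
            by (simp add: powr_mult powr_minus inverse_powr divide_inverse mult_ac)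
          finally show ?thesis by (simp add: powr_mult)
        qed
        ultimately show ?thesis by (simp add: F_def)
      next
        case False
        then have "W z = 0 \<or> m (fst z) = 0" using * m_out[of "fst z"] by auto
        then have z: "W z * (m (fst z) * \<Phi> \<kappa> (snd z)) = 0" by auto
        show ?thesis unfolding z F_def by (intro add_nonneg_nonneg mult_nonneg_nonneg) auto
      qed
    qed
  qed
  also have "\<dots> = s powr p * (\<integral>z. \<bar>W z\<bar> powr p * indicator (slab \<tau>) z \<partial>lebesgue)
      + s powr (- q) * N powr q * (\<integral>z. F z \<partial>lebesgue)"
    using slab_integrable[OF \<tau>] Fi by simp
  also have "\<dots> \<le> s powr p * (\<integral>z. \<bar>W z\<bar> powr p * indicator (slab \<tau>) z \<partial>lebesgue)
      + s powr (- q) * N powr q * Y"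
    using FY by (intro add_left_mono mult_left_mono) auto
  finally show ?thesis by (simp add: d_def q_def N_def mult.assoc)
qed

section \<open>The lifespan estimate\<close>

text \<open>The choice of s with s^p X = u cancels half of the left side. The second term then
  bounds u by a multiple of Y, and the power p - 1 clears the exponents.\<close>

lemma absorb_parameter:
  fixes u X Y p :: real
  assumes p: "1 < p" and pos: "0 < u" "0 < X" "0 < Y"
    and le: "\<And>s. 0 < s \<Longrightarrow> 2 * u \<le> s powr p * X + s powr (- (p / (p - 1))) * Y"
  shows "u powr p \<le> X * Y powr (p - 1)"
proof -
  define s where "s = (u / X) powr (1 / p)"
  have s: "0 < s" using pos by (simp add: s_def)
  have "s powr p = u / X" using p pos by (simp add: s_def powr_powr)
  moreover have "s powr (- (p / (p - 1))) = (u / X) powr (- 1 / (p - 1))"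
    using p by (simp add: s_def powr_powr)
  ultimately have "u \<le> (u / X) powr (- 1 / (p - 1)) * Y" using le[OF s] pos by simp
  then have "u powr (p - 1) \<le> ((u / X) powr (- 1 / (p - 1)) * Y) powr (p - 1)"
    using p pos by (intro powr_mono2) auto
  also have "\<dots> = (u / X) powr (- 1) * Y powr (p - 1)"
    using p by (simp add: powr_mult powr_powr)
  also have "(u / X) powr (- 1) = X / u" using pos by (simp add: powr_neg_one)
  finally have "u powr (p - 1) * u \<le> X * Y powr (p - 1)" using pos by (simp add: field_simps)
  moreover have "u powr (p - 1) * u = u powr p" using pos by (simp add: powr_diff)
  ultimately show ?thesis by simp
qed

lemma Cc_infty_continuous: "f \<in> Cc_infty \<Longrightarrow> continuous_on UNIV f"
  unfolding Cc_infty_def using Ck.simps(1) by blast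

text \<open>Power counting. The first summand is the exponent of the energy on the slab; the factor
  p - 1 multiplies the exponent of the weight's amplitude to the power q plus that of the moment.
  The value \<alpha> = \<beta> (p - 1) / 2 arises here.\<close>

lemma lifespan_exponent:
  fixes l \<beta> p n :: real
  assumes "-1 < l" "1 < p"
  shows "(1 + n * (1 + l) - 2 * (p / (p - 1))) + (p - 1) * (p / (p - 1) * ((\<beta> + l) / 2 - 1)
      + (1 + (1 + l) * ((n - 1) * (1 - p / (p - 1) / 2))))
    = (1 + l) * gamma_poly (\<beta> / 2 * (p - 1)) n l p / (2 * (p - 1))"
proof -
  have "p - 1 \<noteq> 0" "1 + l \<noteq> 0" using assms by auto
  then show ?thesis unfolding gamma_poly_def
    by (simp add: divide_simps) (simp add: algebra_simps power2_eq_square)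
qed

text \<open>For every s > 0 the data term is bounded by s^p X + s^(-q) Y with X and Y powers of
  \<tau>; eliminating s leaves no trace of w. Sign and nontriviality of the data enter through the
  positivity of \<open>d\<close>.\<close>

lemma lifespan_inequality:
  fixes f g :: "real^'n \<Rightarrow> real" and l \<beta> \<mu> p R\<^sub>0 :: real
  assumes l: "-1 < l" "l < 0" and \<beta>: "0 \<le> \<beta>" and p: "1 < p"
    and \<delta>: "(1 - \<beta>)\<^sup>2 - 4 * \<mu>\<^sup>2 < 0"
    and fg: "f \<in> Cc_infty" "g \<in> Cc_infty" "\<And>x. 0 \<le> f x" "\<And>x. 0 \<le> g x" "\<exists>x. f x \<noteq> 0 \<or> g x \<noteq> 0"
    and R: "0 < R\<^sub>0" and supp: "tsupport f \<union> tsupport g \<subseteq> cball 0 R\<^sub>0"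
  shows "\<exists>C>0. \<forall>\<epsilon> T w \<tau>. 0 < \<epsilon> \<and> weak_solution l \<beta> \<mu> p f g \<epsilon> R\<^sub>0 T w \<and> 1 \<le> \<tau> \<and> ereal (3 * \<tau>) < T \<longrightarrow>
    \<epsilon> powr p \<le> C * \<tau> powr ((1 + l) * gamma_poly (\<beta> / 2 * (p - 1)) (real CARD('n)) l p / (2 * (p - 1)))"
proof -
  define q where "q = p / (p - 1)"
  have q: "0 < q" using p by (simp add: q_def)
  obtain \<kappa> C L L1 L2 where L: "0 < \<kappa>" "0 \<le> C" "smooth_on {-1<..} L"
    "\<And>t. -1 < t \<Longrightarrow> (L has_real_derivative L1 t) (at t)"
    "\<And>t. -1 < t \<Longrightarrow> (L1 has_real_derivative L2 t) (at t)"
    "\<And>t. 0 \<le> t \<Longrightarrow> 0 < L t" "0 < \<beta> * L 0 - L1 0"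
    "\<And>t. -1 < t \<Longrightarrow> L2 t - \<kappa>\<^sup>2 * (1 + t) powr (2 * l) * L t
        - (\<beta> / (1 + t) * L1 t - \<beta> / (1 + t)\<^sup>2 * L t) + \<mu>\<^sup>2 / (1 + t)\<^sup>2 * L t = 0"
    "\<And>t. 0 \<le> t \<Longrightarrow> \<bar>L t\<bar> \<le> C * (1 + t) powr ((\<beta> - l) / 2) * exp (- (\<kappa> * (((1 + t) powr (1 + l) - 1) / (1 + l))))"
    "\<And>t. 0 \<le> t \<Longrightarrow> \<bar>L1 t\<bar> \<le> C * (1 + t) powr ((\<beta> + l) / 2) * exp (- (\<kappa> * (((1 + t) powr (1 + l) - 1) / (1 + l))))"
    using decaying_time_factor[OF l(1) \<beta> \<delta>] by blast
  obtain e e1 e2 M where e: "smooth_on UNIV e" "\<And>y. (e has_real_derivative e1 y) (at y)"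
    "\<And>y. (e1 has_real_derivative e2 y) (at y)"
    "\<And>y. 0 \<le> e y" "\<And>y. y \<le> 1 \<Longrightarrow> e y = 1" "\<And>y. 2 \<le> y \<Longrightarrow> e y = 0"
    "\<And>y. y < 1 \<or> 2 < y \<Longrightarrow> e1 y = 0 \<and> e2 y = 0"
    "0 \<le> M" "\<And>y. \<bar>e1 y\<bar> \<le> M" "\<And>y. \<bar>e2 y\<bar> \<le> M"
    using step_profile by blast
  define K where "K = (5 + 3 * \<beta>) * M * C * (1 powr ((\<beta> + l) / 2) + 3 powr ((\<beta> + l) / 2))"
  define e\<^sub>Y where "e\<^sub>Y = 1 + (1 + l) * ((real CARD('n) - 1) * (1 - q / 2))"
  obtain D where D: "0 \<le> D"
    "\<And>\<tau>. 1 \<le> \<tau> \<Longrightarrow> integrable lebesgue (\<lambda>z :: real \<times> (real^'n). indicator (cone_slab l R\<^sub>0 \<tau>) z *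
      (exp (- (\<kappa> * (((1 + fst z) powr (1 + l) - 1) / (1 + l)))) * radial \<kappa> CARD('n) ((norm (snd z))\<^sup>2)) powr q)"
    "\<And>\<tau>. 1 \<le> \<tau> \<Longrightarrow> (\<integral>z. indicator (cone_slab l R\<^sub>0 \<tau>) (z :: real \<times> (real^'n)) *
      (exp (- (\<kappa> * (((1 + fst z) powr (1 + l) - 1) / (1 + l)))) * radial \<kappa> CARD('n) ((norm (snd z))\<^sup>2)) powr q \<partial>lebesgue)
      \<le> D * \<tau> powr e\<^sub>Y"
    using cone_slab_integral[OF l R L(1) q, where 'n='n] unfolding e\<^sub>Y_def by blast
  define e\<^sub>X where "e\<^sub>X = 1 + real CARD('n) * (1 + l) - 2 * q"
  obtain B where B: "0 < B" "\<And>\<epsilon> T w \<tau>. weak_sol l \<beta> \<mu> p f g \<epsilon> R\<^sub>0 T w \<Longrightarrow> 1 \<le> \<tau> \<Longrightarrow> ereal (3 * \<tau>) < T \<Longrightarrow>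
    (\<integral>z. \<bar>trunc T w z\<bar> powr p * indicator (slab \<tau>) z \<partial>lebesgue) \<le> B * \<tau> powr e\<^sub>X"
    using energy_upper_bound[OF l(1) \<beta> p R, of \<mu> f g] unfolding e\<^sub>X_def q_def by blast
  define d where "d = (\<integral>x. (g x * L 0 + f x * (\<beta> * L 0 - L1 0)) * radial \<kappa> CARD('n) ((norm x)\<^sup>2) \<partial>lebesgue)"
  have n1: "1 \<le> CARD('n)" by simp
  have d: "0 < d"
  proof -
    obtain x0 where x0: "f x0 \<noteq> 0 \<or> g x0 \<noteq> 0" using fg(5) by blast
    have L0: "0 < L 0" using L(6) by simp
    have rp: "0 < radial \<kappa> CARD('n) ((norm x)\<^sup>2)" for x :: "real^'n" by (rule radial_pos[OF n1]) simp
    show ?thesis unfolding d_def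
    proof (rule integral_pos_of_continuous[where R="R\<^sub>0" and ?x0.0="x0"])
      show "continuous_on UNIV (\<lambda>x. (g x * L 0 + f x * (\<beta> * L 0 - L1 0)) * radial \<kappa> CARD('n) ((norm x)\<^sup>2))"
        by (intro continuous_intros Cc_infty_continuous fg
            continuous_on_compose2[OF smooth_on_continuous[OF smooth_on_radial[OF n1]]]) auto
      show "0 \<le> (g x * L 0 + f x * (\<beta> * L 0 - L1 0)) * radial \<kappa> CARD('n) ((norm x)\<^sup>2)" for x
        using fg(3,4) L0 L(7) rp[of x] by (intro mult_nonneg_nonneg add_nonneg_nonneg) auto
      have "0 < g x0 * L 0 + f x0 * (\<beta> * L 0 - L1 0)"
      proof (cases "f x0 = 0")
        case True
        then have "0 < g x0" using x0 fg(4)[of x0] by simp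
        then show ?thesis using True L0 by simp
      next
        case False
        then have "0 < f x0" using fg(3)[of x0] by simp
        then show ?thesis using L0 L(7) fg(4)[of x0] by (intro add_nonneg_pos) auto
      qed
      then show "(g x0 * L 0 + f x0 * (\<beta> * L 0 - L1 0)) * radial \<kappa> CARD('n) ((norm x0)\<^sup>2) \<noteq> 0"
        using rp[of x0] by simp
      fix x :: "real^'n" assume "R\<^sub>0 < norm x"
      then have "x \<notin> tsupport f" "x \<notin> tsupport g" using supp by auto
      then have "f x = 0" "g x = 0" unfolding tsupport_def
        using closure_subset[of "{x. f x \<noteq> 0}"] closure_subset[of "{x. g x \<noteq> 0}"] by auto
      then show "(g x * L 0 + f x * (\<beta> * L 0 - L1 0)) * radial \<kappa> CARD('n) ((norm x)\<^sup>2) = 0"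
        by simp
    qed
  qed
  \<comment> \<open>The summand 1 keeps the constant positive even if \<open>K\<close> or
    \<open>D\<close> is zero.\<close>
  define B' where "B' = K powr q * D + 1"
  have B': "0 < B'" using D(1) by (simp add: B'_def add_nonneg_pos)
  \<comment> \<open>The half supplies the factor 2 in the premise of
    \<open>absorb_parameter\<close>.\<close>
  define c where "c = d / 2"
  have c: "0 < c" using d by (simp add: c_def)
  define e\<^sub>0 where "e\<^sub>0 = q * ((\<beta> + l) / 2 - 1) + e\<^sub>Y"
  define A where "A = c powr (- p) * (B * B' powr (p - 1))"
  have A: "0 < A" using c B(1) B' by (simp add: A_def)
  have "\<epsilon> powr p \<le> A * \<tau> powr (e\<^sub>X + (p - 1) * e\<^sub>0)"
    if \<epsilon>: "0 < \<epsilon>" and sol: "weak_solution l \<beta> \<mu> p f g \<epsilon> R\<^sub>0 T w" and \<tau>: "1 \<le> \<tau>" "ereal (3 * \<tau>) < T"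
    for \<epsilon> T w \<tau>
  proof -
    interpret weak_sol l \<beta> \<mu> p f g \<epsilon> R\<^sub>0 T w
      by unfold_locales (use l p R sol supp in auto)
    define X where "X = B * \<tau> powr e\<^sub>X"
    define Y where "Y = B' * \<tau> powr e\<^sub>0"
    have "(\<epsilon> * c) powr p \<le> X * Y powr (p - 1)"
    proof (rule absorb_parameter[OF p])
      show "0 < \<epsilon> * c" "0 < X" "0 < Y" using \<epsilon> c B B' \<tau> by (auto simp: X_def Y_def)
      fix s :: real assume s: "0 < s"
      have "\<epsilon> * d \<le> s powr p * (\<integral>z. \<bar>W z\<bar> powr p * indicator (slab \<tau>) z \<partial>lebesgue)
          + s powr (- q) * ((K * \<tau> powr ((\<beta> + l) / 2 - 1)) powr q * (D * \<tau> powr e\<^sub>Y))"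
        unfolding d_def q_def
        by (rule data_lower_bound[OF \<beta> \<tau> s L(1-6) L(8-10) e K_def])
          (use D(2,3)[OF \<tau>(1)] in \<open>simp_all add: q_def\<close>)
      also have "\<dots> \<le> s powr p * X + s powr (- q) * Y"
      proof (intro add_mono mult_left_mono)
        show "(\<integral>z. \<bar>W z\<bar> powr p * indicator (slab \<tau>) z \<partial>lebesgue) \<le> X"
          unfolding X_def using weak_sol_axioms \<tau> by (rule B(2))
        have "(K * \<tau> powr ((\<beta> + l) / 2 - 1)) powr q * (D * \<tau> powr e\<^sub>Y)
            = K powr q * D * \<tau> powr e\<^sub>0"
          by (simp add: powr_mult powr_powr e\<^sub>0_def powr_add mult_ac)
        also have "\<dots> \<le> Y" unfolding Y_def B'_def by (intro mult_right_mono) auto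
        finally show "(K * \<tau> powr ((\<beta> + l) / 2 - 1)) powr q * (D * \<tau> powr e\<^sub>Y) \<le> Y" .
      qed auto
      finally show "2 * (\<epsilon> * c) \<le> s powr p * X + s powr (- (p / (p - 1))) * Y"
        by (simp add: c_def q_def)
    qed
    also have "X * Y powr (p - 1) = B * B' powr (p - 1) * \<tau> powr (e\<^sub>X + (p - 1) * e\<^sub>0)"
      by (simp add: X_def Y_def powr_mult powr_powr powr_add mult_ac)
    finally have "c powr (- p) * (\<epsilon> * c) powr p \<le> c powr (- p) * (B * B' powr (p - 1) * \<tau> powr (e\<^sub>X + (p - 1) * e\<^sub>0))"
      by (rule mult_left_mono) simp
    moreover have "c powr (- p) * (\<epsilon> * c) powr p = \<epsilon> powr p"
      using c by (simp add: powr_mult powr_minus)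
    ultimately show ?thesis by (simp add: A_def mult_ac)
  qed
  moreover have "e\<^sub>X + (p - 1) * e\<^sub>0 = (1 + l) * gamma_poly (\<beta> / 2 * (p - 1)) (real CARD('n)) l p / (2 * (p - 1))"
    using lifespan_exponent[OF l(1) p, of "real CARD('n)" \<beta>]
    by (simp add: e\<^sub>X_def e\<^sub>0_def e\<^sub>Y_def q_def)
  ultimately show ?thesis using A by (intro exI[of _ A]) auto
qed

section \<open>The sign of \<gamma> and the lifespan\<close>

lemma gamma_poly_neg_low:
  fixes l \<beta> p n :: real
  assumes l: "-1 < l" "l < 0" and "0 \<le> \<beta>" "1 < p" "1 \<le> n" and low: "n * (1 + l) + \<beta> \<le> 1"
  shows "gamma_poly (\<beta> / 2 * (p - 1)) n l p < 0"
proof -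
  \<comment> \<open>Since \<alpha> depends on p, it contributes \<beta> / (1 + l) to the coefficient
    of p^2 and - \<beta> / (1 + l) to that of p: n is shifted by \<beta> / (1 + l). In the low case
    the new leading coefficient is nonpositive.\<close>
  have "gamma_poly (\<beta> / 2 * (p - 1)) n l p
      = (n * (1 + l) + \<beta> - 1) / (1 + l) * p\<^sup>2 - (n + 1 + (\<beta> - 3 * l) / (1 + l)) * p - 2"
    using l unfolding gamma_poly_def by (simp add: divide_simps) (simp add: algebra_simps power2_eq_square)
  moreover have "(n * (1 + l) + \<beta> - 1) / (1 + l) * p\<^sup>2 \<le> 0"
    using l low by (intro mult_nonpos_nonneg divide_nonpos_pos) auto
  moreover have "0 \<le> (n + 1 + (\<beta> - 3 * l) / (1 + l)) * p"
    using l assms by (intro mult_nonneg_nonneg add_nonneg_nonneg divide_nonneg_pos) auto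
  ultimately show ?thesis by linarith
qed

text \<open>For N = n + \<beta> / (1 + l), \<gamma> is the quadratic that defines
  \<open>p_Str N l\<close>, and the condition on n and \<beta> says that its leading coefficient is
  positive. Between 0 and its positive root it is negative.\<close>

lemma gamma_poly_neg_subcritical:
  fixes l \<beta> p n :: real
  assumes l: "-1 < l" and p: "1 < p" and high: "n * (1 + l) + \<beta> > 1" and sub: "p < p_Str (n + \<beta> / (1 + l)) l"
  shows "gamma_poly (\<beta> / 2 * (p - 1)) n l p < 0"
proof -
  define N where "N = n + \<beta> / (1 + l)"
  define a where "a = N - 1 + l / (1 + l)"
  define b where "b = N + 1 - 3 * l / (1 + l)"
  define P where "P = p_Str N l"
  have "1 + l \<noteq> 0" using l by simp
  then have "a * (1 + l) = n * (1 + l) + \<beta> - 1"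
    by (simp add: a_def N_def distrib_right left_diff_distrib)
  then have "0 < a * (1 + l)" using high by simp
  then have a: "0 < a" using l by (simp add: zero_less_mult_iff)
  have P: "0 < P" "a * P\<^sup>2 - b * P - 2 = 0"
    using theI'[OF quadratic_unique_pos_root[OF a, of b]] by (simp_all add: P_def p_Str_def a_def b_def)
  have "p < P" using sub by (simp add: P_def N_def)
  \<comment> \<open>Eliminating \<open>b\<close> between the values at \<open>p\<close> and at the
    root \<open>P\<close> leaves \<open>p - P\<close> times a positive factor.\<close>
  have "P * (a * p\<^sup>2 - b * p - 2) = (p - P) * (a * p * P + 2) + p * (a * P\<^sup>2 - b * P - 2)"
    by (simp add: algebra_simps power2_eq_square)
  also have "\<dots> < 0"
    using P \<open>p < P\<close> a p by (simp add: mult_neg_pos add_pos_pos)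
  finally have "a * p\<^sup>2 - b * p - 2 < 0" using P(1) by (simp add: mult_less_0_iff)
  moreover have "gamma_poly (\<beta> / 2 * (p - 1)) n l p = a * p\<^sup>2 - b * p - 2"
    using l unfolding gamma_poly_def a_def b_def N_def
    by (simp add: divide_simps) (simp add: algebra_simps power2_eq_square)
  ultimately show ?thesis by simp
qed

text \<open>As k < 0, the inequality bounds \<tau> from above, and letting 3 \<tau> approach
  \<open>T\<close> bounds \<open>T\<close>. The maximum with 3 reflects the restriction \<tau> >=
  1.\<close>

lemma lifespan_from_inequality:
  fixes C p k :: real
  assumes p: "0 < p" and k: "k < 0" and C: "0 < C"
  shows "\<exists>C'>0. \<forall>\<epsilon> T. 0 < \<epsilon> \<and> (\<forall>\<tau>\<ge>1. ereal (3 * \<tau>) < T \<longrightarrow> \<epsilon> powr p \<le> C * \<tau> powr k) \<longrightarrow>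
    T \<le> ereal (max 3 (C' * \<epsilon> powr (p / k)))"
proof -
  \<comment> \<open>Equality in \<epsilon>^p <= C (t / 3)^k occurs at t = C' \<epsilon>^(p /
    k).\<close>
  define C' where "C' = 3 * C powr (- 1 / k)"
  have "T \<le> ereal (max 3 (C' * \<epsilon> powr (p / k)))"
    if \<epsilon>: "0 < \<epsilon>" and T: "\<And>\<tau>. 1 \<le> \<tau> \<Longrightarrow> ereal (3 * \<tau>) < T \<Longrightarrow> \<epsilon> powr p \<le> C * \<tau> powr k" for \<epsilon> T
  proof (rule ccontr)
    assume "\<not> T \<le> ereal (max 3 (C' * \<epsilon> powr (p / k)))"
    then have "ereal (max 3 (C' * \<epsilon> powr (p / k))) < T" by (simp only: not_le)
    \<comment> \<open>\<open>T\<close> may be infinite, so a real time strictly between the bound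
      and \<open>T\<close> is used.\<close>
    then obtain t where t: "ereal (max 3 (C' * \<epsilon> powr (p / k))) < ereal t" "ereal t < T"
      using ereal_dense2 by blast
    then have t': "3 < t" "C' * \<epsilon> powr (p / k) < t" by auto
    have "\<epsilon> powr p \<le> C * (t / 3) powr k" using T[of "t / 3"] t t' by simp
    then have "\<epsilon> powr p / C \<le> (t / 3) powr k" using C by (simp add: field_simps)
    then have "((t / 3) powr k) powr (1 / k) \<le> (\<epsilon> powr p / C) powr (1 / k)"
      using k \<epsilon> C by (intro powr_mono2') auto
    then have "t / 3 \<le> (\<epsilon> powr p / C) powr (1 / k)" using k t' by (simp add: powr_powr)
    also have "\<dots> = \<epsilon> powr (p / k) * C powr (- 1 / k)"
      using C \<epsilon> by (simp add: powr_divide powr_powr powr_minus_divide)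
    finally have "t \<le> C' * \<epsilon> powr (p / k)" by (simp add: C'_def mult_ac)
    then show False using t' by simp
  qed
  moreover have "0 < C'" using C by (simp add: C'_def)
  ultimately show ?thesis by blast
qed

theorem corollary6:
  fixes f g :: "real^'n \<Rightarrow> real" and l \<beta> \<mu> p :: real
  assumes "-1 < l" and "l < 0" and "0 \<le> \<beta>" and "1 < p"
    and "(1 - \<beta>)\<^sup>2 - 4 * \<mu>\<^sup>2 < 0"
    and "f \<in> Cc_infty" and "g \<in> Cc_infty"
    and "\<And>x. 0 \<le> f x" and "\<And>x. 0 \<le> g x"
    and "\<exists>x. f x \<noteq> 0 \<or> g x \<noteq> 0"
  shows
    "(real CARD('n) * (1 + l) + \<beta> \<le> 1 \<longrightarrow>
        (\<forall>\<epsilon>>0. \<forall>R\<^sub>0>0. tsupport f \<union> tsupport g \<subseteq> cball 0 R\<^sub>0 \<longrightarrow>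
           (\<nexists>w. weak_solution l \<beta> \<mu> p f g \<epsilon> R\<^sub>0 \<infinity> w)))
     \<and> (real CARD('n) * (1 + l) + \<beta> > 1 \<and> p < p_Str (real CARD('n) + \<beta> / (1 + l)) l \<longrightarrow>
        (\<forall>\<epsilon>>0. \<forall>R\<^sub>0>0. tsupport f \<union> tsupport g \<subseteq> cball 0 R\<^sub>0 \<longrightarrow>
           (\<nexists>w. weak_solution l \<beta> \<mu> p f g \<epsilon> R\<^sub>0 \<infinity> w)))
     \<and> (real CARD('n) * (1 + l) + \<beta> \<le> 1 \<or>
        (real CARD('n) * (1 + l) + \<beta> > 1 \<and> p < p_Str (real CARD('n) + \<beta> / (1 + l)) l) \<longrightarrow>
        (\<forall>R\<^sub>0>0. tsupport f \<union> tsupport g \<subseteq> cball 0 R\<^sub>0 \<longrightarrow>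
           (\<exists>\<epsilon>\<^sub>0>0. \<exists>C>0. \<forall>\<epsilon>. 0 < \<epsilon> \<and> \<epsilon> \<le> \<epsilon>\<^sub>0 \<longrightarrow>
              (\<forall>T w. weak_solution l \<beta> \<mu> p f g \<epsilon> R\<^sub>0 T w \<longrightarrow>
                 T \<le> ereal (C * \<epsilon> powr
                   (2 * p * (p - 1) /
                     ((1 + l) * gamma_poly (\<beta> / 2 * (p - 1)) (real CARD('n)) l p)))))))"
proof -
  define \<gamma> where "\<gamma> = gamma_poly (\<beta> / 2 * (p - 1)) (real CARD('n)) l p"
  define k where "k = (1 + l) * \<gamma> / (2 * (p - 1))"
  have k: "p / k = 2 * p * (p - 1) / ((1 + l) * \<gamma>)" by (simp add: k_def)
  have life: "\<exists>C>0. \<forall>\<epsilon> T w. 0 < \<epsilon> \<and> weak_solution l \<beta> \<mu> p f g \<epsilon> R\<^sub>0 T w \<longrightarrow>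
      T \<le> ereal (max 3 (C * \<epsilon> powr (p / k)))"
    if \<gamma>: "\<gamma> < 0" and R: "0 < R\<^sub>0" "tsupport f \<union> tsupport g \<subseteq> cball 0 R\<^sub>0" for R\<^sub>0
  proof -
    have k0: "k < 0" unfolding k_def using \<gamma> assms(1,4) by (intro divide_neg_pos mult_pos_neg) auto
    obtain C where C: "0 < C" "\<And>\<epsilon> T w \<tau>. 0 < \<epsilon> \<Longrightarrow> weak_solution l \<beta> \<mu> p f g \<epsilon> R\<^sub>0 T w \<Longrightarrow> 1 \<le> \<tau> \<Longrightarrow>
        ereal (3 * \<tau>) < T \<Longrightarrow> \<epsilon> powr p \<le> C * \<tau> powr k"
      using lifespan_inequality[OF assms R] unfolding k_def \<gamma>_def by blast
    obtain C' where "0 < C'" "\<And>\<epsilon> T. 0 < \<epsilon> \<Longrightarrow> (\<And>\<tau>. 1 \<le> \<tau> \<Longrightarrow> ereal (3 * \<tau>) < T \<Longrightarrow> \<epsilon> powr p \<le> C * \<tau> powr k) \<Longrightarrow>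
        T \<le> ereal (max 3 (C' * \<epsilon> powr (p / k)))"
      using lifespan_from_inequality[OF _ k0 C(1), of p] assms(4) by auto
    then show ?thesis using C(2) by blast
  qed
  have global: "\<not> weak_solution l \<beta> \<mu> p f g \<epsilon> R\<^sub>0 \<infinity> w"
    if h: "\<gamma> < 0" "0 < \<epsilon>" "0 < R\<^sub>0" "tsupport f \<union> tsupport g \<subseteq> cball 0 R\<^sub>0" for \<epsilon> R\<^sub>0 w
  proof
    assume "weak_solution l \<beta> \<mu> p f g \<epsilon> R\<^sub>0 \<infinity> w"
    \<comment> \<open>The bound before restricting \<epsilon> is already a real number for each
      positive \<epsilon>, which excludes an infinite lifespan.\<close>
    then obtain x where "\<infinity> \<le> ereal x" using life[OF h(1,3,4)] h(2) by blast
    then show False by simp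
  qed
  have lifespan: "\<exists>\<epsilon>\<^sub>0>0. \<exists>C>0. \<forall>\<epsilon>. 0 < \<epsilon> \<and> \<epsilon> \<le> \<epsilon>\<^sub>0 \<longrightarrow>
      (\<forall>T w. weak_solution l \<beta> \<mu> p f g \<epsilon> R\<^sub>0 T w \<longrightarrow> T \<le> ereal (C * \<epsilon> powr (p / k)))"
    if \<gamma>: "\<gamma> < 0" and R: "0 < R\<^sub>0" "tsupport f \<union> tsupport g \<subseteq> cball 0 R\<^sub>0" for R\<^sub>0
  proof -
    have k0: "k < 0" unfolding k_def using \<gamma> assms(1,4) by (intro divide_neg_pos mult_pos_neg) auto
    obtain C where C: "0 < C" "\<And>\<epsilon> T w. 0 < \<epsilon> \<Longrightarrow> weak_solution l \<beta> \<mu> p f g \<epsilon> R\<^sub>0 T w \<Longrightarrow>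
        T \<le> ereal (max 3 (C * \<epsilon> powr (p / k)))"
      using life[OF \<gamma> R] by blast
    \<comment> \<open>For \<epsilon> <= 1 the nonpositive exponent makes \<epsilon>^(p / k) at least
      1, so the constant 3 is absorbed into the factor 3 + C. Hence 1 serves as the threshold for
      \<epsilon>.\<close>
    have bound: "T \<le> ereal ((3 + C) * \<epsilon> powr (p / k))"
      if \<epsilon>: "0 < \<epsilon>" "\<epsilon> \<le> 1" and sol: "weak_solution l \<beta> \<mu> p f g \<epsilon> R\<^sub>0 T w" for \<epsilon> T w
    proof -
      have "p / k \<le> 0" using k0 assms(4) by (intro divide_nonneg_neg) auto
      then have "1 \<le> \<epsilon> powr (p / k)" using powr_mono2'[of "p / k" \<epsilon> 1] \<epsilon> by simp
      then have "3 * 1 \<le> (3 + C) * \<epsilon> powr (p / k)" using C(1) by (intro mult_mono) auto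
      moreover have "C * \<epsilon> powr (p / k) \<le> (3 + C) * \<epsilon> powr (p / k)" by (intro mult_right_mono) auto
      ultimately have "max 3 (C * \<epsilon> powr (p / k)) \<le> (3 + C) * \<epsilon> powr (p / k)" by simp
      then show ?thesis using C(2)[OF \<epsilon>(1) sol] order_trans ereal_less_eq(3) by blast
    qed
    have "0 < 3 + C \<and> (\<forall>\<epsilon>. 0 < \<epsilon> \<and> \<epsilon> \<le> 1 \<longrightarrow>
        (\<forall>T w. weak_solution l \<beta> \<mu> p f g \<epsilon> R\<^sub>0 T w \<longrightarrow> T \<le> ereal ((3 + C) * \<epsilon> powr (p / k))))"
      using bound C(1) by (auto simp del: ereal_max)
    then show ?thesis using zero_less_one by blast
  qed
  have neg: "\<gamma> < 0" if "real CARD('n) * (1 + l) + \<beta> \<le> 1 \<or>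
        (real CARD('n) * (1 + l) + \<beta> > 1 \<and> p < p_Str (real CARD('n) + \<beta> / (1 + l)) l)"
    using that gamma_poly_neg_low[OF assms(1-4)] gamma_poly_neg_subcritical[OF assms(1,4)]
    unfolding \<gamma>_def by (auto simp: Suc_le_eq)
  show ?thesis
    unfolding \<gamma>_def[symmetric] k[symmetric]
    using global lifespan neg by blast
qed

end
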